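(* The decision version of \textsc{Best Blue Response} is NP-complete, even if the recharging time is $\tau=\infty$ (i.e. each sensor can sense only one target), each target has value $1$, and the sum of each row and of each column of the sensing matrix is at most four.
   Context: An Escape Sensing Game (ESG) consists of: a finite set of targets $T=\{t_1,\dots,t_n\}$, each $t_i$ with a value $v_i\in\mathbb{R}^+$ (rational when part of a computational input); a finite set of sensors $S=\{s_1,\dots,s_k\}$; a recharging time $\tau\in\mathbb{N}\cup\{\infty\}$ common to all sensors; and a sensing matrix $D\in\{0,1\}^{n\times k}$, where $D_{i,j}=1$ means that sensor $s_j$ is capable of sensing target $t_i$. A target ordering is a bijection $\sigma:T\to[n]$. A sensing plan is a map $\psi:S\to 2^T$ with $\psi(s)\cap\psi(s')=\emptyset$ for all $s\neq s'\in S$. The plan $\psi$ is valid with respect to $\sigma$ if (i) for each $s_j\in S$ and $t_i\in\psi(s_j)$ we have $D_{i,j}=1$, and (ii) for each $s\in S$ and all distinct $t,t'\in\psi(s)$ we have $|\sigma(t)-\sigma(t')|>\tau$ (so if $\tau=\infty$ each sensor senses at most one target). The value of not-sensed targets is $v(\psi)=\sum_{t_i\in T\setminus\bigcup_{s\in S}\psi(s)}v_i$. Non-coordinated (greedy) sensing: the sensors have the fixed order $s_1,\dots,s_k$. Given $\sigma$, the target $\sigma^{-1}(i)$ passes sensor $s_j$ in step $i+j-1$, for $i\in[n]$, $j\in[k]$. The sensing plan $\psi_\sigma$ is built from the empty plan by going through the steps $\ell=1,\dots,n+k-1$: whenever target $t$ passes sensor $s_j$ in step $\ell$, add $t$ to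 $\psi_\sigma(s_j)$ if the resulting map is still a sensing plan (in particular $t$ has not been sensed before) that is valid with respect to $\sigma$. \textsc{Best Blue Response}: given an ESG with sensor order $s_1,\dots,s_k$, find a target ordering $\sigma$ maximizing $v(\psi_\sigma)$. Decision version: given additionally a threshold $\ell$, decide whether there is a target ordering $\sigma$ with $v(\psi_\sigma)\geq\ell$. *)

theory Defs
  imports
    Complex_Main
    "HOL-Computational_Algebra.Polynomial"
    "HOL-Library.Disjoint_Sets"
    "HOL-Library.Extended_Nat"
begin

section \<open>Polynomial time and NP\<close>

text \<open>
  Deterministic multi-tape Turing machines. The tapes are infinite in both directions; the
  symbols are \<open>0, \<dots>, num_syms - 1\<close> with \<open>0\<close> the blank and \<open>1\<close>, \<open>2\<close> the bits of inputs and
  outputs. The working states are \<open>0, \<dots>, num_states - 1\<close>, the start state is \<open>0\<close>, and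
  \<open>num_states\<close> itself is the halting state. The input is on the first tape and
  the output on the last one (the same tape if there is only one).
\<close>

datatype move = MoveLeft | Stay | MoveRight

record tm =
  num_tapes :: nat
  num_syms :: nat
  num_states :: nat
  trans :: "nat \<Rightarrow> nat list \<Rightarrow> nat \<times> (nat \<times> move) list"

definition wf_tm :: "tm \<Rightarrow> bool" where
  "wf_tm M \<longleftrightarrow> num_tapes M \<ge> 1 \<and> num_syms M \<ge> 3 \<and>
    (\<forall>q < num_states M. \<forall>rs. length rs = num_tapes M \<and> set rs \<subseteq> {..<num_syms M} \<longrightarrow>
       (case trans M q rs of (q', as) \<Rightarrow>
          q' \<le> num_states M \<and> length as = num_tapes M \<and> (\<forall>(a, m) \<in> set as. a < num_syms M)))"

type_synonym tape = "(int \<Rightarrow> nat) \<times> int"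
type_synonym config = "nat \<times> tape list"

fun shift :: "move \<Rightarrow> int" where
  "shift MoveLeft = -1"
| "shift Stay = 0"
| "shift MoveRight = 1"

definition read :: "tape \<Rightarrow> nat" where
  "read tp = fst tp (snd tp)"

fun act :: "nat \<times> move \<Rightarrow> tape \<Rightarrow> tape" where
  "act (a, m) (c, h) = (c(h := a), h + shift m)"

fun step :: "tm \<Rightarrow> config \<Rightarrow> config" where
  "step M (q, tps) =
    (if q < num_states M
     then (case trans M q (map read tps) of (q', as) \<Rightarrow> (q', map2 act as tps))
     else (q, tps))"

definition bit_sym :: "bool \<Rightarrow> nat" where
  "bit_sym b = (if b then 2 else 1)"

definition word_tape :: "bool list \<Rightarrow> tape" where
  "word_tape x =
    ((\<lambda>i. if 0 \<le> i \<and> i < int (length x) then bit_sym (x ! nat i) else 0), 0)"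

definition init_config :: "tm \<Rightarrow> bool list \<Rightarrow> config" where
  "init_config M x = (0, word_tape x # replicate (num_tapes M - 1) (word_tape []))"

text \<open>
  The output is the word that starts in cell \<open>0\<close> and ends before the next blank; the other
  cells and the head position are irrelevant.
\<close>

definition tape_output :: "tape \<Rightarrow> bool list \<Rightarrow> bool" where
  "tape_output tp y \<longleftrightarrow>
    (\<forall>i < length y. fst tp (int i) = bit_sym (y ! i)) \<and> fst tp (int (length y)) = 0"

definition halts_with :: "tm \<Rightarrow> config \<Rightarrow> bool list \<Rightarrow> bool" where
  "halts_with M c y \<longleftrightarrow> fst c = num_states M \<and> tape_output (last (snd c)) y"

definition polytime :: "(bool list \<Rightarrow> bool list) \<Rightarrow> bool" where
  "polytime f \<longleftrightarrow> (\<exists>M (p :: nat poly). wf_tm M \<and>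
    (\<forall>x. \<exists>t \<le> poly p (length x). halts_with M ((step M ^^ t) (init_config M x)) (f x)))"

text \<open>Self-delimiting code: every bit is preceded by \<open>True\<close>, and \<open>False\<close> ends the word.\<close>

definition delim :: "bool list \<Rightarrow> bool list" where
  "delim x = concat (map (\<lambda>b. [True, b]) x) @ [False]"

definition pair_word :: "bool list \<Rightarrow> bool list \<Rightarrow> bool list" where
  "pair_word x u = delim x @ u"

definition NP :: "bool list set set" where
  "NP = {L. \<exists>V (p :: nat poly). polytime V \<and>
    (\<forall>x. x \<in> L \<longleftrightarrow> (\<exists>u. length u \<le> poly p (length x) \<and> V (pair_word x u) = [True]))}"

definition poly_reducible :: "bool list set \<Rightarrow> bool list set \<Rightarrow> bool" where
  "poly_reducible L L' \<longleftrightarrow> (\<exists>f. polytime f \<and> (\<forall>x. x \<in> L \<longleftrightarrow> f x \<in> L'))"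

definition NP_hard :: "bool list set \<Rightarrow> bool" where
  "NP_hard L \<longleftrightarrow> (\<forall>L' \<in> NP. poly_reducible L' L)"

definition NP_complete :: "bool list set \<Rightarrow> bool" where
  "NP_complete L \<longleftrightarrow> L \<in> NP \<and> NP_hard L"


section \<open>Escape Sensing Games\<close>

text \<open>
  Target \<open>t\<^sub>i\<close> is the number \<open>i - 1\<close> and sensor \<open>s\<^sub>j\<close> the number \<open>j - 1\<close>, so that they index the
  lists below; the sensor order is the order of these numbers. Row \<open>t\<close> of \<open>sensing\<close> belongs to
  target \<open>t\<close>. Positions in a target ordering are \<open>1, \<dots>, n\<close>.
\<close>

record esg =
  target_values :: "rat list"
  num_sensors :: nat
  recharge :: enat
  sensing :: "bool list list"

definition num_targets :: "esg \<Rightarrow> nat" where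
  "num_targets G = length (target_values G)"

definition targets :: "esg \<Rightarrow> nat set" where
  "targets G = {..<num_targets G}"

definition sensors :: "esg \<Rightarrow> nat set" where
  "sensors G = {..<num_sensors G}"

definition wf_esg :: "esg \<Rightarrow> bool" where
  "wf_esg G \<longleftrightarrow> (\<forall>v \<in> set (target_values G). v > 0) \<and>
    length (sensing G) = num_targets G \<and> (\<forall>row \<in> set (sensing G). length row = num_sensors G)"

definition can_sense :: "esg \<Rightarrow> nat \<Rightarrow> nat \<Rightarrow> bool" where
  "can_sense G s t \<longleftrightarrow> sensing G ! t ! s"

definition target_ordering :: "esg \<Rightarrow> (nat \<Rightarrow> nat) \<Rightarrow> bool" where
  "target_ordering G \<sigma> \<longleftrightarrow> bij_betw \<sigma> (targets G) {1..num_targets G}"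

type_synonym plan = "nat \<Rightarrow> nat set"

definition sensing_plan :: "esg \<Rightarrow> plan \<Rightarrow> bool" where
  "sensing_plan G \<psi> \<longleftrightarrow>
    (\<forall>s \<in> sensors G. \<psi> s \<subseteq> targets G) \<and> disjoint_family_on \<psi> (sensors G)"

definition valid_plan :: "esg \<Rightarrow> (nat \<Rightarrow> nat) \<Rightarrow> plan \<Rightarrow> bool" where
  "valid_plan G \<sigma> \<psi> \<longleftrightarrow>
    (\<forall>s \<in> sensors G. \<forall>t \<in> \<psi> s. can_sense G s t) \<and>
    (\<forall>s \<in> sensors G. \<forall>t \<in> \<psi> s. \<forall>t' \<in> \<psi> s. t \<noteq> t' \<longrightarrow>
       recharge G < enat (nat \<bar>int (\<sigma> t) - int (\<sigma> t')\<bar>))"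

definition unsensed_value :: "esg \<Rightarrow> plan \<Rightarrow> rat" where
  "unsensed_value G \<psi> = (\<Sum>t \<in> targets G - (\<Union>s \<in> sensors G. \<psi> s). target_values G ! t)"

text \<open>
  The pairs (target, sensor) that meet in a given step: with sensors counted from \<open>0\<close>, the target
  at position \<open>i\<close> passes sensor \<open>j\<close> in step \<open>i + j\<close>. The targets and the sensors met in one step
  are pairwise distinct, so the order in which the pairs of one step are processed is immaterial.
\<close>

definition passes :: "esg \<Rightarrow> (nat \<Rightarrow> nat) \<Rightarrow> nat \<Rightarrow> (nat \<times> nat) list" where
  "passes G \<sigma> l = [(inv_into (targets G) \<sigma> i, j).
     j \<leftarrow> [0..<num_sensors G], i \<leftarrow> [1..<num_targets G + 1], i + j = l]"

fun try_sense :: "esg \<Rightarrow> (nat \<Rightarrow> nat) \<Rightarrow> nat \<times> nat \<Rightarrow> plan \<Rightarrow> plan" where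
  "try_sense G \<sigma> (t, s) \<psi> =
    (let \<psi>' = \<psi>(s := insert t (\<psi> s))
     in if sensing_plan G \<psi>' \<and> valid_plan G \<sigma> \<psi>' then \<psi>' else \<psi>)"

definition greedy_plan :: "esg \<Rightarrow> (nat \<Rightarrow> nat) \<Rightarrow> plan" where
  "greedy_plan G \<sigma> =
    fold (try_sense G \<sigma>)
      (concat (map (passes G \<sigma>) [1..<num_targets G + num_sensors G])) (\<lambda>_. {})"


section \<open>Best Blue Response as a language\<close>

definition best_blue_response :: "esg \<Rightarrow> rat \<Rightarrow> bool" where
  "best_blue_response G l \<longleftrightarrow>
    (\<exists>\<sigma>. target_ordering G \<sigma> \<and> unsensed_value G (greedy_plan G \<sigma>) \<ge> l)"

text \<open>Binary representation, least significant bit first and without leading zeros.\<close>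

fun binary :: "nat \<Rightarrow> bool list" where
  "binary n = (if n = 0 then [] else odd n # binary (n div 2))"

declare binary.simps [simp del]

definition enc_nat :: "nat \<Rightarrow> bool list" where
  "enc_nat n = delim (binary n)"

definition enc_enat :: "enat \<Rightarrow> bool list" where
  "enc_enat e = (case e of enat n \<Rightarrow> False # enc_nat n | \<infinity> \<Rightarrow> [True])"

definition enc_rat :: "rat \<Rightarrow> bool list" where
  "enc_rat r = (case quotient_of r of (a, b) \<Rightarrow> (a < 0) # enc_nat (nat \<bar>a\<bar>) @ enc_nat (nat b))"

definition enc_instance :: "esg \<Rightarrow> rat \<Rightarrow> bool list" where
  "enc_instance G l =
    enc_nat (num_targets G) @ enc_nat (num_sensors G) @ enc_enat (recharge G) @
    concat (map enc_rat (target_values G)) @ concat (sensing G) @ enc_rat l"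

definition BBR :: "bool list set" where
  "BBR = {enc_instance G l |G l. wf_esg G \<and> best_blue_response G l}"

definition row_sum :: "esg \<Rightarrow> nat \<Rightarrow> nat" where
  "row_sum G t = card {s \<in> sensors G. can_sense G s t}"

definition col_sum :: "esg \<Rightarrow> nat \<Rightarrow> nat" where
  "col_sum G s = card {t \<in> targets G. can_sense G s t}"

definition restricted_esg :: "esg \<Rightarrow> bool" where
  "restricted_esg G \<longleftrightarrow> recharge G = \<infinity> \<and> (\<forall>v \<in> set (target_values G). v = 1) \<and>
    (\<forall>t \<in> targets G. row_sum G t \<le> 4) \<and> (\<forall>s \<in> sensors G. col_sum G s \<le> 4)"

definition restricted_BBR :: "bool list set" where
  "restricted_BBR = {enc_instance G l |G l. wf_esg G \<and> restricted_esg G \<and> best_blue_response G l}"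


subsection \<open>The encoding is injective\<close>

lemma delim_append_inject: "delim x @ u = delim y @ w \<longleftrightarrow> x = y \<and> u = w"
proof (induction x arbitrary: y)
  case Nil
  then show ?case by (cases y) (auto simp: delim_def)
next
  case (Cons a x)
  then show ?case by (cases y) (auto simp: delim_def)
qed

lemma binary_inject: "binary m = binary n \<longleftrightarrow> m = n"
proof (induction m arbitrary: n rule: less_induct)
  case (less m)
  show ?case
  proof (cases "m = 0 \<or> n = 0")
    case True
    then show ?thesis by (subst (1 2) binary.simps) auto
  next
    case False
    then have "binary (m div 2) = binary (n div 2) \<longleftrightarrow> m div 2 = n div 2"
      using less.IH[of "m div 2" "n div 2"] by simp
    moreover have "m = n \<longleftrightarrow> (odd m \<longleftrightarrow> odd n) \<and> m div 2 = n div 2"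
      by presburger
    ultimately show ?thesis
      using False by (subst (1 2) binary.simps) auto
  qed
qed

lemma enc_nat_append_inject: "enc_nat m @ u = enc_nat n @ w \<longleftrightarrow> m = n \<and> u = w"
  by (simp add: enc_nat_def delim_append_inject binary_inject)

lemma enc_enat_append_inject: "enc_enat m @ u = enc_enat n @ w \<longleftrightarrow> m = n \<and> u = w"
  by (auto simp: enc_enat_def enc_nat_append_inject split: enat.splits)

lemma enc_rat_append_inject: "enc_rat r @ u = enc_rat s @ w \<longleftrightarrow> r = s \<and> u = w"
proof -
  obtain a b where r: "quotient_of r = (a, b)" by fastforce
  obtain c d where s: "quotient_of s = (c, d)" by fastforce
  have pos: "b > 0" "d > 0"
    using quotient_of_denom_pos r s by blast+
  have "r = s \<longleftrightarrow> a = c \<and> b = d"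
    using quotient_of_inject[of r s] r s by auto
  then show ?thesis
    using r s pos by (auto simp: enc_rat_def enc_nat_append_inject)
qed

lemma enc_rats_append_inject:
  "length rs = length ss \<Longrightarrow>
    concat (map enc_rat rs) @ u = concat (map enc_rat ss) @ w \<longleftrightarrow> rs = ss \<and> u = w"
  by (induction rs ss rule: list_induct2) (auto simp: enc_rat_append_inject)

lemma rows_append_inject:
  assumes "length A = length B" "\<forall>row \<in> set A. length row = k" "\<forall>row \<in> set B. length row = k"
  shows "concat A @ u = concat B @ w \<longleftrightarrow> A = B \<and> u = w"
  using assms by (induction A B rule: list_induct2) auto

lemma enc_instance_inject:
  assumes "wf_esg G" "wf_esg H"
  shows "enc_instance G l = enc_instance H l' \<longleftrightarrow> G = H \<and> l = l'"
proof
  assume eq: "enc_instance G l = enc_instance H l'"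
  then have n: "num_targets G = num_targets H" and k: "num_sensors G = num_sensors H"
    and tau: "recharge G = recharge H"
    and rest: "concat (map enc_rat (target_values G)) @ concat (sensing G) @ enc_rat l =
      concat (map enc_rat (target_values H)) @ concat (sensing H) @ enc_rat l'"
    by (simp_all add: enc_instance_def enc_nat_append_inject enc_enat_append_inject)
  have v: "target_values G = target_values H"
    and rest': "concat (sensing G) @ enc_rat l = concat (sensing H) @ enc_rat l'"
    using rest n enc_rats_append_inject by (auto simp: num_targets_def)
  have "sensing G = sensing H" "enc_rat l = enc_rat l'"
    using rest' rows_append_inject[of "sensing G" "sensing H" "num_sensors G"] assms n k
    by (auto simp: wf_esg_def)
  moreover have "l = l'"
    using \<open>enc_rat l = enc_rat l'\<close> enc_rat_append_inject[of l "[]" l' "[]"] by simp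
  ultimately show "G = H \<and> l = l'"
    using k tau v by simp
qed simp

end

theory Submission imports Defs begin

text \<open>
  Membership: a certificate contains the whole game, the threshold and the order in which the
  targets pass; the verifier encodes them again, compares the result with its input and simulates
  greedy sensing.

  Hardness: the runs of a polynomial time verifier satisfy clauses with four literals, and
  conversely a satisfying assignment contains an accepting run. Such clauses become a game with
  \<open>\<tau> = \<infinity>\<close>, where a sensor senses a target iff it meets one that is not sensed before. So Blue
  wants few sensors to be met at all: the four targets of a clause have three private sensors, hence
  one of them goes on to the sensor of its literal, which is met anyway iff the literal is true.

  Polynomial time: the functions computed in polynomial time by programs over binary stacks
  are closed under bounded iteration, hence under the usual operations on lists, and these
  programs compile to Turing machines with one tape for each stack.
\<close>

section \<open>Stack programs\<close>

text \<open>The threshold \<open>9 * m\<close> for \<open>m\<close> clauses is a count. With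
  \<open>N = 4 * m\<close> slots there are \<open>7 * N = 28 * m\<close> targets, and every ordering
  uses at least \<open>19 * m\<close> sensors: the \<open>3 * m\<close> private ones of the clauses,
  the \<open>3 * N\<close> that choose values and link copies, and one sensor \<open>V\<close> for
  each slot. If \<open>9 * m\<close> targets stay unsensed, no further sensor is used, so the used
  sensors \<open>V\<close> spell an assignment. Conversely, sorting the targets by their intended
  sensors gives the ordering. Column sums of at most four forbid one sensor for all occurrences of a
  literal. Hence every occurrence has its own copy of the variable, tied only to the previous one.
  Clauses of four literals fit the row sums (three private sensors and a literal) and also the
  clauses of a computation, which are implications with at most three premises; so no other
  NP-complete problem is needed in between. Programs hold naturals in unary, whereas values, \<tau>
  and the threshold come in binary and may be exponentially large; therefore the verifier calculates
  with bit lists.\<close>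

datatype com = Skip | Push nat bool | Pop nat | Seq com com (infixr ";;" 60)
  | Case nat com com com | While nat com

type_synonym store = "nat \<Rightarrow> bool list"

text \<open>\<open>n\<close> is an upper bound, which makes the relation monotone. It counts steps
  of the compiled machine: a push moves and writes, a test takes one step, and so does the jump that
  ends a branch or closes a loop.\<close>

inductive runs :: "com \<Rightarrow> store \<Rightarrow> nat \<Rightarrow> store \<Rightarrow> bool" where
  Skip: "runs Skip s n s"
| Push: "2 \<le> n \<Longrightarrow> runs (Push r b) s n (s(r := b # s r))"
| Pop: "1 \<le> n \<Longrightarrow> runs (Pop r) s n (s(r := tl (s r)))"
| Seq: "runs a s m s' \<Longrightarrow> runs b s' n s'' \<Longrightarrow> m + n \<le> k \<Longrightarrow> runs (a ;; b) s k s''"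
| Case_Nil: "s r = [] \<Longrightarrow> runs a s n s' \<Longrightarrow> n + 2 \<le> k \<Longrightarrow> runs (Case r a b c) s k s'"
| Case_False: "s r = False # w \<Longrightarrow> runs b s n s' \<Longrightarrow> n + 2 \<le> k \<Longrightarrow> runs (Case r a b c) s k s'"
| Case_True: "s r = True # w \<Longrightarrow> runs c s n s' \<Longrightarrow> n + 2 \<le> k \<Longrightarrow> runs (Case r a b c) s k s'"
| While_Nil: "s r = [] \<Longrightarrow> 1 \<le> k \<Longrightarrow> runs (While r c) s k s"
| While_Cons: "s r \<noteq> [] \<Longrightarrow> runs c s m s' \<Longrightarrow> runs (While r c) s' n s'' \<Longrightarrow> m + n + 2 \<le> k \<Longrightarrow>
    runs (While r c) s k s''"

lemma runs_mono: "runs c s n s' \<Longrightarrow> n \<le> n' \<Longrightarrow> runs c s n' s'"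
proof (erule runs.cases, goal_cases)
  case 1 then show ?case by (simp add: runs.Skip)
next
  case 2 then show ?case by (simp add: runs.Push)
next
  case 3 then show ?case by (simp add: runs.Pop)
next
  case 4 then show ?case by simp (erule (1) runs.Seq, linarith)
next
  case 5 then show ?case by simp (erule (1) runs.Case_Nil, linarith)
next
  case 6 then show ?case by simp (erule (1) runs.Case_False, linarith)
next
  case 7 then show ?case by simp (erule (1) runs.Case_True, linarith)
next
  case 8 then show ?case by (simp add: runs.While_Nil)
next
  case 9 then show ?case by simp (erule (2) runs.While_Cons, linarith)
qed

text \<open>A step lengthens a stack by at most one symbol. Hence time bounds are also size bounds,
  and compositions need no separate analysis of sizes.\<close>

lemma runs_length: "runs c s n s' \<Longrightarrow> length (s' r) \<le> length (s r) + n"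
proof (induction arbitrary: r rule: runs.induct)
  case (Seq a s m s' b n s'' k)
  show ?case using Seq.IH(1)[of r] Seq.IH(2)[of r] Seq.hyps by linarith
next
  case (While_Cons s r c m s' n s'' k r')
  show ?case using While_Cons.IH(1)[of r'] While_Cons.IH(2)[of r'] While_Cons.hyps by linarith
next
  case (Case_Nil s r' a n s' k b c)
  show ?case using Case_Nil.IH[of r] Case_Nil.hyps by linarith
next
  case (Case_False s r' w b n s' k a c)
  show ?case using Case_False.IH[of r] Case_False.hyps by linarith
next
  case (Case_True s r' w c n s' k a b)
  show ?case using Case_True.IH[of r] Case_True.hyps by linarith
qed auto

subsection \<open>Compilation to Turing machines\<close>

fun regs :: "com \<Rightarrow> nat set" where
  "regs Skip = {}"
| "regs (Push r b) = {r}"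
| "regs (Pop r) = {r}"
| "regs (a ;; b) = regs a \<union> regs b"
| "regs (Case r a b c) = {r} \<union> regs a \<union> regs b \<union> regs c"
| "regs (While r c) = {r} \<union> regs c"

lemma finite_regs: "finite (regs c)"
  by (induction c) auto

definition stay :: "nat list \<Rightarrow> (nat \<times> move) list" where
  "stay rs = map (\<lambda>a. (a, Stay)) rs"

fun csize :: "com \<Rightarrow> nat" where
  "csize Skip = 0"
| "csize (Push r b) = 2"
| "csize (Pop r) = 1"
| "csize (a ;; b) = csize a + csize b"
| "csize (Case r a b c) = csize a + csize b + csize c + 3"
| "csize (While r c) = csize c + 2"

text \<open>A stack lies on its tape with the top under the head and the bottom to the right, so that
  the input word is the stack of register \<open>0\<close>.\<close>

fun compile :: "com \<Rightarrow> nat \<Rightarrow> (nat list \<Rightarrow> nat \<times> (nat \<times> move) list) list" where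
  "compile Skip p = []"
| "compile (Push r b) p =
    [\<lambda>rs. (p + 1, (stay rs)[r := (rs ! r, MoveLeft)]), \<lambda>rs. (p + 2, (stay rs)[r := (bit_sym b, Stay)])]"
| "compile (Pop r) p =
    [\<lambda>rs. (p + 1, (stay rs)[r := (rs ! r, if rs ! r = 0 then Stay else MoveRight)])]"
| "compile (a ;; b) p = compile a p @ compile b (p + csize a)"
| "compile (Case r a b c) p =
    (\<lambda>rs. (if rs ! r = 0 then p + 1 else if rs ! r = 1 then p + csize a + 2
            else p + csize a + csize b + 3, stay rs)) #
    compile a (p + 1) @
    (\<lambda>rs. (p + csize a + csize b + csize c + 3, stay rs)) #
    compile b (p + csize a + 2) @
    (\<lambda>rs. (p + csize a + csize b + csize c + 3, stay rs)) #
    compile c (p + csize a + csize b + 3)"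
| "compile (While r c) p =
    (\<lambda>rs. (if rs ! r = 0 then p + csize c + 2 else p + 1, stay rs)) #
    compile c (p + 1) @ [\<lambda>rs. (p, stay rs)]"

lemma length_compile: "length (compile c p) = csize c"
  by (induction c arbitrary: p) auto

lemma compile_wf:
  assumes "f \<in> set (compile c p)" "regs c \<subseteq> {..<length rs}" "set rs \<subseteq> {..<3}"
  shows "fst (f rs) \<le> p + csize c \<and> length (snd (f rs)) = length rs \<and>
    (\<forall>x \<in> set (snd (f rs)). fst x < 3)"
proof -
  have upd: "\<forall>x \<in> set ((stay rs)[r := (a, m)]). fst x < 3" if "a < 3" for r a m
    using that assms(3) set_update_subset_insert[of "stay rs" r "(a, m)"]
    by (force simp: stay_def)
  have st: "\<forall>x \<in> set (stay rs). fst x < 3"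
    using assms(3) by (auto simp: stay_def)
  have nth: "rs ! r < 3" if "r < length rs" for r
    using that assms(3) nth_mem by blast
  have len: "length (stay rs) = length rs" by (simp add: stay_def)
  have bit: "bit_sym b < 3" for b by (simp add: bit_sym_def)
  show ?thesis
    using assms(1,2)
  proof (induction c arbitrary: p)
    case (Seq c1 c2)
    then consider "f \<in> set (compile c1 p)" | "f \<in> set (compile c2 (p + csize c1))" by auto
    then show ?case
      using Seq.prems Seq.IH(1)[of p] Seq.IH(2)[of "p + csize c1"] by cases auto
  next
    case (Case r a b c)
    then consider "f \<in> set (compile a (p + 1))" | "f \<in> set (compile b (p + csize a + 2))"
      | "f \<in> set (compile c (p + csize a + csize b + 3))"
      | "snd (f rs) = stay rs \<and> fst (f rs) \<le> p + csize (Case r a b c)" by force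
    then show ?case
      using Case.prems(2) Case.IH(1)[of "p + 1"] Case.IH(2)[of "p + csize a + 2"]
        Case.IH(3)[of "p + csize a + csize b + 3"] st len by cases auto
  next
    case (While r c)
    then consider "f \<in> set (compile c (p + 1))"
      | "snd (f rs) = stay rs \<and> fst (f rs) \<le> p + csize (While r c)" by force
    then show ?case
      using While.prems(2) While.IH[of "p + 1"] st len by cases auto
  next
    case (Push r b)
    then consider "f rs = (p + 1, (stay rs)[r := (rs ! r, MoveLeft)])"
      | "f rs = (p + 2, (stay rs)[r := (bit_sym b, Stay)])" by auto
    then show ?case
      using Push.prems(2) upd[of "rs ! r"] upd[OF bit] nth[of r] len by cases auto
  next
    case (Pop r)
    then show ?case using upd[of "rs ! r"] nth[of r] len by auto
  qed auto
qed

text \<open>Cells left of the head and beyond the first blank are unconstrained: a pop leaves its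
  symbol behind, and a later push overwrites it.\<close>

definition stack_on :: "tape \<Rightarrow> bool list \<Rightarrow> bool" where
  "stack_on tp w \<longleftrightarrow> (\<forall>i < length w. fst tp (snd tp + int i) = bit_sym (w ! i)) \<and>
    fst tp (snd tp + int (length w)) = 0"

lemma bit_sym_neq_0 [simp]: "bit_sym b \<noteq> 0" "0 \<noteq> bit_sym b" "0 < bit_sym b"
  by (auto simp: bit_sym_def)

lemma stack_on_read: "stack_on tp w \<Longrightarrow> read tp = (case w of [] \<Rightarrow> 0 | b # _ \<Rightarrow> bit_sym b)"
  by (cases w) (auto simp: stack_on_def read_def)

lemma stack_on_push:
  assumes "stack_on tp w"
  shows "stack_on (act (bit_sym b, Stay) (act (read tp, MoveLeft) tp)) (b # w)"
proof -
  obtain c h where tp: "tp = (c, h)" by fastforce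
  show ?thesis
    using assms by (auto simp: tp stack_on_def read_def nth_Cons split: nat.splits)
qed

lemma stack_on_pop:
  assumes "stack_on tp w"
  shows "stack_on (act (read tp, if read tp = 0 then Stay else MoveRight) tp) (tl w)"
proof (cases w)
  case Nil
  then show ?thesis
    using assms by (cases tp) (auto simp: stack_on_def read_def)
next
  case (Cons b v)
  obtain c h where tp: "tp = (c, h)" by fastforce
  have r: "read tp = bit_sym b" "read (c, h) = bit_sym b" "c(h := bit_sym b) = c"
    using stack_on_read[OF assms] Cons by (auto simp: tp read_def)
  have "c (h + 1 + int i) = bit_sym (v ! i)" if "i < length v" for i
    using assms that Cons unfolding stack_on_def tp
    by (auto dest!: spec[of _ "Suc i"] simp: algebra_simps)
  then show ?thesis
    using assms Cons unfolding tp by (auto simp: r stack_on_def algebra_simps)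
qed

lemma map2_act_update:
  assumes "r < length tps"
  shows "map2 act ((stay (map read tps))[r := x]) tps = tps[r := act x (tps ! r)]"
proof (rule nth_equalityI)
  fix i assume "i < length (map2 act ((stay (map read tps))[r := x]) tps)"
  then show "map2 act ((stay (map read tps))[r := x]) tps ! i = tps[r := act x (tps ! r)] ! i"
    using assms by (cases "tps ! i") (auto simp: stay_def nth_list_update read_def)
qed (simp add: stay_def)

lemma map2_act_stay: "map2 act (stay (map read tps)) tps = tps"
proof (rule nth_equalityI)
  fix i assume "i < length (map2 act (stay (map read tps)) tps)"
  then show "map2 act (stay (map read tps)) tps ! i = tps ! i"
    by (cases "tps ! i") (auto simp: stay_def read_def)
qed (simp add: stay_def)

definition reaches :: "tm \<Rightarrow> nat \<Rightarrow> config \<Rightarrow> config \<Rightarrow> bool" where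
  "reaches M n c c' \<longleftrightarrow> (\<exists>m\<le>n. (step M ^^ m) c = c')"

lemma reaches_refl: "reaches M n c c"
  unfolding reaches_def by (rule exI[of _ 0]) simp

lemma reaches_step: "step M c = c' \<Longrightarrow> reaches M 1 c c'"
  unfolding reaches_def by (rule exI[of _ 1]) simp

lemma reaches_trans:
  assumes "reaches M m a b" "reaches M n b c" "m + n \<le> k"
  shows "reaches M k a c"
proof -
  obtain i j where "i \<le> m" "j \<le> n" "(step M ^^ i) a = b" "(step M ^^ j) b = c"
    using assms by (auto simp: reaches_def)
  then show ?thesis
    using assms(3) unfolding reaches_def by (intro exI[of _ "j + i"]) (auto simp: funpow_add)
qed

lemma reaches_mono: "reaches M m a b \<Longrightarrow> m \<le> n \<Longrightarrow> reaches M n a b"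
  unfolding reaches_def using le_trans by blast

definition code_at :: "tm \<Rightarrow> nat \<Rightarrow> (nat list \<Rightarrow> nat \<times> (nat \<times> move) list) list \<Rightarrow> bool" where
  "code_at M p l \<longleftrightarrow> p + length l \<le> num_states M \<and> (\<forall>i < length l. trans M (p + i) = l ! i)"

lemma code_at_append:
  assumes "code_at M p (xs @ ys)"
  shows "code_at M p xs \<and> code_at M (p + length xs) ys"
proof -
  have "trans M (p + i) = (xs @ ys) ! i" if "i < length (xs @ ys)" for i
    using assms that unfolding code_at_def by blast
  from this this[of "length xs + i" for i] show ?thesis
    using assms by (auto simp: code_at_def nth_append add.assoc split: if_splits)
qed

lemma code_at_Cons:
  "code_at M p (x # xs) \<Longrightarrow> p < num_states M \<and> trans M p = x \<and> code_at M (Suc p) xs"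
  using code_at_append[of M p "[x]" xs] by (auto simp: code_at_def)

text \<open>Tape \<open>K\<close> stays blank during the program. The output has to start at cell
  \<open>0\<close>, whereas the stack of register \<open>0\<close> starts wherever its head happens
  to be; so it is finally copied to tape \<open>K\<close>.\<close>

definition stacks :: "nat \<Rightarrow> store \<Rightarrow> tape list \<Rightarrow> bool" where
  "stacks K s tps \<longleftrightarrow> length tps = K + 1 \<and> (\<forall>r<K. stack_on (tps ! r) (s r)) \<and> tps ! K = word_tape []"

lemma stacks_update:
  "stacks K s tps \<Longrightarrow> r < K \<Longrightarrow> stack_on tp w \<Longrightarrow> stacks K (s(r := w)) (tps[r := tp])"
  by (auto simp: stacks_def nth_list_update)

lemma step_stay:
  assumes "q < num_states M" "trans M q (map read tps) = (q', stay (map read tps))"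
  shows "reaches M 1 (q, tps) (q', tps)"
  by (rule reaches_step) (use assms in \<open>simp add: map2_act_stay\<close>)

lemma step_update:
  assumes "q < num_states M" "r < length tps"
    "trans M q (map read tps) = (q', (stay (map read tps))[r := x])"
  shows "reaches M 1 (q, tps) (q', tps[r := act x (tps ! r)])"
  by (rule reaches_step) (use assms in \<open>simp add: map2_act_update\<close>)

text \<open>State numbers serve as addresses. A finished fragment leaves the machine in the state
  just behind its code, so fragments compose by \<open>reaches_trans\<close>.\<close>

lemma compile_correct:
  assumes "runs c s n s'" "code_at M p (compile c p)" "regs c \<subseteq> {..<K}" "stacks K s tps"
  shows "\<exists>tps'. reaches M n (p, tps) (p + csize c, tps') \<and> stacks K s' tps'"
  using assms
proof (induction arbitrary: p tps rule: runs.induct)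
  case (Skip s n)
  then show ?case by (auto intro: reaches_refl)
next
  case (Push n r b s)
  let ?t1 = "tps[r := act (read (tps ! r), MoveLeft) (tps ! r)]"
  let ?t2 = "?t1[r := act (bit_sym b, Stay) (?t1 ! r)]"
  have r: "r < K" "r < length tps" using Push by (auto simp: stacks_def)
  note c0 = code_at_Cons[OF Push.prems(1)[unfolded compile.simps]]
  note c1 = code_at_Cons[OF conjunct2[OF conjunct2[OF c0]]]
  have c: "p < num_states M" "Suc p < num_states M"
    "trans M p = (\<lambda>rs. (p + 1, (stay rs)[r := (rs ! r, MoveLeft)]))"
    "trans M (Suc p) = (\<lambda>rs. (p + 2, (stay rs)[r := (bit_sym b, Stay)]))"
    using c0 c1 by simp_all
  have s1: "reaches M 1 (p, tps) (Suc p, ?t1)"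
    by (rule step_update) (use r c in auto)
  have s2: "reaches M 1 (Suc p, ?t1) (p + 2, ?t2)"
    by (rule step_update) (use r c in auto)
  have "stacks K (s(r := b # s r)) (tps[r := ?t2 ! r])"
    using r Push.prems stack_on_push[of "tps ! r" "s r" b]
    by (intro stacks_update) (auto simp: stacks_def)
  moreover have "tps[r := ?t2 ! r] = ?t2"
    using r by simp
  ultimately show ?case
    using reaches_trans[OF s1 s2] Push.hyps
    by (intro exI[of _ ?t2]) (simp del: fun_upd_apply)
next
  case (Pop n r s)
  let ?x = "(read (tps ! r), if read (tps ! r) = 0 then Stay else MoveRight)"
  let ?t = "tps[r := act ?x (tps ! r)]"
  have r: "r < K" "r < length tps" using Pop by (auto simp: stacks_def)
  have c: "p < num_states M"
    "trans M p = (\<lambda>rs. (p + 1, (stay rs)[r := (rs ! r, if rs ! r = 0 then Stay else MoveRight)]))"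
    using code_at_Cons[OF Pop.prems(1)[unfolded compile.simps]] by simp_all
  have "reaches M 1 (p, tps) (p + 1, ?t)"
    by (rule step_update) (use r c in auto)
  moreover have "stacks K (s(r := tl (s r))) ?t"
    using r Pop.prems stack_on_pop[of "tps ! r" "s r"]
    by (intro stacks_update) (auto simp: stacks_def)
  ultimately show ?case
    using Pop.hyps by (intro exI[of _ ?t]) (auto intro: reaches_mono simp del: fun_upd_apply)
next
  case (Seq a s m s' b n s'' k)
  have c: "code_at M p (compile a p)" "code_at M (p + csize a) (compile b (p + csize a))"
    using code_at_append[of M p "compile a p"] Seq.prems by (auto simp: length_compile)
  obtain t1 where t1: "reaches M m (p, tps) (p + csize a, t1)" "stacks K s' t1"
    using Seq.IH(1)[OF c(1) _ Seq.prems(3)] Seq.prems by auto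
  obtain t2 where t2: "reaches M n (p + csize a, t1) (p + csize a + csize b, t2)" "stacks K s'' t2"
    using Seq.IH(2)[OF c(2) _ t1(2)] Seq.prems by auto
  show ?case
    using reaches_trans[OF t1(1) t2(1) Seq.hyps(3)] t2(2) by (auto simp: add.assoc)
next
  case (Case_Nil s r a n s' k b c)
  let ?e = "p + csize a + csize b + csize c + 3"
  have r: "r < K" "r < length tps" "read (tps ! r) = 0"
    using Case_Nil stack_on_read[of "tps ! r" "s r"] by (auto simp: stacks_def)
  note c0 = code_at_Cons[OF Case_Nil.prems(1)[unfolded compile.simps]]
  note c1 = code_at_append[OF conjunct2[OF conjunct2[OF c0]], unfolded length_compile]
  note c2 = code_at_Cons[OF conjunct2[OF c1]]
  have s1: "reaches M 1 (p, tps) (p + 1, tps)"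
    by (rule step_stay) (use r c0 in auto)
  obtain t1 where t1: "reaches M n (p + 1, tps) (p + 1 + csize a, t1)" "stacks K s' t1"
    using Case_Nil.IH[of "p + 1" tps] c1 Case_Nil.prems by auto
  have s2: "reaches M 1 (p + 1 + csize a, t1) (?e, t1)"
    by (rule step_stay) (use r c2 in auto)
  have "reaches M (n + 2) (p, tps) (?e, t1)"
    using reaches_trans[OF reaches_trans[OF s1 t1(1) order_refl] s2 order_refl] by simp
  then show ?case using t1(2) reaches_mono[OF _ Case_Nil.hyps(3)] by (auto simp: ac_simps)
next
  case (Case_False s r w b n s' k a c)
  let ?e = "p + csize a + csize b + csize c + 3"
  have r: "r < K" "r < length tps" "read (tps ! r) = 1"
    using Case_False stack_on_read[of "tps ! r" "s r"] by (auto simp: stacks_def bit_sym_def)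
  note c0 = code_at_Cons[OF Case_False.prems(1)[unfolded compile.simps]]
  note c1 = code_at_append[OF conjunct2[OF conjunct2[OF c0]], unfolded length_compile]
  note c2 = code_at_Cons[OF conjunct2[OF c1]]
  note c3 = code_at_append[OF conjunct2[OF conjunct2[OF c2]], unfolded length_compile]
  note c4 = code_at_Cons[OF conjunct2[OF c3]]
  have s1: "reaches M 1 (p, tps) (p + csize a + 2, tps)"
    by (rule step_stay) (use r c0 in auto)
  obtain t1 where t1: "reaches M n (p + csize a + 2, tps) (p + csize a + 2 + csize b, t1)" "stacks K s' t1"
    using Case_False.IH[of "p + csize a + 2" tps] c3 Case_False.prems by auto
  have s2: "reaches M 1 (p + csize a + 2 + csize b, t1) (?e, t1)"
    by (rule step_stay) (use r c4 in auto)
  have "reaches M (n + 2) (p, tps) (?e, t1)"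
    using reaches_trans[OF reaches_trans[OF s1 t1(1) order_refl] s2 order_refl] by simp
  then show ?case using t1(2) reaches_mono[OF _ Case_False.hyps(3)] by (auto simp: ac_simps)
next
  case (Case_True s r w c n s' k a b)
  let ?e = "p + csize a + csize b + csize c + 3"
  have r: "r < K" "r < length tps" "read (tps ! r) = 2"
    using Case_True stack_on_read[of "tps ! r" "s r"] by (auto simp: stacks_def bit_sym_def)
  note c0 = code_at_Cons[OF Case_True.prems(1)[unfolded compile.simps]]
  note c1 = code_at_append[OF conjunct2[OF conjunct2[OF c0]], unfolded length_compile]
  note c2 = code_at_Cons[OF conjunct2[OF c1]]
  note c3 = code_at_append[OF conjunct2[OF conjunct2[OF c2]], unfolded length_compile]
  note c4 = code_at_Cons[OF conjunct2[OF c3]]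
  have s1: "reaches M 1 (p, tps) (p + csize a + csize b + 3, tps)"
    by (rule step_stay) (use r c0 in auto)
  have c5: "code_at M (p + csize a + csize b + 3) (compile c (p + csize a + csize b + 3))"
    using c4 by (simp add: eval_nat_numeral)
  obtain t1 where t1: "reaches M n (p + csize a + csize b + 3, tps) (?e, t1)" "stacks K s' t1"
    using Case_True.IH[OF c5 _ Case_True.prems(3)] Case_True.prems(2)
    by (auto simp del: compile.simps simp: add.assoc add.left_commute add.commute[of 3])
  have "reaches M (n + 2) (p, tps) (?e, t1)"
    using reaches_trans[OF s1 t1(1), of "n + 2"] by simp
  then show ?case using t1(2) reaches_mono[OF _ Case_True.hyps(3)] by (auto simp: ac_simps)
next
  case (While_Nil s r k c)
  have r: "r < K" "r < length tps" "read (tps ! r) = 0"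
    using While_Nil stack_on_read[of "tps ! r" "s r"] by (auto simp: stacks_def)
  note c0 = code_at_Cons[OF While_Nil.prems(1)[unfolded compile.simps]]
  have "reaches M 1 (p, tps) (p + csize c + 2, tps)"
    by (rule step_stay) (use r c0 in auto)
  then show ?case using While_Nil reaches_mono[of M 1 "(p, tps)" _ k] by auto
next
  case (While_Cons s r c m s' n s'' k)
  have r: "r < K" "r < length tps" "read (tps ! r) \<noteq> 0"
    using While_Cons stack_on_read[of "tps ! r" "s r"]
    by (auto simp: stacks_def split: list.splits)
  note c0 = code_at_Cons[OF While_Cons.prems(1)[unfolded compile.simps]]
  note c1 = code_at_append[OF conjunct2[OF conjunct2[OF c0]], unfolded length_compile]
  note c2 = code_at_Cons[OF conjunct2[OF c1]]
  have s1: "reaches M 1 (p, tps) (p + 1, tps)"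
    by (rule step_stay) (use r c0 in auto)
  obtain t1 where t1: "reaches M m (p + 1, tps) (p + 1 + csize c, t1)" "stacks K s' t1"
    using While_Cons.IH(1)[of "p + 1" tps] c1 While_Cons.prems by auto
  have s2: "reaches M 1 (p + 1 + csize c, t1) (p, t1)"
    by (rule step_stay) (use r c2 in auto)
  obtain t2 where t2: "reaches M n (p, t1) (p + csize (While r c), t2)" "stacks K s'' t2"
    using While_Cons.IH(2)[OF While_Cons.prems(1,2) t1(2)] by auto
  have "reaches M (m + n + 2) (p, tps) (p + csize (While r c), t2)"
    by (rule reaches_trans[OF reaches_trans[OF reaches_trans[OF s1 t1(1) order_refl] s2 order_refl] t2(1)]) simp
  from reaches_mono[OF this While_Cons.hyps(4)] show ?case using t2(2) by blast
qed

text \<open>After the program, one more state copies the stack of register \<open>0\<close> to the last tape.\<close>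

definition tm_of :: "com \<Rightarrow> nat \<Rightarrow> tm" where
  "tm_of c K = \<lparr>num_tapes = K + 1, num_syms = 3, num_states = csize c + 1,
    trans = (\<lambda>q rs. if q < csize c then (compile c 0 ! q) rs
      else if rs ! 0 = 0 then (csize c + 1, stay rs)
      else (csize c, (stay rs)[0 := (rs ! 0, MoveRight), K := (rs ! 0, MoveRight)]))\<rparr>"

lemma wf_tm_of:
  assumes "regs c \<subseteq> {..<K}"
  shows "wf_tm (tm_of c K)"
proof -
  have "case trans (tm_of c K) q rs of (q', as) \<Rightarrow> q' \<le> csize c + 1 \<and> length as = K + 1 \<and>
      (\<forall>(a, m) \<in> set as. a < 3)"
    if q: "q < csize c + 1" and rs: "length rs = K + 1" "set rs \<subseteq> {..<3}" for q rs
  proof (cases "q < csize c")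
    case True
    then have "compile c 0 ! q \<in> set (compile c 0)" by (simp add: length_compile)
    moreover have "regs c \<subseteq> {..<length rs}" using assms rs by auto
    ultimately have "fst ((compile c 0 ! q) rs) \<le> 0 + csize c \<and>
      length (snd ((compile c 0 ! q) rs)) = length rs \<and>
      (\<forall>x \<in> set (snd ((compile c 0 ! q) rs)). fst x < 3)"
      using compile_wf rs(2) by blast
    then show ?thesis
      using True rs(1) by (auto simp: tm_of_def split_def)
  next
    case False
    have "rs ! 0 \<in> set rs" by (rule nth_mem) (simp add: rs(1))
    then have "rs ! 0 < 3" using rs(2) by (meson lessThan_iff subsetD)
    then have "\<forall>x \<in> set ((stay rs)[0 := (rs ! 0, MoveRight), K := (rs ! 0, MoveRight)]). fst x < 3"
      using rs set_update_subset_insert[of "(stay rs)[0 := (rs ! 0, MoveRight)]" K "(rs ! 0, MoveRight)"]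
       set_update_subset_insert[of "stay rs" 0 "(rs ! 0, MoveRight)"]
      by (force simp: stay_def)
    then show ?thesis
      using False rs by (auto simp: tm_of_def stay_def)
  qed
  then show ?thesis by (simp add: wf_tm_def) (simp add: tm_of_def)
qed

lemma word_tape_stack_on: "stack_on (word_tape w) w"
  by (auto simp: stack_on_def word_tape_def)

text \<open>\<open>v\<close> is what has been copied so far, a generalization for the induction. The
  blanks behind \<open>v\<close> supply the end of the output, and one extra step detects the empty
  stack.\<close>

lemma output_phase:
  assumes "K > 0" "length tps = K + 1" "stack_on (tps ! 0) w"
    "snd (tps ! K) = int (length v)" "\<forall>i < length v. fst (tps ! K) (int i) = bit_sym (v ! i)"
    "\<forall>i \<ge> length v. fst (tps ! K) (int i) = 0"
  shows "\<exists>tps'. reaches (tm_of c K) (length w + 1) (csize c, tps) (csize c + 1, tps') \<and>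
    length tps' = K + 1 \<and> tape_output (tps' ! K) (v @ w)"
  using assms
proof (induction w arbitrary: v tps)
  case Nil
  have "read (tps ! 0) = 0" using stack_on_read[OF Nil.prems(3)] by simp
  moreover have "map read tps ! 0 = read (tps ! 0)" using Nil.prems(2) by (intro nth_map) simp
  ultimately have "reaches (tm_of c K) 1 (csize c, tps) (csize c + 1, tps)"
    by (intro step_stay) (simp_all add: tm_of_def)
  moreover have "tape_output (tps ! K) v" using Nil.prems(5,6) by (simp add: tape_output_def)
  ultimately show ?case using Nil.prems(2) by auto
next
  case (Cons b w)
  define t1 where "t1 = tps[0 := act (bit_sym b, MoveRight) (tps ! 0), K := act (bit_sym b, MoveRight) (tps ! K)]"
  have r: "read (tps ! 0) = bit_sym b"
    using stack_on_read[OF Cons.prems(3)] by simp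
  have m: "map2 act ((stay (map read tps))[0 := (bit_sym b, MoveRight), K := (bit_sym b, MoveRight)]) tps = t1"
  proof (rule nth_equalityI)
    fix i assume "i < length (map2 act ((stay (map read tps))[0 := (bit_sym b, MoveRight), K := (bit_sym b, MoveRight)]) tps)"
    then show "map2 act ((stay (map read tps))[0 := (bit_sym b, MoveRight), K := (bit_sym b, MoveRight)]) tps ! i = t1 ! i"
      using Cons.prems(1,2) by (cases "tps ! i") (auto simp: t1_def stay_def nth_list_update read_def)
  qed (simp add: stay_def t1_def)
  have nz: "map read tps ! 0 = bit_sym b" using r Cons.prems(2) nth_map[of 0 tps read] by simp
  have s1: "reaches (tm_of c K) 1 (csize c, tps) (csize c, t1)"
    by (rule reaches_step) (simp add: tm_of_def nz m)
  have "\<exists>tps'. reaches (tm_of c K) (length w + 1) (csize c, t1) (csize c + 1, tps') \<and>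
    length tps' = K + 1 \<and> tape_output (tps' ! K) ((v @ [b]) @ w)"
  proof (rule Cons.IH)
    show "stack_on (t1 ! 0) w"
      using stack_on_pop[OF Cons.prems(3)] Cons.prems(1,2) by (simp add: t1_def r)
    obtain f h where K: "tps ! K = (f, h)" by fastforce
    have 1: "t1 ! K = (f(h := bit_sym b), h + 1)" using Cons.prems(2) K by (simp add: t1_def)
    show "snd (t1 ! K) = int (length (v @ [b]))" using Cons.prems(4) 1 K by simp
    show "\<forall>i < length (v @ [b]). fst (t1 ! K) (int i) = bit_sym ((v @ [b]) ! i)"
      using Cons.prems(4,5) 1 K by (auto simp: nth_append less_Suc_eq)
    show "\<forall>i \<ge> length (v @ [b]). fst (t1 ! K) (int i) = 0"
      using Cons.prems(4,6) 1 K by auto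
    show "length t1 = K + 1" using Cons.prems(2) by (simp add: t1_def)
  qed (rule Cons.prems(1))
  then show ?case
    using reaches_trans[OF s1, of "length w + 1" _ "length (b # w) + 1"] by auto
qed

lemma finite_nat_bounded_pos:
  assumes "finite (X :: nat set)"
  shows "\<exists>K>0. X \<subseteq> {..<K}"
proof -
  obtain k where "X \<subseteq> {..<k}"
    using finite_nat_bounded[OF assms] by blast
  then have "X \<subseteq> {..<Suc k}" by auto
  then show ?thesis by blast
qed

lemma poly_nat_mono: "m \<le> n \<Longrightarrow> poly (p :: nat poly) m \<le> poly p n"
proof (induction p)
  case (pCons a p)
  then show ?case by (simp add: mult_le_mono)
qed simp

lemma polytime_of_com:
  assumes run: "\<And>x. runs c ((\<lambda>_. [])(0 := x)) (poly p (length x)) ((\<lambda>_. [])(0 := f x))"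
  shows "polytime f"
proof -
  obtain K where K: "regs c \<subseteq> {..<K}" "K > 0"
    using finite_nat_bounded_pos[OF finite_regs[of c]] by blast
  define M where "M = tm_of c K"
  \<comment> \<open>The program takes at most \<open>p\<close> steps, its result has at most
    \<open>length x + p\<close> symbols, and copying it takes one step more than it has
    symbols.\<close>
  define q where "q = p + ([:0, 1:] + p + 1)"
  have "\<exists>t \<le> poly q (length x). halts_with M ((step M ^^ t) (init_config M x)) (f x)" for x
  proof -
    let ?tps = "word_tape x # replicate K (word_tape [])"
    have st: "stacks K ((\<lambda>_. [])(0 := x)) ?tps"
      unfolding stacks_def
    proof (intro conjI allI impI)
      show "stack_on (?tps ! r) (((\<lambda>_. [])(0 := x)) r)" if "r < K" for r
        using that by (cases r) (simp_all add: word_tape_stack_on)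
      show "?tps ! K = word_tape []"
        using K(2) by (cases K) (simp_all del: replicate.simps)
    qed simp
    have code: "code_at M 0 (compile c 0)"
      unfolding code_at_def by (simp add: M_def tm_of_def length_compile)
    obtain t1 where t1: "reaches M (poly p (length x)) (0, ?tps) (csize c, t1)"
      "stacks K ((\<lambda>_. [])(0 := f x)) t1"
      using compile_correct[OF run[of x] code K(1) st] unfolding add_0 by blast
    have len: "length (f x) \<le> length x + poly p (length x)"
      using runs_length[OF run[of x], of 0] by simp
    have "\<exists>tps'. reaches M (length (f x) + 1) (csize c, t1) (csize c + 1, tps') \<and>
      length tps' = K + 1 \<and> tape_output (tps' ! K) ([] @ f x)"
      unfolding M_def by (rule output_phase) (use t1(2) K(2) in \<open>auto simp: stacks_def word_tape_def\<close>)
    then obtain t2 where t2: "reaches M (length (f x) + 1) (csize c, t1) (csize c + 1, t2)"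
      "length t2 = K + 1" "tape_output (t2 ! K) (f x)" unfolding append_Nil by blast
    have "reaches M (poly q (length x)) (0, ?tps) (csize c + 1, t2)"
      by (rule reaches_trans[OF t1(1) t2(1)]) (use len in \<open>simp add: q_def\<close>)
    then obtain t where "t \<le> poly q (length x)" "(step M ^^ t) (0, ?tps) = (csize c + 1, t2)"
      unfolding reaches_def by blast
    moreover have "init_config M x = (0, ?tps)" by (simp add: init_config_def M_def tm_of_def)
    moreover have "t2 \<noteq> []" using t2(2) by auto
    then have "last t2 = t2 ! K" using t2(2) by (simp add: last_conv_nth)
    ultimately show ?thesis
      using t2(3) unfolding halts_with_def
      by (intro exI[of _ t]) (simp add: M_def tm_of_def)
  qed
  then show ?thesis
    using wf_tm_of[OF K(1)] unfolding polytime_def M_def[symmetric] by blast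
qed

text \<open>Injectivity allows equality of values to be tested on their words.\<close>

class encoded =
  fixes word_of :: "'a \<Rightarrow> bool list"
  assumes word_of_inject: "word_of x = word_of y \<Longrightarrow> x = y"

abbreviation len :: "'a :: encoded \<Rightarrow> nat" where
  "len x \<equiv> length (word_of x)"

lemma word_of_eq_iff: "word_of x = word_of y \<longleftrightarrow> x = y"
  using word_of_inject by blast

lemma delim_simps [simp]: "delim [] = [False]" "delim (b # w) = True # b # delim w"
  by (simp_all add: delim_def)

lemma length_delim [simp]: "length (delim w) = 2 * length w + 1"
  by (induction w) auto

text \<open>\<open>Raw w\<close> is its own code, as needed for the input and output of a machine; a
  plain \<open>bool list\<close> spends three symbols on each bit.\<close>

datatype raw = Raw (unraw: "bool list")

instantiation raw :: encoded
begin
definition word_of_raw :: "raw \<Rightarrow> bool list" where "word_of r = unraw r"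
instance by standard (auto simp: word_of_raw_def raw.expand)
end

instantiation bool :: encoded
begin
definition word_of_bool :: "bool \<Rightarrow> bool list" where "word_of b = [b]"
instance by standard (simp add: word_of_bool_def)
end

text \<open>In unary, loop counters are words, addition is concatenation, and every number computed
  in polynomial time is polynomially bounded (\<open>pt_pb\<close>).\<close>

instantiation nat :: encoded
begin
definition word_of_nat :: "nat \<Rightarrow> bool list" where "word_of n = replicate n True"
instance by standard (simp add: word_of_nat_def)
end

instantiation prod :: (encoded, encoded) encoded
begin
definition word_of_prod :: "'a \<times> 'b \<Rightarrow> bool list" where
  "word_of x = delim (word_of (fst x)) @ word_of (snd x)"
instance
  by standard (auto simp: word_of_prod_def delim_append_inject word_of_eq_iff prod_eq_iff)
end

text \<open>As pairs delimit only their first component, a nonempty list has the same word as the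
  pair of its head and tail. So \<open>pt_Cons\<close> and \<open>pt_case_list\<close> reduce to
  pairing and projections.\<close>

instantiation list :: (encoded) encoded
begin
definition word_of_list :: "'a list \<Rightarrow> bool list" where
  "word_of xs = concat (map (\<lambda>x. delim (word_of x)) xs)"
instance
proof
  fix xs ys :: "'a list"
  have "delim w @ u \<noteq> []" for w u by (simp add: delim_def)
  then show "word_of xs = word_of ys \<Longrightarrow> xs = ys"
    unfolding word_of_list_def
  proof (induction xs arbitrary: ys)
    case Nil
    then show ?case by (cases ys) auto
  next
    case (Cons x xs)
    then show ?case by (cases ys) (auto simp: delim_append_inject word_of_eq_iff)
  qed
qed
end

lemma word_of_simps:
  "word_of (Raw w) = w" "word_of b = [b]" "word_of n = replicate n True"
  "word_of (x, y) = delim (word_of x) @ word_of y"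
  "word_of [] = []" "word_of (z # zs) = delim (word_of z) @ word_of zs"
  "word_of (zs @ zs') = word_of zs @ word_of zs'"
  by (simp_all add: word_of_raw_def word_of_bool_def word_of_nat_def word_of_prod_def word_of_list_def)

lemma len_simps:
  "len (Raw w) = length w" "len b = 1" "len n = n" "len (x, y) = 2 * len x + len y + 1"
  "len [] = 0" "len (z # zs) = 2 * len z + len zs + 1" "len (zs @ zs') = len zs + len zs'"
  for b :: bool and n :: nat
  by (simp_all add: word_of_simps)

subsection \<open>Polynomially bounded functions\<close>

definition pb_on :: "'a :: encoded set \<Rightarrow> ('a \<Rightarrow> nat) \<Rightarrow> bool" where
  "pb_on A g \<longleftrightarrow> (\<exists>p :: nat poly. \<forall>x\<in>A. g x \<le> poly p (len x))"

lemma pb_poly: "(\<And>x. x \<in> A \<Longrightarrow> g x \<le> poly p (len x)) \<Longrightarrow> pb_on A g"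
  by (auto simp: pb_on_def)

lemma pb_const: "pb_on A (\<lambda>_. k)"
  by (rule pb_poly[of _ _ "[:k:]"]) simp

lemma pb_len: "pb_on A (\<lambda>x. len x)"
  by (rule pb_poly[of _ _ "[:0, 1:]"]) simp

lemma pb_add: "pb_on A f \<Longrightarrow> pb_on A g \<Longrightarrow> pb_on A (\<lambda>x. f x + g x)"
  unfolding pb_on_def
proof (elim exE)
  fix p q :: "nat poly"
  assume "\<forall>x\<in>A. f x \<le> poly p (len x)" "\<forall>x\<in>A. g x \<le> poly q (len x)"
  then show "\<exists>r :: nat poly. \<forall>x\<in>A. f x + g x \<le> poly r (len x)"
    by (intro exI[of _ "p + q"]) (simp add: add_mono)
qed

lemma pb_mult: "pb_on A f \<Longrightarrow> pb_on A g \<Longrightarrow> pb_on A (\<lambda>x. f x * g x)"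
  unfolding pb_on_def
proof (elim exE)
  fix p q :: "nat poly"
  assume "\<forall>x\<in>A. f x \<le> poly p (len x)" "\<forall>x\<in>A. g x \<le> poly q (len x)"
  then show "\<exists>r :: nat poly. \<forall>x\<in>A. f x * g x \<le> poly r (len x)"
    by (intro exI[of _ "p * q"]) (simp add: mult_mono)
qed

lemma pb_Suc: "pb_on A f \<Longrightarrow> pb_on A (\<lambda>x. Suc (f x))"
  using pb_add[OF _ pb_const[of A 1]] by fastforce

lemma pb_le: "pb_on A g \<Longrightarrow> (\<And>x. x \<in> A \<Longrightarrow> f x \<le> g x) \<Longrightarrow> pb_on A f"
  unfolding pb_on_def by (meson le_trans)

lemma pb_comp_poly:
  assumes "pb_on A f"
  shows "pb_on A (\<lambda>x. poly (q :: nat poly) (f x))"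
proof -
  obtain p where "\<forall>x\<in>A. f x \<le> poly p (len x)" using assms by (auto simp: pb_on_def)
  then show ?thesis
    by (intro pb_poly[of _ _ "q \<circ>\<^sub>p p"]) (simp add: poly_pcompose poly_nat_mono)
qed

lemma pb_comp:
  assumes "pb_on B g" "pb_on A (\<lambda>x. len (f x))" "f ` A \<subseteq> B"
  shows "pb_on A (\<lambda>x. g (f x))"
proof -
  obtain q where "\<forall>x\<in>B. g x \<le> poly q (len x)" using assms(1) by (auto simp: pb_on_def)
  then show ?thesis
    using pb_le[OF pb_comp_poly[OF assms(2), of q]] assms(3) by (simp add: image_subset_iff)
qed

lemma pb_subset: "pb_on B g \<Longrightarrow> A \<subseteq> B \<Longrightarrow> pb_on A g"
  by (auto simp: pb_on_def)

lemmas pb_intros = pb_add pb_mult pb_Suc pb_const pb_len pb_comp_poly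

subsection \<open>Programs computing functions\<close>

text \<open>
  The argument is in register \<open>d\<close> and the result replaces it; the registers above \<open>d\<close> are empty
  before and after, and those below \<open>d\<close> are preserved, so programs can be nested by raising \<open>d\<close>.
\<close>

definition computes ::
  "(nat \<Rightarrow> com) \<Rightarrow> 'a :: encoded set \<Rightarrow> ('a \<Rightarrow> nat) \<Rightarrow> ('a \<Rightarrow> 'b :: encoded) \<Rightarrow> bool" where
  "computes c A g f \<longleftrightarrow> (\<forall>d s x. x \<in> A \<longrightarrow> s d = word_of x \<longrightarrow> (\<forall>r>d. s r = []) \<longrightarrow>
    runs (c d) s (g x) (s(d := word_of (f x))))"

text \<open>The set \<open>A\<close> serves functions that are controlled only on some arguments:
  branches of a conditional, \<open>hd\<close> and \<open>tl\<close> on nonempty lists, iterations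
  whose intermediate results are bounded only for certain starts.\<close>

definition pt_on :: "'a :: encoded set \<Rightarrow> ('a \<Rightarrow> 'b :: encoded) \<Rightarrow> bool" where
  "pt_on A f \<longleftrightarrow> (\<exists>c g. computes c A g f \<and> pb_on A g)"

abbreviation pt :: "('a :: encoded \<Rightarrow> 'b :: encoded) \<Rightarrow> bool" where
  "pt \<equiv> pt_on UNIV"

lemma computesD:
  "computes c A g f \<Longrightarrow> x \<in> A \<Longrightarrow> s d = word_of x \<Longrightarrow> (\<And>r. r > d \<Longrightarrow> s r = []) \<Longrightarrow>
    s' = s(d := word_of (f x)) \<Longrightarrow> runs (c d) s (g x) s'"
  by (simp add: computes_def)

lemma pt_onI:
  assumes "\<And>d s x. x \<in> A \<Longrightarrow> s d = word_of x \<Longrightarrow> (\<And>r. r > d \<Longrightarrow> s r = []) \<Longrightarrow>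
      runs (c d) s (g x) (s(d := word_of (f x)))"
    "pb_on A g"
  shows "pt_on A f"
  unfolding pt_on_def computes_def using assms by blast

lemma computes_len:
  assumes "computes c A g f" "x \<in> A"
  shows "len (f x) \<le> len x + g x"
  using runs_length[OF computesD[OF assms, of "(\<lambda>_. [])(0 := word_of x)" 0], of _ 0] by simp

lemma pt_on_pb_len:
  assumes "pt_on A f"
  shows "pb_on A (\<lambda>x. len (f x))"
proof -
  obtain c g where c: "computes c A g f" "pb_on A g" using assms by (auto simp: pt_on_def)
  show ?thesis
    by (rule pb_le[OF pb_add[OF pb_len c(2)]]) (rule computes_len[OF c(1)])
qed

lemma pt_on_subset: "pt_on B f \<Longrightarrow> A \<subseteq> B \<Longrightarrow> pt_on A f"
  unfolding pt_on_def computes_def using pb_subset by blast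

lemma pt_on_cong: "pt_on A f \<Longrightarrow> (\<And>x. x \<in> A \<Longrightarrow> f x = g x) \<Longrightarrow> pt_on A g"
  by (simp add: pt_on_def computes_def)

text \<open>Programs see only words. So a program for \<open>g\<close> also computes
  \<open>f\<close> if \<open>r\<close> changes the type of the argument but not its word.\<close>

lemma pt_on_recast:
  assumes "pt_on B g" "\<And>x. x \<in> A \<Longrightarrow> r x \<in> B \<and> word_of (r x) = word_of x \<and> word_of (g (r x)) = word_of (f x)"
  shows "pt_on A f"
proof -
  obtain c t where c: "computes c B t g" "pb_on B t" using assms by (auto simp: pt_on_def)
  show ?thesis
  proof (rule pt_onI)
    show "pb_on A (\<lambda>x. t (r x))"
      by (rule pb_comp[OF c(2) pb_le[OF pb_len]]) (use assms(2) in auto)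
    fix d :: nat and s :: store and x assume "x \<in> A" "s d = word_of x" "\<And>i. i > d \<Longrightarrow> s i = []"
    then show "runs (c d) s (t (r x)) (s(d := word_of (f x)))"
      using assms(2)[of x] by (intro computesD[OF c(1)]) auto
  qed
qed

lemma pt_on_cast: "(\<And>x. x \<in> A \<Longrightarrow> word_of (f x) = word_of x) \<Longrightarrow> pt_on A f"
  by (rule pt_onI[of _ "\<lambda>_. Skip" "\<lambda>_. 0"]) (auto intro: runs.Skip simp: pb_const fun_upd_idem)

lemma pt_on_comp:
  assumes "pt_on B g" "pt_on A f" "f ` A \<subseteq> B"
  shows "pt_on A (\<lambda>x. g (f x))"
proof -
  obtain c t where c: "computes c B t g" "pb_on B t" using assms by (auto simp: pt_on_def)
  obtain c' t' where c': "computes c' A t' f" "pb_on A t'" using assms by (auto simp: pt_on_def)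
  show ?thesis
  proof (rule pt_onI)
    show "pb_on A (\<lambda>x. t' x + t (f x))"
      using pb_add[OF c'(2) pb_comp[OF c(2) pt_on_pb_len[OF assms(2)] assms(3)]] .
    fix d :: nat and s :: store and x assume x: "x \<in> A" "s d = word_of x" "\<And>r. r > d \<Longrightarrow> s r = []"
    have fx: "f x \<in> B" using assms(3) x(1) by blast
    show "runs (c' d ;; c d) s (t' x + t (f x)) (s(d := word_of (g (f x))))"
      by (rule runs.Seq[OF computesD[OF c'(1) x(1), where d = d and s' = "s(d := word_of (f x))"]
            computesD[OF c(1) fx, where d = d]]) (use x in auto)
  qed
qed

lemma pt_comp: "pt g \<Longrightarrow> pt_on A f \<Longrightarrow> pt_on A (\<lambda>x. g (f x))"
  by (rule pt_on_comp) auto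

section \<open>Elementary stack programs\<close>

fun straight :: "com \<Rightarrow> bool" where
  "straight (a ;; b) \<longleftrightarrow> straight a \<and> straight b"
| "straight (Case r a b c) \<longleftrightarrow> False"
| "straight (While r c) \<longleftrightarrow> False"
| "straight _ \<longleftrightarrow> True"

fun effect :: "com \<Rightarrow> store \<Rightarrow> store" where
  "effect (Push r b) s = s(r := b # s r)"
| "effect (Pop r) s = s(r := tl (s r))"
| "effect (a ;; b) s = effect b (effect a s)"
| "effect _ s = s"

lemma runs_straight: "straight c \<Longrightarrow> csize c \<le> n \<Longrightarrow> s' = effect c s \<Longrightarrow> runs c s n s'"
proof (induction c arbitrary: s n s')
  case (Seq a b)
  show ?case
    by (rule runs.Seq[OF Seq.IH(1)[OF _ order_refl refl] Seq.IH(2)[OF _ order_refl]])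
      (use Seq.prems in auto)
qed (auto intro: runs.intros)

lemma runs_eqI: "runs c s n s' \<Longrightarrow> s' = s'' \<Longrightarrow> runs c s n s''"
  by simp

definition clear :: "nat \<Rightarrow> com" where
  "clear a = While a (Pop a)"

lemma runs_clear:
  assumes "3 * length (s a) + 1 \<le> n" "s' = s(a := [])"
  shows "runs (clear a) s n s'"
proof -
  have "runs (clear a) s (3 * length w + 1) (s(a := []))" if "s a = w" for w
    using that
  proof (induction w arbitrary: s)
    case Nil
    then show ?case unfolding clear_def
      using runs.While_Nil[of s a 1 "Pop a"] by (simp add: fun_upd_idem)
  next
    case (Cons b w)
    have 1: "runs (clear a) (s(a := w)) (3 * length w + 1) ((s(a := w))(a := []))"
      by (rule Cons.IH) simp
    have 2: "runs (Pop a) s 1 (s(a := w))"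
      by (rule runs_straight) (use Cons.prems in auto)
    show ?case
      unfolding clear_def
      by (rule runs.While_Cons[OF _ 2 1[unfolded clear_def], THEN runs_eqI]) (use Cons.prems in auto)
  qed
  then show ?thesis using assms runs_mono by blast
qed

definition each :: "nat \<Rightarrow> com \<Rightarrow> com \<Rightarrow> com" where
  "each a F T = While a (Case a Skip (Pop a ;; F) (Pop a ;; T))"

lemma runs_each_Nil: "s a = [] \<Longrightarrow> 1 \<le> n \<Longrightarrow> runs (each a F T) s n s"
  unfolding each_def by (rule runs.While_Nil)

lemma runs_each_Cons:
  assumes "s a = b # w" "runs (if b then T else F) (s(a := w)) m s'" "runs (each a F T) s' n s''"
    "m + n + 5 \<le> k"
  shows "runs (each a F T) s k s''"
proof -
  have 1: "runs (Pop a) s 1 (s(a := w))"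
    using runs.Pop[of 1 a s] assms(1) by simp
  have "runs (Case a Skip (Pop a ;; F) (Pop a ;; T)) s (m + 3) s'"
  proof (cases b)
    case True
    show ?thesis
      by (rule runs.Case_True[OF _ runs.Seq[OF 1, of T m s' "m + 1"]]) (use assms True in auto)
  next
    case False
    show ?thesis
      by (rule runs.Case_False[OF _ runs.Seq[OF 1, of F m s' "m + 1"]]) (use assms False in auto)
  qed
  then show ?thesis
    using assms(1,3,4) unfolding each_def by (elim runs.While_Cons[rotated]) auto
qed

definition mv :: "nat \<Rightarrow> nat \<Rightarrow> com" where
  "mv a b = each a (Push b False) (Push b True)"

lemma runs_mv:
  assumes "a \<noteq> b" "7 * length (s a) + 1 \<le> n" "s' = s(a := [], b := rev (s a) @ s b)"
  shows "runs (mv a b) s n s'"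
proof -
  have "runs (mv a b) s (7 * length w + 1) (s(a := [], b := rev (s a) @ s b))" if "s a = w" for w
    using that
  proof (induction w arbitrary: s)
    case Nil
    then show ?case
      using runs_each_Nil[of s a 1] by (simp add: mv_def fun_upd_idem)
  next
    case (Cons x w)
    let ?s = "s(a := w, b := x # s b)"
    have 1: "runs (if x then Push b True else Push b False) (s(a := w)) 2 ?s"
      using runs.Push[of 2 b x "s(a := w)"] assms(1) by (cases x) auto
    have "runs (mv a b) ?s (7 * length w + 1) (?s(a := [], b := rev (?s a) @ ?s b))"
      by (rule Cons.IH) (use assms(1) in simp)
    also have "?s(a := [], b := rev (?s a) @ ?s b) = s(a := [], b := rev (s a) @ s b)"
      using assms(1) Cons.prems by (auto simp: fun_eq_iff)
    finally show ?case
      unfolding mv_def by (rule runs_each_Cons[OF Cons.prems 1]) simp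
  qed
  then show ?thesis using assms runs_mono by blast
qed

definition mv2 :: "nat \<Rightarrow> nat \<Rightarrow> nat \<Rightarrow> com" where
  "mv2 a b c = each a (Push b False ;; Push c False) (Push b True ;; Push c True)"

lemma runs_mv2:
  assumes "a \<noteq> b" "a \<noteq> c" "b \<noteq> c" "9 * length (s a) + 1 \<le> n"
    "s' = s(a := [], b := rev (s a) @ s b, c := rev (s a) @ s c)"
  shows "runs (mv2 a b c) s n s'"
proof -
  have "runs (mv2 a b c) s (9 * length w + 1) (s(a := [], b := rev (s a) @ s b, c := rev (s a) @ s c))"
    if "s a = w" for w
    using that
  proof (induction w arbitrary: s)
    case Nil
    then show ?case
      using runs_each_Nil[of s a 1] by (simp add: mv2_def fun_upd_idem)
  next
    case (Cons x w)
    let ?s = "s(a := w, b := x # s b, c := x # s c)"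
    have 1: "runs (Push b x ;; Push c x) (s(a := w)) 4 ?s"
      by (rule runs_straight) (use assms(1-3) in auto)
    have "runs (mv2 a b c) ?s (9 * length w + 1) (?s(a := [], b := rev (?s a) @ ?s b, c := rev (?s a) @ ?s c))"
      by (rule Cons.IH) (use assms(1-3) in simp)
    also have "?s(a := [], b := rev (?s a) @ ?s b, c := rev (?s a) @ ?s c) =
        s(a := [], b := rev (s a) @ s b, c := rev (s a) @ s c)"
      using assms(1-3) Cons.prems by (auto simp: fun_eq_iff)
    finally have 2: "runs (mv2 a b c) ?s (9 * length w + 1)
        (s(a := [], b := rev (s a) @ s b, c := rev (s a) @ s c))" .
    show ?case
      unfolding mv2_def
      by (rule runs_each_Cons[where s = s and a = a and b = x and w = w and m = 4, OF Cons.prems _ 2[unfolded mv2_def]])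
        (use 1 in \<open>cases x; simp\<close>)+
  qed
  then show ?thesis using assms runs_mono by blast
qed

lemma runs_Seq: "runs a s m s' \<Longrightarrow> runs b s' n s'' \<Longrightarrow> k = m + n \<Longrightarrow> runs (a ;; b) s k s''"
  by (simp add: runs.Seq)

definition copy :: "nat \<Rightarrow> nat \<Rightarrow> nat \<Rightarrow> com" where
  "copy a b t = (mv a t ;; mv2 t a b)"

lemma runs_copy:
  assumes "a \<noteq> b" "a \<noteq> t" "b \<noteq> t" "s b = []" "s t = []" "16 * length (s a) + 2 \<le> n"
    "s' = s(b := s a)"
  shows "runs (copy a b t) s n s'"
proof -
  have "runs (copy a b t) s ((7 * length (s a) + 1) + (9 * length (s a) + 1)) s'"
    unfolding copy_def
    by (rule runs_Seq[OF runs_mv[where s' = "s(a := [], t := rev (s a))"] runs_mv2])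
      (use assms in \<open>auto simp: fun_eq_iff\<close>)
  then show ?thesis using assms(6) by (elim runs_mono) simp
qed

definition pushes :: "nat \<Rightarrow> bool list \<Rightarrow> com" where
  "pushes a w = foldr (\<lambda>b c. c ;; Push a b) w Skip"

lemma runs_pushes: "runs (pushes a w) s (2 * length w) (s(a := w @ s a))"
proof (induction w)
  case Nil
  then show ?case by (simp add: pushes_def runs.Skip fun_upd_idem)
next
  case (Cons b w)
  show ?case
    using runs_Seq[OF Cons runs.Push[of 2 a b "s(a := w @ s a)"] refl]
    by (simp add: pushes_def del: fun_upd_apply) (simp add: fun_upd_def)
qed

lemma pt_const: "pt_on A (\<lambda>_. k)"
proof (rule pt_onI)
  show "pb_on A (\<lambda>x. (3 * len x + 1) + 2 * len k)" by (intro pb_intros)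
  fix d :: nat and s :: store and x assume "s d = word_of x"
  then show "runs (clear d ;; pushes d (word_of k)) s ((3 * len x + 1) + 2 * len k) (s(d := word_of k))"
    by (intro runs_Seq[OF runs_clear[OF order_refl refl]])
      (use runs_pushes[of d "word_of k" "s(d := [])"] in auto)
qed

text \<open>On a stack the code is built from its end: the end mark first, then the bits, the last
  one first. Hence the argument has to be reversed, which is how one \<open>mv\<close> leaves
  it.\<close>

definition recode :: "nat \<Rightarrow> nat \<Rightarrow> com" where
  "recode a b = (Push b False ;;
     each a (Push b False ;; Push b True) (Push b True ;; Push b True))"

lemma runs_recode:
  assumes "a \<noteq> b" "9 * length (s a) + 3 \<le> n" "s' = s(a := [], b := delim (rev (s a)) @ s b)"
  shows "runs (recode a b) s n s'"
proof -
  let ?c = "each a (Push b False ;; Push b True) (Push b True ;; Push b True)"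
  have "runs ?c s (9 * length w + 1) (s(a := [], b := delim (rev w @ v) @ u))"
    if "s a = w" "s b = delim v @ u" for s w v u
    using that
  proof (induction w arbitrary: s v)
    case Nil
    then show ?case
      using runs_each_Nil[of s a 1] by (simp add: fun_upd_idem)
  next
    case (Cons x w)
    let ?s = "s(a := w, b := True # x # s b)"
    have 1: "runs (Push b x ;; Push b True) (s(a := w)) 4 ?s"
      by (rule runs_straight) (use assms(1) in auto)
    have "runs ?c ?s (9 * length w + 1) (?s(a := [], b := delim (rev w @ x # v) @ u))"
      by (rule Cons.IH) (use assms(1) Cons.prems in simp_all)
    also have "?s(a := [], b := delim (rev w @ x # v) @ u) = s(a := [], b := delim (rev (x # w) @ v) @ u)"
      using assms(1) Cons.prems by (auto simp: fun_eq_iff)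
    finally have 2: "runs ?c ?s (9 * length w + 1) (s(a := [], b := delim (rev (x # w) @ v) @ u))" .
    show ?case
      by (rule runs_each_Cons[where s = s and a = a and b = x and w = w and m = 4, OF Cons.prems(1) _ 2]) (use 1 in \<open>cases x; simp\<close>)+
  qed
  from this[of "s(b := False # s b)" "s a" "[]" "s b"]
  have 1: "runs ?c (s(b := False # s b)) (9 * length (s a) + 1) (s(b := False # s b, a := [], b := delim (rev (s a)) @ s b))"
    using assms(1) by (simp del: fun_upd_apply) (simp add: fun_upd_def)
  have 2: "runs (Push b False) s 2 (s(b := False # s b))" by (rule runs_straight) auto
  show ?thesis unfolding assms(3) recode_def
    by (rule runs_eqI[OF runs.Seq[OF 2 1]]) (use assms in \<open>auto simp: fun_eq_iff\<close>)
qed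

lemma pt_Pair:
  assumes "pt_on A f" "pt_on A g"
  shows "pt_on A (\<lambda>x. (f x, g x))"
proof -
  obtain c t where c: "computes c A t f" "pb_on A t" using assms by (auto simp: pt_on_def)
  obtain c' t' where c': "computes c' A t' g" "pb_on A t'" using assms by (auto simp: pt_on_def)
  \<comment> \<open>Programs consume their argument, so \<open>x\<close> is copied before each call.
    The result of \<open>f\<close> is moved once and thus reversed for \<open>recode\<close>, which
    puts its code on top of the result of \<open>g\<close>; two more moves bring everything back to
    \<open>d\<close> in the right order.\<close>
  let ?P = "\<lambda>d. copy d (d+1) (d+2) ;; c (d+1) ;; copy d (d+2) (d+3) ;; c' (d+2) ;; clear d ;;
    mv (d+1) (d+3) ;; recode (d+3) (d+2) ;; mv (d+2) (d+3) ;; mv (d+3) d"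
  let ?T = "\<lambda>x. (16 * len x + 2) + (t x + ((16 * len x + 2) + (t' x + ((3 * len x + 1) +
    ((7 * len (f x) + 1) + ((9 * len (f x) + 3) + ((7 * len (f x, g x) + 1) + (7 * len (f x, g x) + 1))))))))"
  show ?thesis
  proof (rule pt_onI)
    show "pb_on A ?T"
      unfolding len_simps by (intro pb_intros c c' assms[THEN pt_on_pb_len])
    fix d :: nat and s :: store and x assume x: "x \<in> A" "s d = word_of x" "\<And>r. r > d \<Longrightarrow> s r = []"
    let ?x = "word_of x" and ?f = "word_of (f x)" and ?g = "word_of (g x)"
    let ?fg = "word_of (f x, g x)"
    show "runs (?P d) s (?T x) (s(d := ?fg))"
      apply (rule runs_Seq[OF runs_copy[where s' = "s(d+1 := ?x)"]])
               apply (use x in \<open>auto\<close>)[7]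
       apply (rule runs_Seq[OF computesD[OF c(1) x(1), where s' = "s(d+1 := ?f)"]])
           apply (use x in \<open>auto\<close>)[3]
        apply (rule runs_Seq[OF runs_copy[where s' = "s(d+1 := ?f, d+2 := ?x)"]])
                apply (use x in \<open>auto\<close>)[7]
         apply (rule runs_Seq[OF computesD[OF c'(1) x(1), where s' = "s(d+1 := ?f, d+2 := ?g)"]])
            apply (use x in \<open>auto\<close>)[3]
          apply (rule runs_Seq[OF runs_clear[where s' = "s(d+1 := ?f, d+2 := ?g, d := [])"]])
            apply (use x in \<open>auto\<close>)[2]
           apply (rule runs_Seq[OF runs_mv[where s' = "s(d+2 := ?g, d := [], d+3 := rev ?f)"]])
              apply (use x in \<open>auto simp: fun_eq_iff\<close>)[3]
            apply (rule runs_Seq[OF runs_recode[where s' = "s(d+2 := ?fg, d := [])"]])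
               apply (use x in \<open>auto simp: fun_eq_iff word_of_simps\<close>)[3]
             apply (rule runs_Seq[OF runs_mv[where s' = "s(d := [], d+3 := rev ?fg)"]])
                apply (use x in \<open>auto simp: fun_eq_iff\<close>)[3]
              apply (rule runs_mv)
      using x by (auto simp: fun_eq_iff)
  qed
qed

text \<open>The flag in \<open>d+2\<close> keeps the loop running until the end mark is read. The
  first component arrives reversed in \<open>d+1\<close>, and the second one is what remains in
  \<open>d\<close>.\<close>

definition unpair :: "nat \<Rightarrow> com" where
  "unpair d = (Push (d+2) True ;;
    While (d+2) (Case d Skip (Pop d ;; Pop (d+2))
      (Pop d ;; Case d Skip (Pop d ;; Push (d+1) False) (Pop d ;; Push (d+1) True))))"

lemma runs_unpair:
  assumes "s d = delim a @ b" "s (d+2) = []" "10 * length a + 10 \<le> n"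
    "s' = s(d := b, d+1 := rev a @ s (d+1))"
  shows "runs (unpair d) s n s'"
proof -
  let ?c = "Case d Skip (Pop d ;; Pop (d+2))
      (Pop d ;; Case d Skip (Pop d ;; Push (d+1) False) (Pop d ;; Push (d+1) True))"
  have loop: "runs (While (d+2) ?c) s (10 * length a + 8) (s(d := b, d+2 := [], d+1 := rev a @ s (d+1)))"
    if "s d = delim a @ b" "s (d+2) = [True]" for s
    using that
  proof (induction a arbitrary: s)
    case Nil
    have "runs (Pop d ;; Pop (d+2)) s 2 (s(d := b, d+2 := []))"
      by (rule runs_straight) (use Nil in \<open>auto simp: fun_eq_iff\<close>)
    then have "runs ?c s 4 (s(d := b, d+2 := []))"
      using Nil by (intro runs.Case_False[where n = 2 and w = b]) simp_all
    moreover have "runs (While (d+2) ?c) (s(d := b, d+2 := [])) 1 (s(d := b, d+2 := []))"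
      by (rule runs.While_Nil) auto
    ultimately have "runs (While (d+2) ?c) s 8 (s(d := b, d+2 := []))"
      by (rule runs.While_Cons[rotated]) (use Nil in auto)
    then show ?case by (rule runs_eqI[OF runs_mono]) (auto simp: fun_eq_iff)
  next
    case (Cons x a)
    let ?s = "s(d := delim a @ b, d+1 := x # s (d+1))"
    have 1: "runs (Pop d) s 1 (s(d := x # delim a @ b))"
      by (rule runs_straight) (use Cons.prems in auto)
    have 2: "runs (Pop d ;; Push (d+1) x) (s(d := x # delim a @ b)) 3 ?s"
      by (rule runs_straight) (auto simp: fun_eq_iff)
    have "runs (Case d Skip (Pop d ;; Push (d+1) False) (Pop d ;; Push (d+1) True)) (s(d := x # delim a @ b)) 5 ?s"
    proof (cases x)
      case True
      then show ?thesis using 2 by (intro runs.Case_True[where n = 3]) auto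
    next
      case False
      then show ?thesis using 2 by (intro runs.Case_False[where n = 3]) auto
    qed
    from runs.Seq[OF 1 this order_refl] have 3: "runs ?c s 8 ?s"
      using Cons.prems(1) by (intro runs.Case_True[where n = 6 and w = "x # delim a @ b"]) simp_all
    have "runs (While (d+2) ?c) ?s (10 * length a + 8) (?s(d := b, d+2 := [], d+1 := rev a @ ?s (d+1)))"
      by (rule Cons.IH) (use Cons.prems in auto)
    also have "?s(d := b, d+2 := [], d+1 := rev a @ ?s (d+1)) = s(d := b, d+2 := [], d+1 := rev (x # a) @ s (d+1))"
      by (auto simp: fun_eq_iff)
    finally have 4: "runs (While (d+2) ?c) ?s (10 * length a + 8) (s(d := b, d+2 := [], d+1 := rev (x # a) @ s (d+1)))" .
    show ?case
      by (rule runs.While_Cons[OF _ 3 4]) (use Cons.prems(2) in auto)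
  qed
  have 1: "runs (While (d+2) ?c) (s(d+2 := [True])) (10 * length a + 8)
      (s(d+2 := [True], d := b, d+2 := [], d+1 := rev a @ s (d+1)))"
    by (rule runs_eqI[OF loop]) (use assms(1) in auto)
  have 2: "runs (Push (d+2) True) s 2 (s(d+2 := [True]))" by (rule runs_straight) (use assms in auto)
  show ?thesis unfolding assms(4) unpair_def
    by (rule runs_eqI[OF runs.Seq[OF 2 1]]) (use assms in \<open>auto simp: fun_eq_iff\<close>)
qed

lemma pt_fst0: "pt (\<lambda>x :: 'a :: encoded \<times> 'b :: encoded. fst x)"
proof (rule pt_onI)
  show "pb_on UNIV (\<lambda>x :: 'a \<times> 'b. (10 * len x + 10) + ((3 * len x + 1) + (7 * len x + 1)))"
    by (intro pb_intros)
  fix d :: nat and s :: store and x :: "'a \<times> 'b" assume x: "s d = word_of x" "\<And>r. r > d \<Longrightarrow> s r = []"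
  show "runs (unpair d ;; clear d ;; mv (d+1) d) s ((10 * len x + 10) + ((3 * len x + 1) + (7 * len x + 1)))
      (s(d := word_of (fst x)))"
    apply (rule runs_Seq[OF runs_unpair[where a = "word_of (fst x)" and b = "word_of (snd x)"]])
         apply (use x in \<open>auto simp: word_of_prod_def\<close>)[4]
     apply (rule runs_Seq[OF runs_clear[where s' = "s(d := [], d+1 := rev (word_of (fst x)))"]])
       apply (use x in \<open>auto simp: fun_eq_iff word_of_prod_def\<close>)[2]
      apply (rule runs_mv)
    using x by (auto simp: fun_eq_iff word_of_prod_def)
qed

lemma pt_snd0: "pt (\<lambda>x :: 'a :: encoded \<times> 'b :: encoded. snd x)"
proof (rule pt_onI)
  show "pb_on UNIV (\<lambda>x :: 'a \<times> 'b. (10 * len x + 10) + (3 * len x + 1))"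
    by (intro pb_intros)
  fix d :: nat and s :: store and x :: "'a \<times> 'b" assume x: "s d = word_of x" "\<And>r. r > d \<Longrightarrow> s r = []"
  show "runs (unpair d ;; clear (d+1)) s ((10 * len x + 10) + (3 * len x + 1)) (s(d := word_of (snd x)))"
    apply (rule runs_Seq[OF runs_unpair[where a = "word_of (fst x)" and b = "word_of (snd x)"]])
         apply (use x in \<open>auto simp: word_of_prod_def\<close>)[4]
     apply (rule runs_clear)
    using x by (auto simp: fun_eq_iff word_of_prod_def)
qed

text \<open>Stated for any \<open>h\<close> that appends words, since this covers concatenation of
  lists, addition of unary numbers and concatenation of raw words.\<close>

lemma pt_append0:
  assumes "\<And>x y. word_of (h x y) = word_of x @ word_of y"
  shows "pt (\<lambda>x :: 'a :: encoded \<times> 'b :: encoded. h (fst x) (snd x))"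
proof (rule pt_onI)
  show "pb_on UNIV (\<lambda>x :: 'a \<times> 'b. (10 * len x + 10) + (7 * len x + 1))"
    by (intro pb_intros)
  fix d :: nat and s :: store and x :: "'a \<times> 'b" assume x: "s d = word_of x" "\<And>r. r > d \<Longrightarrow> s r = []"
  show "runs (unpair d ;; mv (d+1) d) s ((10 * len x + 10) + (7 * len x + 1)) (s(d := word_of (h (fst x) (snd x))))"
    apply (rule runs_Seq[OF runs_unpair[where a = "word_of (fst x)" and b = "word_of (snd x)"]])
         apply (use x in \<open>auto simp: word_of_prod_def\<close>)[4]
     apply (rule runs_mv)
    using x by (auto simp: fun_eq_iff word_of_prod_def assms)
qed

lemma pt_If:
  assumes "pt_on A b" "pt_on {x \<in> A. b x} f" "pt_on {x \<in> A. \<not> b x} g"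
  shows "pt_on A (\<lambda>x. if b x then f x else g x)"
proof -
  let ?F = "{x \<in> A. b x}" and ?G = "{x \<in> A. \<not> b x}"
  obtain c0 t0 where c0: "computes c0 A t0 b" "pb_on A t0" using assms by (auto simp: pt_on_def)
  obtain c1 t1 where c1: "computes c1 ?F t1 f" "pb_on ?F t1" using assms by (auto simp: pt_on_def)
  obtain c2 t2 where c2: "computes c2 ?G t2 g" "pb_on ?G t2" using assms by (auto simp: pt_on_def)
  \<comment> \<open>The time of a branch is bounded only on the inputs that take it; the sum of the
    two polynomials bounds both branches on all of \<open>A\<close>.\<close>
  obtain p1 where p1: "\<forall>x\<in>?F. t1 x \<le> poly p1 (len x)" using c1 by (auto simp: pb_on_def)
  obtain p2 where p2: "\<forall>x\<in>?G. t2 x \<le> poly p2 (len x)" using c2 by (auto simp: pb_on_def)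
  let ?t = "\<lambda>x. poly p1 (len x) + poly p2 (len x) + 1"
  show ?thesis
  proof (rule pt_onI)
    show "pb_on A (\<lambda>x. (16 * len x + 2) + (t0 x + (?t x + 2)))"
      by (intro pb_intros c0)
    fix d :: nat and s :: store and x assume x: "x \<in> A" "s d = word_of x" "\<And>r. r > d \<Longrightarrow> s r = []"
    let ?r = "word_of (if b x then f x else g x)"
    have p: "runs (Pop (d+1)) (s(d+1 := [b x])) 1 s"
      by (rule runs_straight) (use x in \<open>auto simp: fun_eq_iff\<close>)
    have "runs (Case (d+1) Skip (Pop (d+1) ;; c2 d) (Pop (d+1) ;; c1 d)) (s(d+1 := [b x])) (?t x + 2) (s(d := ?r))"
    proof (cases "b x")
      case True
      then have "runs (c1 d) s (t1 x) (s(d := ?r))"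
        by (intro computesD[OF c1(1)]) (use x in auto)
      from runs.Seq[OF p this, of "?t x"] show ?thesis
        using p1 True x(1) by (intro runs.Case_True[where n = "?t x"]) auto
    next
      case False
      then have "runs (c2 d) s (t2 x) (s(d := ?r))"
        by (intro computesD[OF c2(1)]) (use x in auto)
      from runs.Seq[OF p this, of "?t x"] show ?thesis
        using p2 False x(1) by (intro runs.Case_False[where n = "?t x"]) auto
    qed
    then show "runs (copy d (d+1) (d+2) ;; c0 (d+1) ;; Case (d+1) Skip (Pop (d+1) ;; c2 d) (Pop (d+1) ;; c1 d)) s
      ((16 * len x + 2) + (t0 x + (?t x + 2))) (s(d := ?r))"
      apply (intro runs_Seq[OF runs_copy[where s' = "s(d+1 := word_of x)"]]
         runs_Seq[OF computesD[OF c0(1) x(1), where s' = "s(d+1 := [b x])"]])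
      using x by (auto simp: word_of_simps)
  qed
qed

lemma pt_pred0: "pt (\<lambda>n :: nat. n - 1)"
proof (rule pt_onI[where c = Pop])
  show "pb_on UNIV (\<lambda>_. 1)" by (rule pb_const)
  fix d :: nat and s :: store and n :: nat assume "s d = word_of n"
  then show "runs (Pop d) s 1 (s(d := word_of (n - 1)))"
    by (intro runs_straight) (cases n; simp add: word_of_simps)+
qed

text \<open>Register \<open>e\<close> receives one symbol for each position where \<open>b\<close>
  differs from \<open>a\<close> or has ended; what \<open>b\<close> has in excess is left over. The
  words agree iff both remainders are empty.\<close>

definition match :: "nat \<Rightarrow> nat \<Rightarrow> nat \<Rightarrow> com" where
  "match a b e = each a (Case b (Push e True) (Pop b) (Pop b ;; Push e True))
     (Case b (Push e True) (Pop b ;; Push e True) (Pop b))"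

lemma runs_match:
  assumes "a \<noteq> b" "a \<noteq> e" "b \<noteq> e"
  shows "\<exists>f. runs (match a b e) s (10 * length (s a) + 1)
      (s(a := [], b := drop (length (s a)) (s b), e := f @ s e)) \<and>
    (f = [] \<longleftrightarrow> s a = take (length (s a)) (s b)) \<and> length f \<le> length (s a)"
proof -
  have "\<exists>f. runs (match a b e) s (10 * length w + 1)
      (s(a := [], b := drop (length w) (s b), e := f @ s e)) \<and>
    (f = [] \<longleftrightarrow> w = take (length w) (s b)) \<and> length f \<le> length w" if "s a = w" for w
    using that
  proof (induction w arbitrary: s)
    case Nil
    then show ?case
      using runs_each_Nil[of s a 1] by (intro exI[of _ "[]"]) (simp add: match_def fun_upd_idem)
  next
    case (Cons x w)
    let ?v = "s b"
    define g where "g = (if ?v \<noteq> [] \<and> hd ?v = x then [] else [True])"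
    let ?s = "s(a := w, b := tl ?v, e := g @ s e)"
    have pop: "runs (Pop b) (s(a := w)) 1 (s(a := w, b := tl ?v))"
      by (rule runs_straight) (use assms in auto)
    have push: "runs (Push e True) (s(a := w, b := tl ?v)) 2 (s(a := w, b := tl ?v, e := True # s e))"
      by (rule runs_straight) (use assms in auto)
    have both: "runs (Pop b ;; Push e True) (s(a := w)) 3 (s(a := w, b := tl ?v, e := True # s e))"
      by (rule runs.Seq[OF pop push]) simp
    let ?F = "Case b (Push e True) (Pop b) (Pop b ;; Push e True)"
    let ?T = "Case b (Push e True) (Pop b ;; Push e True) (Pop b)"
    have 1: "runs (if x then ?T else ?F) (s(a := w)) 5 ?s"
    proof (cases ?v)
      case Nil
      then have "s(a := w, b := tl ?v) = s(a := w)" using assms by (auto simp: fun_eq_iff)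
      then have "runs (Push e True) (s(a := w)) 2 ?s"
        using push by (simp add: g_def Nil)
      then show ?thesis
        using Nil assms by (cases x) (auto intro!: runs.Case_Nil[where n = 2])
    next
      case (Cons y v)
      show ?thesis
      proof (cases "y = x")
        case True
        then have "runs (Pop b) (s(a := w)) 1 ?s"
          using pop assms Cons by (simp add: g_def fun_upd_idem)
        then show ?thesis
          using Cons True assms
          by (cases x) (auto intro: runs.Case_True[where n = 1] runs.Case_False[where n = 1])
      next
        case False
        then have "runs (Pop b ;; Push e True) (s(a := w)) 3 ?s"
          using both Cons by (simp add: g_def)
        then show ?thesis
          using Cons False assms
          by (cases x) (auto intro: runs.Case_True[where n = 3] runs.Case_False[where n = 3])
      qed
    qed
    obtain f where f: "runs (match a b e) ?s (10 * length w + 1)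
        (?s(a := [], b := drop (length w) (?s b), e := f @ ?s e))"
      "f = [] \<longleftrightarrow> w = take (length w) (?s b)" "length f \<le> length w"
    proof -
      have "?s a = w" using assms by simp
      then have "\<exists>f. runs (match a b e) ?s (10 * length w + 1)
          (?s(a := [], b := drop (length w) (?s b), e := f @ ?s e)) \<and>
        (f = [] \<longleftrightarrow> w = take (length w) (?s b)) \<and> length f \<le> length w"
        by (rule Cons.IH)
      then show ?thesis using that by blast
    qed
    have "?s(a := [], b := drop (length w) (?s b), e := f @ ?s e) =
      s(a := [], b := drop (length (x # w)) ?v, e := (f @ g) @ s e)"
      using assms by (auto simp: fun_eq_iff drop_Suc)
    with f(1) have "runs (match a b e) s (10 * length (x # w) + 1)
        (s(a := [], b := drop (length (x # w)) ?v, e := (f @ g) @ s e))"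
      unfolding match_def by (intro runs_each_Cons[OF Cons.prems 1]) auto
    moreover have "f @ g = [] \<longleftrightarrow> x # w = take (length (x # w)) ?v"
      using f(2) assms by (cases ?v) (auto simp: g_def)
    moreover have "length (f @ g) \<le> length (x # w)"
      using f(3) by (simp add: g_def)
    ultimately show ?case by blast
  qed
  then show ?thesis by blast
qed

lemma pt_eq0: "pt (\<lambda>x :: 'a :: encoded \<times> 'a. fst x = snd x)"
proof (rule pt_onI)
  let ?T = "\<lambda>x :: 'a \<times> 'a. (10 * len x + 10) + ((7 * len x + 1) + ((10 * len x + 1) + ((7 * len x + 1) + (6 * len x + 5))))"
  show "pb_on UNIV ?T" by (intro pb_intros)
  fix d :: nat and s :: store and x :: "'a \<times> 'a" assume x: "s d = word_of x" "\<And>r. r > d \<Longrightarrow> s r = []"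
  let ?a = "word_of (fst x)" and ?b = "word_of (snd x)"
  let ?C = "clear (d+3) ;; Push d False"
  have l: "len x = 2 * length ?a + 1 + length ?b" by (simp add: word_of_prod_def)
  let ?s = "s(d := [], d+1 := rev ?a, d+2 := rev ?b)"
  obtain f where f: "runs (match (d+1) (d+2) (d+3)) ?s (10 * length ?a + 1)
      (?s(d+1 := [], d+2 := drop (length ?a) (rev ?b), d+3 := f))"
    "f = [] \<longleftrightarrow> rev ?a = take (length ?a) (rev ?b)" "length f \<le> length ?a"
    using runs_match[of "d+1" "d+2" "d+3" ?s] x by auto
  let ?f = "rev (drop (length ?a) (rev ?b)) @ f"
  let ?s' = "s(d := [], d+3 := ?f)"
  have "?f = [] \<longleftrightarrow> rev ?a = rev ?b"
    using f(2) by (metis append_is_Nil_conv append_take_drop_id rev_is_Nil_conv append_Nil2 drop_all length_rev order_refl take_all_iff)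
  then have eq: "?f = [] \<longleftrightarrow> fst x = snd x" by (simp add: word_of_eq_iff)
  have lf: "length ?f \<le> len x" using f(3) l by simp
  have 1: "runs (clear (d+3) ;; Push d False) ?s' (3 * len x + 3) (s(d := [False]))"
    by (rule runs.Seq[OF runs_clear[OF order_refl refl] runs_straight[OF _ order_refl]])
      (use x lf in \<open>auto simp: fun_eq_iff\<close>)
  have "runs (Case (d+3) (Push d True) ?C ?C) ?s' (6 * len x + 5) (s(d := word_of (fst x = snd x)))"
  proof (cases ?f)
    case Nil
    have "runs (Push d True) ?s' 2 (s(d := [True]))"
      by (rule runs_straight) (use x Nil in \<open>auto simp: fun_eq_iff\<close>)
    then show ?thesis
      using Nil eq by (intro runs.Case_Nil[where n = 2]) (auto simp: word_of_simps)
  next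
    case (Cons y w)
    then have "word_of (fst x = snd x) = [False]" using eq by (simp add: word_of_simps)
    with 1 have 2: "runs ?C ?s' (3 * len x + 3) (s(d := word_of (fst x = snd x)))" by simp
    have 3: "?s' (d+3) = y # w" using Cons by simp
    show ?thesis
    proof (cases y)
      case True
      show ?thesis by (rule runs.Case_True[OF _ 2]) (use 3 True in auto)
    next
      case False
      show ?thesis by (rule runs.Case_False[OF _ 2]) (use 3 False in auto)
    qed
  qed
  note 5 = this
  have 2: "runs (unpair d) s (10 * len x + 10) (s(d := ?b, d+1 := rev ?a))"
    by (rule runs_unpair[where a = "?a" and b = "?b"]) (use x l in \<open>auto simp: word_of_prod_def\<close>)
  have 3: "runs (mv d (d+2)) (s(d := ?b, d+1 := rev ?a)) (7 * len x + 1) ?s"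
    by (rule runs_mv) (use x l in \<open>auto simp: fun_eq_iff\<close>)
  have f': "runs (match (d+1) (d+2) (d+3)) ?s (10 * len x + 1)
      (?s(d+1 := [], d+2 := drop (length ?a) (rev ?b), d+3 := f))"
    by (rule runs_mono[OF f(1)]) (use l in simp)
  have 4: "runs (mv (d+2) (d+3)) (?s(d+1 := [], d+2 := drop (length ?a) (rev ?b), d+3 := f)) (7 * len x + 1) ?s'"
    by (rule runs_mv) (use x l in \<open>auto simp: fun_eq_iff\<close>)
  show "runs (unpair d ;; mv d (d+2) ;; match (d+1) (d+2) (d+3) ;; mv (d+2) (d+3) ;;
      Case (d+3) (Push d True) ?C ?C) s (?T x) (s(d := word_of (fst x = snd x)))"
    by (rule runs_Seq[OF 2 runs_Seq[OF 3 runs_Seq[OF f' runs_Seq[OF 4 5 refl] refl] refl] refl])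
qed

text \<open>The bound on all intermediate results does not follow from \<open>pt g\<close>: iterated
  doubling grows exponentially. Given the bound, each of the \<open>len n\<close> rounds takes
  polynomial time.\<close>

lemma pt_iterate0:
  fixes g :: "'a :: encoded \<Rightarrow> 'a"
  assumes "pt g" "\<And>n y i. (n, y) \<in> A \<Longrightarrow> i \<le> len n \<Longrightarrow> len ((g ^^ i) y) \<le> poly p (len (n, y))"
  shows "pt_on A (\<lambda>x :: 'c :: encoded \<times> 'a. (g ^^ len (fst x)) (snd x))"
proof -
  obtain c t where c: "computes c UNIV t g" "pb_on UNIV t" using assms by (auto simp: pt_on_def)
  obtain q where q: "\<And>y. t y \<le> poly q (len y)" using c by (auto simp: pb_on_def)
  let ?l = "\<lambda>d. While d (Pop d ;; c (d+1))"
  have loop: "runs (?l d) s (length w * (k + 3) + 1) (s(d := [], d+1 := word_of ((g ^^ length w) y)))"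
    if "\<And>i. i < length w \<Longrightarrow> t ((g ^^ i) y) \<le> k" "s d = w" "s (d+1) = word_of y" "\<And>r. r > d+1 \<Longrightarrow> s r = []"
    for d s w k and y :: 'a
    using that
  proof (induction w arbitrary: y s)
    case Nil
    then show ?case
      using runs.While_Nil[of s d 1] by (auto simp: fun_upd_idem)
  next
    case (Cons b w)
    let ?s = "s(d := w, d+1 := word_of (g y))"
    have p: "runs (Pop d) s 1 (s(d := w))"
      by (rule runs_straight) (use Cons.prems in auto)
    have b: "runs (c (d+1)) (s(d := w)) (t y) ?s"
      by (rule computesD[OF c(1)]) (use Cons.prems in auto)
    have r: "runs (?l d) ?s (length w * (k + 3) + 1) (?s(d := [], d+1 := word_of ((g ^^ length w) (g y))))"
    proof (rule Cons.IH)
      show "t ((g ^^ i) (g y)) \<le> k" if "i < length w" for i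
        using Cons.prems(1)[of "Suc i"] that by (simp add: funpow_swap1)
    qed (use Cons.prems in auto)
    have e: "?s(d := [], d+1 := word_of ((g ^^ length w) (g y))) = s(d := [], d+1 := word_of ((g ^^ length (b # w)) y))"
      by (auto simp: fun_eq_iff funpow_swap1)
    have sd: "s d \<noteq> []" using Cons.prems(2) by simp
    show ?case
      by (rule runs.While_Cons[OF sd runs.Seq[OF p b order_refl] r[unfolded e]])
        (use Cons.prems(1)[of 0] in simp)
  qed
  let ?B = "\<lambda>x :: 'c \<times> 'a. poly p (len x)"
  let ?T = "\<lambda>x. (10 * len x + 10) + ((7 * len x + 1) + ((7 * len x + 1) + ((7 * len x + 1) +
     ((len x * (poly q (?B x) + 3) + 1) + ((7 * ?B x + 1) + (7 * ?B x + 1))))))"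
  show ?thesis
  proof (rule pt_onI)
    show "pb_on A ?T" by (intro pb_intros)
    fix d :: nat and s :: store and x :: "'c \<times> 'a" assume x: "x \<in> A" "s d = word_of x" "\<And>r. r > d \<Longrightarrow> s r = []"
    obtain n y where ny: "x = (n, y)" by fastforce
    let ?r = "word_of ((g ^^ len n) y)"
    have len: "len n \<le> len x" "len y \<le> len x" by (simp_all add: ny len_simps)
    have B: "len ((g ^^ i) y) \<le> ?B x" if "i \<le> len n" for i
      using assms(2) x(1) that ny by blast
    have k: "t ((g ^^ i) y) \<le> poly q (?B x)" if "i < len n" for i
      using q B[of i] that poly_nat_mono[of _ _ q] le_trans by (meson less_imp_le)
    let ?s = "s(d := word_of n, d+1 := word_of y)"
    have "runs (?l d) ?s (len n * (poly q (?B x) + 3) + 1) (?s(d := [], d+1 := ?r))"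
      by (rule loop) (use k x in auto)
    also have "?s(d := [], d+1 := ?r) = s(d := [], d+1 := ?r)" by (auto simp: fun_eq_iff)
    finally have l: "runs (?l d) ?s (len x * (poly q (?B x) + 3) + 1) (s(d := [], d+1 := ?r))"
      by (rule runs_mono) (use len(1) in simp)
    have 1: "runs (unpair d) s (10 * len x + 10) (s(d := word_of y, d+1 := rev (word_of n)))"
      by (rule runs_unpair[where a = "word_of n" and b = "word_of y"])
        (use x len ny in \<open>auto simp: word_of_simps\<close>)
    have 2: "runs (mv d (d+2)) (s(d := word_of y, d+1 := rev (word_of n))) (7 * len x + 1)
        (s(d := [], d+1 := rev (word_of n), d+2 := rev (word_of y)))"
      by (rule runs_mv) (use x len in \<open>auto simp: fun_eq_iff\<close>)
    have 3: "runs (mv (d+1) d) (s(d := [], d+1 := rev (word_of n), d+2 := rev (word_of y))) (7 * len x + 1)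
        (s(d := word_of n, d+2 := rev (word_of y)))"
      by (rule runs_mv) (use x len in \<open>auto simp: fun_eq_iff word_of_simps\<close>)
    have 4: "runs (mv (d+2) (d+1)) (s(d := word_of n, d+2 := rev (word_of y))) (7 * len x + 1) ?s"
      by (rule runs_mv) (use x len in \<open>auto simp: fun_eq_iff word_of_simps\<close>)
    have 5: "runs (mv (d+1) (d+2)) (s(d := [], d+1 := ?r)) (7 * ?B x + 1) (s(d := [], d+2 := rev ?r))"
      by (rule runs_mv) (use x B[of "len n"] in \<open>auto simp: fun_eq_iff\<close>)
    have 6: "runs (mv (d+2) d) (s(d := [], d+2 := rev ?r)) (7 * ?B x + 1) (s(d := ?r))"
      by (rule runs_mv) (use x B[of "len n"] in \<open>auto simp: fun_eq_iff\<close>)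
    show "runs (unpair d ;; mv d (d+2) ;; mv (d+1) d ;; mv (d+2) (d+1) ;; ?l d ;; mv (d+1) (d+2) ;; mv (d+2) d)
      s (?T x) (s(d := word_of ((g ^^ len (fst x)) (snd x))))"
      unfolding ny fst_conv snd_conv
      by (rule runs_Seq[OF 1 runs_Seq[OF 2 runs_Seq[OF 3 runs_Seq[OF 4 runs_Seq[OF l
        runs_Seq[OF 5 6 refl] refl] refl] refl] refl] refl, unfolded ny])
  qed
qed

definition explode :: "nat \<Rightarrow> com" where
  "explode d = (mv d (d+1) ;; each (d+1) (Push d False ;; Push d False ;; Push d True)
      (Push d False ;; Push d True ;; Push d True))"

lemma pt_explode0: "pt unraw"
proof (rule pt_onI[where c = explode])
  show "pb_on UNIV (\<lambda>x :: raw. (7 * len x + 1) + (11 * len x + 1))" by (intro pb_intros)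
  fix d :: nat and s :: store and x :: raw assume x: "s d = word_of x" "\<And>r. r > d \<Longrightarrow> s r = []"
  let ?F = "Push d False ;; Push d False ;; Push d True"
  let ?T = "Push d False ;; Push d True ;; Push d True"
  have loop: "runs (each (d+1) ?F ?T) s (11 * length w + 1) (s(d := word_of (rev w @ v), d+1 := []))"
    if "s (d+1) = w" "s d = word_of v" for w v s
    using that
  proof (induction w arbitrary: s v)
    case Nil
    then show ?case using runs_each_Nil[of s "d+1" 1] by (simp add: fun_upd_idem)
  next
    case (Cons b w)
    let ?s = "s(d+1 := w, d := word_of (b # v))"
    have 1: "runs (Push d False ;; Push d b ;; Push d True) (s(d+1 := w)) 6 ?s"
      by (rule runs_straight) (use Cons.prems in \<open>auto simp: fun_eq_iff word_of_simps\<close>)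
    have "runs (each (d+1) ?F ?T) ?s (11 * length w + 1) (?s(d := word_of (rev w @ b # v), d+1 := []))"
      by (rule Cons.IH) auto
    also have "?s(d := word_of (rev w @ b # v), d+1 := []) = s(d := word_of (rev (b # w) @ v), d+1 := [])"
      by (auto simp: fun_eq_iff)
    finally have 2: "runs (each (d+1) ?F ?T) ?s (11 * length w + 1) (s(d := word_of (rev (b # w) @ v), d+1 := []))" .
    show ?case
      by (rule runs_each_Cons[where s = s and a = "d+1" and b = b and w = w and m = 6, OF Cons.prems(1) _ 2]) (use 1 in \<open>cases b; simp\<close>)+
  qed
  let ?s = "s(d := [], d+1 := rev (word_of x))"
  have "runs (each (d+1) ?F ?T) ?s (11 * len x + 1) (?s(d := word_of (rev (rev (word_of x)) @ []), d+1 := []))"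
    using loop[of ?s "rev (word_of x)" "[]"] by (simp add: word_of_simps)
  also have "?s(d := word_of (rev (rev (word_of x)) @ []), d+1 := []) = s(d := word_of (unraw x))"
    using x by (auto simp: fun_eq_iff word_of_raw_def)
  finally have 2: "runs (each (d+1) ?F ?T) ?s (11 * len x + 1) (s(d := word_of (unraw x)))" .
  have 1: "runs (mv d (d+1)) s (7 * len x + 1) ?s"
    by (rule runs_mv) (use x in \<open>auto simp: fun_eq_iff\<close>)
  show "runs (explode d) s ((7 * len x + 1) + (11 * len x + 1)) (s(d := word_of (unraw x)))"
    unfolding explode_def by (rule runs_Seq[OF 1 2 refl])
qed

lemma polytime_of_pt:
  assumes "pt f"
  shows "polytime (\<lambda>x. unraw (f (Raw x)))"
proof -
  obtain c t where c: "computes c UNIV t f" "pb_on UNIV t" using assms by (auto simp: pt_on_def)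
  obtain q where q: "\<And>y. t y \<le> poly q (len y)" using c by (auto simp: pb_on_def)
  show ?thesis
  proof (rule polytime_of_com)
    fix x :: "bool list"
    have "runs (c 0) ((\<lambda>_. [])(0 := x)) (t (Raw x)) ((\<lambda>_. [])(0 := unraw (f (Raw x))))"
      by (rule computesD[OF c(1)]) (auto simp: word_of_raw_def)
    then show "runs (c 0) ((\<lambda>_. [])(0 := x)) (poly q (length x)) ((\<lambda>_. [])(0 := unraw (f (Raw x))))"
      using q[of "Raw x"] by (elim runs_mono) (simp add: len_simps)
  qed
qed

section \<open>Closure rules for functions computable in polynomial time\<close>

named_theorems pt_rules

lemma pt_id [pt_rules]: "pt (\<lambda>x. x)"
  by (rule pt_on_cast) simp

declare pt_const [pt_rules] pt_Pair [pt_rules]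

lemma pt_cong: "pt f \<Longrightarrow> (\<And>x. f x = g x) \<Longrightarrow> pt g"
  by (rule pt_on_cong)

lemma pt_lift1: "pt h \<Longrightarrow> pt f \<Longrightarrow> pt (\<lambda>x. h (f x))"
  by (rule pt_comp)

text \<open>Binary functions are handled as functions of a pair \<open>p\<close>, their arguments
  being \<open>fst p\<close> and \<open>snd p\<close>; in this form the rules also go below
  binders.\<close>

lemma pt_lift2: "pt (\<lambda>p. h (fst p) (snd p)) \<Longrightarrow> pt f \<Longrightarrow> pt g \<Longrightarrow> pt (\<lambda>x. h (f x) (g x))"
  using pt_comp[of "\<lambda>p. h (fst p) (snd p)" UNIV "\<lambda>x. (f x, g x)"] by (simp add: pt_Pair)

lemmas pt_fst [pt_rules] = pt_lift1[OF pt_fst0]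
lemmas pt_snd [pt_rules] = pt_lift1[OF pt_snd0]
lemmas pt_eq [pt_rules] = pt_lift2[OF pt_eq0]
lemmas pt_unraw [pt_rules] = pt_lift1[OF pt_explode0]

lemma pt_if [pt_rules]: "pt b \<Longrightarrow> pt f \<Longrightarrow> pt g \<Longrightarrow> pt (\<lambda>x. if b x then f x else g x)"
  by (rule pt_If) (auto elim: pt_on_subset)

lemma pt_Let [pt_rules]:
  assumes "pt f" "pt (\<lambda>p. g (fst p) (snd p))"
  shows "pt (\<lambda>x. let y = f x in g x y)"
  using pt_lift2[OF assms(2) pt_id assms(1)] by (simp add: Let_def)

lemma pt_case_prod [pt_rules]:
  assumes "pt f" "pt (\<lambda>p. g (fst p) (fst (snd p)) (snd (snd p)))"
  shows "pt (\<lambda>x. case f x of (a, b) \<Rightarrow> g x a b)"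
  using pt_comp[OF assms(2) pt_Pair[OF pt_id assms(1)]] by (simp add: split_def)

lemma pt_not [pt_rules]: "pt b \<Longrightarrow> pt (\<lambda>x. \<not> b x)"
  by (rule pt_cong[OF pt_if[of b "\<lambda>_. False" "\<lambda>_. True"]]) (auto simp: pt_const)

lemma pt_and [pt_rules]: "pt b \<Longrightarrow> pt c \<Longrightarrow> pt (\<lambda>x. b x \<and> c x)"
  by (rule pt_cong[OF pt_if[of b c "\<lambda>_. False"]]) (auto simp: pt_const)

lemma pt_or [pt_rules]: "pt b \<Longrightarrow> pt c \<Longrightarrow> pt (\<lambda>x. b x \<or> c x)"
  by (rule pt_cong[OF pt_if[of b "\<lambda>_. True" c]]) (auto simp: pt_const)

lemma pt_imp [pt_rules]: "pt b \<Longrightarrow> pt c \<Longrightarrow> pt (\<lambda>x. b x \<longrightarrow> c x)"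
  by (rule pt_cong[OF pt_if[of b c "\<lambda>_. True"]]) (auto simp: pt_const)

lemma pt_add [pt_rules]: "pt f \<Longrightarrow> pt g \<Longrightarrow> pt (\<lambda>x. f x + g x :: nat)"
  by (rule pt_lift2[where h = "(+)", OF pt_append0]) (simp_all add: word_of_simps replicate_add)

lemma pt_Suc [pt_rules]: "pt f \<Longrightarrow> pt (\<lambda>x. Suc (f x))"
  using pt_add[OF pt_const[of _ 1]] by simp

lemma pt_append [pt_rules]: "pt f \<Longrightarrow> pt g \<Longrightarrow> pt (\<lambda>x. f x @ g x)"
  by (rule pt_lift2[where h = "(@)", OF pt_append0]) (simp_all add: word_of_simps)

lemma pt_Cons [pt_rules]:
  assumes "pt f" "pt g"
  shows "pt (\<lambda>x. f x # g x)"
  by (rule pt_on_recast[OF pt_Pair[OF assms], of _ "\<lambda>x. x"]) (simp add: word_of_simps)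

lemma pt_case_list [pt_rules]:
  assumes xs: "pt xs" and f: "pt f" and g: "pt (\<lambda>p. g (fst p) (fst (snd p)) (snd (snd p)))"
  shows "pt (\<lambda>x. case xs x of [] \<Rightarrow> f x | y # ys \<Rightarrow> g x y ys)"
proof -
  let ?N = "{l :: 'b list. l \<noteq> []}"
  have ne: "l \<noteq> [] \<Longrightarrow> word_of (hd l, tl l) = word_of l" for l :: "'b list"
    by (cases l) (auto simp: word_of_simps)
  have hd: "pt_on ?N hd"
    by (rule pt_on_recast[OF pt_fst0, of _ "\<lambda>l. (hd l, tl l)"]) (simp add: ne)
  have tl: "pt_on ?N tl"
    by (rule pt_on_recast[OF pt_snd0, of _ "\<lambda>l. (hd l, tl l)"]) (simp add: ne)
  have e: "pt (\<lambda>x. xs x = [])"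
    by (rule pt_eq[OF xs pt_const])
  have "pt (\<lambda>x. if xs x = [] then f x else g x (hd (xs x)) (tl (xs x)))"
  proof (rule pt_If[OF e pt_on_subset[OF f]])
    have i: "pt_on A (\<lambda>x. x)" for A :: "'a set" by (rule pt_on_cast) simp
    show "pt_on {x \<in> UNIV. xs x \<noteq> []} (\<lambda>x. g x (hd (xs x)) (tl (xs x)))"
      by (rule pt_comp[OF g, of _ "\<lambda>x. (x, hd (xs x), tl (xs x))", simplified])
        (intro pt_Pair i pt_on_comp[OF hd] pt_on_comp[OF tl] pt_on_subset[OF xs]; auto)
  qed auto
  then show ?thesis
    by (rule pt_on_cong) (auto split: list.splits)
qed

lemma pt_pred: "pt f \<Longrightarrow> pt (\<lambda>x. f x - 1 :: nat)"
  by (rule pt_lift1[OF pt_pred0])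

subsection \<open>Bounded iteration\<close>

lemma pt_iterate_len:
  fixes i :: "'a :: encoded \<Rightarrow> 'b :: encoded" and n :: "'a \<Rightarrow> 'c :: encoded" and g :: "'a \<Rightarrow> 'b \<Rightarrow> 'b"
  assumes n: "pt n" and i: "pt i" and g: "pt (\<lambda>p. g (fst p) (snd p))" and B: "pb_on UNIV B"
    "\<And>x k. k \<le> len (n x) \<Longrightarrow> len ((g x ^^ k) (i x)) \<le> B x"
  shows "pt (\<lambda>x. (g x ^^ len (n x)) (i x))"
proof -
  \<comment> \<open>The body of the loop may depend on \<open>x\<close>, so \<open>x\<close> is
    carried along in the state.\<close>
  let ?g = "\<lambda>(x, s). (x, g x s)"
  have pow: "(?g ^^ k) (x, s) = (x, (g x ^^ k) s)" for k x s
    by (induction k) auto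
  obtain p where p: "\<And>x. B x \<le> poly p (len x)" using B(1) by (auto simp: pb_on_def)
  let ?f = "\<lambda>x. (n x, (x, i x))"
  have "pt_on (range ?f) (\<lambda>x. (?g ^^ len (fst x)) (snd x))"
  \<comment> \<open>The state \<open>(x, s)\<close> has length
    \<open>2 * len x + len s + 1\<close>.\<close>
  proof (rule pt_iterate0[where p = "[:0, 2:] + p + 1"])
    show "pt ?g"
      using pt_Pair[OF pt_fst0 g] by (simp add: split_def)
    fix m y k assume "(m, y) \<in> range ?f" "k \<le> len m"
    then obtain x where x: "m = n x" "y = (x, i x)" by auto
    then have "len ((g x ^^ k) (i x)) \<le> poly p (len x)"
      using B(2)[of k x] p[of x] \<open>k \<le> len m\<close> by simp
    moreover have "poly p (len x) \<le> poly p (len (m, y))"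
      by (rule poly_nat_mono) (simp add: x len_simps)
    ultimately show "len ((?g ^^ k) y) \<le> poly ([:0, 2:] + p + 1) (len (m, y))"
      by (simp add: x pow len_simps)
  qed
  from pt_on_comp[OF this, of UNIV ?f] have "pt (\<lambda>x. (?g ^^ len (n x)) (x, i x))"
    by (simp add: pt_Pair n i pt_id)
  from pt_snd[OF this] show ?thesis by (simp add: pow)
qed

lemma pt_iterate:
  fixes n :: "'a :: encoded \<Rightarrow> nat" and g :: "'a \<Rightarrow> 'b :: encoded \<Rightarrow> 'b"
  assumes "pt n" "pt i" "pt (\<lambda>p. g (fst p) (snd p))" "pb_on UNIV B"
    "\<And>x k. k \<le> n x \<Longrightarrow> len ((g x ^^ k) (i x)) \<le> B x"
  shows "pt (\<lambda>x. (g x ^^ n x) (i x))"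
  using pt_iterate_len[OF assms(1-4)] assms(5) by (simp add: len_simps)

lemma pt_pb: "pt f \<Longrightarrow> pb_on UNIV (\<lambda>x. f x :: nat)"
  using pt_on_pb_len[of UNIV f] by (simp add: len_simps)

lemma pt_minus [pt_rules]:
  assumes "pt f" "pt g"
  shows "pt (\<lambda>x. f x - g x :: nat)"
proof -
  have s: "((\<lambda>k. k - 1) ^^ k) m = m - k" for k m :: nat by (induction k) auto
  have "pt (\<lambda>x. ((\<lambda>k. k - 1) ^^ g x) (f x))"
    apply (rule pt_iterate[OF assms(2,1) _ pt_pb[OF assms(1)]])
     apply (rule pt_pred)
     apply (rule pt_rules)
     apply (rule pt_rules)
    apply (simp only: s len_simps diff_le_self)
    done
  then show ?thesis by (simp only: s)
qed

lemma pt_mult [pt_rules]: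
  assumes "pt f" "pt g"
  shows "pt (\<lambda>x. f x * g x :: nat)"
proof -
  have s: "((\<lambda>k. m + k) ^^ n) 0 = n * m" for n m :: nat by (induction n) auto
  have "pt (\<lambda>x. ((\<lambda>k. g x + k) ^^ f x) 0)"
    by (rule pt_iterate[OF assms(1) pt_const _ pb_mult[OF assms[THEN pt_pb]]])
      (intro pt_rules pt_lift1[OF assms(2)], simp add: s len_simps)
  then show ?thesis by (simp add: s)
qed

lemma pt_le [pt_rules]: "pt f \<Longrightarrow> pt g \<Longrightarrow> pt (\<lambda>x. f x \<le> (g x :: nat))"
  using pt_eq[OF pt_minus[of f g] pt_const[of _ 0]] by simp

lemma pt_less [pt_rules]: "pt f \<Longrightarrow> pt g \<Longrightarrow> pt (\<lambda>x. f x < (g x :: nat))"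
  using pt_le[of "\<lambda>x. Suc (f x)" g] by (simp add: Suc_le_eq pt_Suc)

lemma pt_poly [pt_rules]: "pt f \<Longrightarrow> pt (\<lambda>x. poly (p :: nat poly) (f x))"
  by (induction p) (auto intro: pt_rules)

text \<open>Division by counting up with a carry. For \<open>k = 0\<close> the carry never occurs,
  in accordance with \<open>n div 0 = 0\<close> and \<open>n mod 0 = n\<close>.\<close>

lemma divmod_iterate:
  fixes k n :: nat
  shows "((\<lambda>(q, r). if Suc r = k then (Suc q, 0) else (q, Suc r)) ^^ n) (0, 0) = (n div k, n mod k)"
proof (induction n)
  case (Suc n)
  then show ?case by (simp add: div_Suc mod_Suc)
qed simp

lemma pt_divmod:
  assumes "pt f" "pt g"
  shows "pt (\<lambda>x. (f x div g x :: nat, f x mod g x :: nat))"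
proof -
  have "pt (\<lambda>x. ((\<lambda>(q, r). if Suc r = g x then (Suc q, 0) else (q, Suc r)) ^^ f x) (0 :: nat, 0 :: nat))"
  proof (rule pt_iterate[OF assms(1) pt_const])
    show "pt (\<lambda>p. case snd p of (q, r) \<Rightarrow> if Suc r = g (fst p) then (Suc q, 0 :: nat) else (q, Suc r))"
      by (intro pt_rules pt_lift1[OF assms(2)])
    show "pb_on UNIV (\<lambda>x. 3 * f x + 1)"
      by (intro pb_intros pt_pb assms)
    fix x k assume "k \<le> f x"
    moreover have "k div g x \<le> k" "k mod g x \<le> k" by simp_all
    ultimately show "len (((\<lambda>(q, r). if Suc r = g x then (Suc q, 0) else (q, Suc r)) ^^ k) (0 :: nat, 0 :: nat))
        \<le> 3 * f x + 1"
      unfolding divmod_iterate len_simps by linarith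
  qed
  then show ?thesis unfolding divmod_iterate .
qed

lemma pt_div [pt_rules]: "pt f \<Longrightarrow> pt g \<Longrightarrow> pt (\<lambda>x. f x div g x :: nat)"
  using pt_fst[OF pt_divmod[of f g]] by simp

lemma pt_mod [pt_rules]: "pt f \<Longrightarrow> pt g \<Longrightarrow> pt (\<lambda>x. f x mod g x :: nat)"
  using pt_snd[OF pt_divmod[of f g]] by simp

lemma len_mem: "y \<in> set ys \<Longrightarrow> 2 * len y + 1 \<le> len ys"
  by (induction ys) (auto simp: len_simps)

lemma length_le_len: "length ys \<le> len ys"
  by (induction ys) (auto simp: len_simps)

lemma len_drop_le: "len (drop k ys) \<le> len ys"
proof -
  have "len ys = len (take k ys @ drop k ys)" by simp
  then show ?thesis unfolding len_simps by linarith
qed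

lemma pt_fold_bound:
  fixes xs :: "'a :: encoded \<Rightarrow> 'b :: encoded list" and i :: "'a \<Rightarrow> 'c :: encoded"
  assumes xs: "pt xs" and h: "pt (\<lambda>p. h (fst p) (fst (snd p)) (snd (snd p)))" and i: "pt i"
    and B: "pb_on UNIV B" "\<And>x k. k \<le> length (xs x) \<Longrightarrow> len (fold (h x) (take k (xs x)) (i x)) \<le> B x"
  shows "pt (\<lambda>x. fold (h x) (xs x) (i x))"
proof -
  let ?g = "\<lambda>x (ys, a). case ys of [] \<Rightarrow> ([], a) | y # ys' \<Rightarrow> (ys', h x y a)"
  have pow: "(?g x ^^ k) (ys, a) = (drop k ys, fold (h x) (take k ys) a)" for x k ys a
  proof (induction k arbitrary: ys a)
    case (Suc k)
    show ?case unfolding funpow_Suc_right comp_def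
      by (cases ys) (use Suc in \<open>simp_all del: funpow.simps\<close>)
  qed simp
  \<comment> \<open>The word of the list serves as the counter. It has at least as many symbols as
    the list has elements, and the surplus rounds change nothing.\<close>
  have fold: "pt (\<lambda>x. (?g x ^^ len (xs x)) (xs x, i x))"
  proof (rule pt_iterate_len[OF xs pt_Pair[OF xs i]])
    show "pt (\<lambda>p. case snd p of (ys, a) \<Rightarrow> case ys of [] \<Rightarrow> ([], a) | y # ys' \<Rightarrow> (ys', h (fst p) y a))"
      by (intro pt_rules pt_lift1[OF h, of "\<lambda>q. (f q, g q, k q)" for f g k, simplified])
    show "pb_on UNIV (\<lambda>x. 2 * len (xs x) + B x + 1)"
      by (intro pb_intros B pt_on_pb_len xs)
    fix x k
    have "len (fold (h x) (take k (xs x)) (i x)) \<le> B x"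
    proof (cases "k \<le> length (xs x)")
      case False
      then show ?thesis using B(2)[of "length (xs x)" x] by simp
    qed (rule B(2))
    then show "len ((?g x ^^ k) (xs x, i x)) \<le> 2 * len (xs x) + B x + 1"
      using len_drop_le[of k "xs x"] unfolding pow len_simps by linarith
  qed
  show ?thesis
    using pt_snd[OF fold] unfolding pow by (simp add: length_le_len)
qed

text \<open>Linear growth of some measure \<open>m\<close> suffices if \<open>m\<close> bounds the
  length polynomially. For pairs, the maximum of the lengths of the components may grow linearly
  although \<open>len\<close> itself can be multiplied in a single step.\<close>

lemma pt_fold_measure:
  fixes xs :: "'a :: encoded \<Rightarrow> 'b :: encoded list" and i :: "'a \<Rightarrow> 'c :: encoded"
  assumes xs: "pt xs" and h: "pt (\<lambda>p. h (fst p) (fst (snd p)) (snd (snd p)))" and i: "pt i"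
    and q: "pb_on UNIV q" and m0: "pb_on UNIV (\<lambda>x. m x (i x))"
    and step: "\<And>x y a. y \<in> set (xs x) \<Longrightarrow> m x (h x y a) \<le> m x a + q x"
    and len: "\<And>x a. len a \<le> poly r (m x a)"
  shows "pt (\<lambda>x. fold (h x) (xs x) (i x))"
proof (rule pt_fold_bound[OF xs h i])
  show "pb_on UNIV (\<lambda>x. poly r (m x (i x) + len (xs x) * q x))"
    by (intro pb_intros m0 q pt_on_pb_len xs)
  fix x k
  have "m x (fold (h x) ys a) \<le> m x a + length ys * q x" if "set ys \<subseteq> set (xs x)" for ys a
    using that
  proof (induction ys arbitrary: a)
    case (Cons y ys)
    then have "m x (fold (h x) ys (h x y a)) \<le> m x (h x y a) + length ys * q x" by simp
    then show ?case using step[of y x a] Cons.prems by simp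
  qed simp
  from this[of "take k (xs x)" "i x"]
  have "m x (fold (h x) (take k (xs x)) (i x)) \<le> m x (i x) + length (take k (xs x)) * q x"
    using set_take_subset by fast
  also have "\<dots> \<le> m x (i x) + len (xs x) * q x"
    using length_le_len[of "xs x"] by (intro add_left_mono mult_right_mono) auto
  finally show "len (fold (h x) (take k (xs x)) (i x)) \<le> poly r (m x (i x) + len (xs x) * q x)"
    using len[of "fold (h x) (take k (xs x)) (i x)" x] poly_nat_mono le_trans by blast
qed

lemma pt_fold_add:
  assumes "pt xs" "pt (\<lambda>p. h (fst p) (fst (snd p)) (snd (snd p)))" "pt i" "pb_on UNIV q"
    "\<And>x y a. y \<in> set (xs x) \<Longrightarrow> len (h x y a) \<le> len a + q x"
  shows "pt (\<lambda>x. fold (h x) (xs x) (i x))"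
  by (rule pt_fold_measure[OF assms(1-4), where m = "\<lambda>_. len" and r = "[:0, 1:]"])
    (simp_all add: assms pt_on_pb_len)

subsection \<open>Lists\<close>

lemma pt_concat_map [pt_rules]:
  assumes xs: "pt xs" and f: "pt (\<lambda>p. f (fst p) (snd p))"
  shows "pt (\<lambda>x. concat (map (f x) (xs x)))"
proof -
  obtain p where p: "\<And>x y. len (f x y) \<le> poly p (len (x, y))"
    using pt_on_pb_len[OF f] by (auto simp: pb_on_def)
  have "pt (\<lambda>x. fold (\<lambda>y a. a @ f x y) (xs x) [])"
  proof (rule pt_fold_add[OF xs _ pt_const])
    show "pt (\<lambda>p. snd (snd p) @ f (fst p) (fst (snd p)))"
      by (intro pt_rules pt_lift2[OF f])
    show "pb_on UNIV (\<lambda>x. poly p (2 * len x + len (xs x) + 1))"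
      by (intro pb_intros pt_on_pb_len xs)
    fix x y a assume "y \<in> set (xs x)"
    then have "len (x, y) \<le> 2 * len x + len (xs x) + 1"
      using len_mem[of y "xs x"] by (simp add: len_simps)
    then have "poly p (len (x, y)) \<le> poly p (2 * len x + len (xs x) + 1)"
      by (rule poly_nat_mono)
    then show "len (a @ f x y) \<le> len a + poly p (2 * len x + len (xs x) + 1)"
      using p[of x y] by (simp add: len_simps(7))
  qed
  moreover have "fold (\<lambda>y a. a @ f x y) ys b = b @ concat (map (f x) ys)" for x ys b
    by (induction ys arbitrary: b) auto
  ultimately show ?thesis by simp
qed

lemma pt_map [pt_rules]:
  assumes "pt xs" "pt (\<lambda>p. f (fst p) (snd p))"
  shows "pt (\<lambda>x. map (f x) (xs x))"
proof -
  have "pt (\<lambda>x. concat (map (\<lambda>y. [f x y]) (xs x)))"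
    by (intro pt_concat_map assms(1) pt_Cons assms(2) pt_const)
  then show ?thesis by simp
qed

lemma pt_filter [pt_rules]:
  fixes xs :: "'a :: encoded \<Rightarrow> 'b :: encoded list"
  assumes "pt xs" "pt (\<lambda>p. f (fst p) (snd p))"
  shows "pt (\<lambda>x. filter (f x) (xs x))"
proof -
  have "pt (\<lambda>x. concat (map (\<lambda>y. if f x y then [y] else []) (xs x)))"
    by (intro pt_rules assms)
  moreover have "concat (map (\<lambda>y. if P y then [y] else []) ys) = filter P ys" for P and ys :: "'b list"
    by (induction ys) auto
  ultimately show ?thesis by simp
qed

lemma pt_concat [pt_rules]: "pt f \<Longrightarrow> pt (\<lambda>x. concat (f x))"
  using pt_concat_map[of f "\<lambda>_ y. y"] by (simp add: pt_snd0)

lemma pt_Ball [pt_rules]: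
  assumes "pt xs" "pt (\<lambda>p. P (fst p) (snd p))"
  shows "pt (\<lambda>x. \<forall>y \<in> set (xs x). P x y)"
proof -
  have "pt (\<lambda>x. filter (\<lambda>y. \<not> P x y) (xs x) = [])"
    by (intro pt_rules assms)
  then show ?thesis by (simp add: filter_empty_conv)
qed

lemma pt_Bex [pt_rules]:
  assumes "pt xs" "pt (\<lambda>p. P (fst p) (snd p))"
  shows "pt (\<lambda>x. \<exists>y \<in> set (xs x). P x y)"
  using pt_not[OF pt_Ball[OF assms(1) pt_not[OF assms(2)]]] by simp

lemma pt_sum_list [pt_rules]:
  assumes "pt f"
  shows "pt (\<lambda>x. sum_list (f x :: nat list))"
proof -
  have "fold (+) ys a = a + sum_list ys" for ys and a :: nat
    by (induction ys arbitrary: a) auto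
  moreover have "pt (\<lambda>x. fold (+) (f x) 0)"
  proof (rule pt_fold_add[OF assms _ pt_const pt_on_pb_len[OF assms]])
    show "len (y + a) \<le> len a + len (f x)" if "y \<in> set (f x)" for x y a
      using len_mem[OF that] by (simp add: len_simps)
  qed (intro pt_rules)
  ultimately show ?thesis by simp
qed

lemma pt_length [pt_rules]:
  assumes "pt f"
  shows "pt (\<lambda>x. length (f x))"
proof -
  have "pt (\<lambda>x. sum_list (map (\<lambda>_. 1 :: nat) (f x)))"
    by (intro pt_rules assms)
  then show ?thesis by (simp add: sum_list_triv)
qed

lemma pt_upt0 [pt_rules]:
  assumes "pt f"
  shows "pt (\<lambda>x. [0..<f x])"
proof -
  have s: "((\<lambda>ys. ys @ [length ys]) ^^ k) [] = [0..<k]" for k by (induction k) auto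
  have l: "len [0..<k] \<le> k * (2 * k + 1)" for k
    by (induction k) (auto simp: len_simps)
  have "pt (\<lambda>x. ((\<lambda>ys. ys @ [length ys]) ^^ f x) [])"
  proof (rule pt_iterate[OF assms pt_const])
    show "pb_on UNIV (\<lambda>x. f x * (2 * f x + 1))"
      by (intro pb_intros pt_pb assms)
    show "len (((\<lambda>ys. ys @ [length ys]) ^^ k) []) \<le> f x * (2 * f x + 1)" if "k \<le> f x" for x k
    proof -
      have "len [0..<k] \<le> f x * (2 * f x + 1)"
        using that by (intro order_trans[OF l] mult_le_mono) auto
      then show ?thesis by (simp add: s)
    qed
  qed (intro pt_rules)
  then show ?thesis by (simp add: s)
qed

lemma pt_upt [pt_rules]:
  assumes "pt f" "pt g"
  shows "pt (\<lambda>x. [f x..<g x])"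
proof -
  have "pt (\<lambda>x. map (\<lambda>i. f x + i) [0..<g x - f x])"
    by (intro pt_rules assms pt_lift1[OF assms(1)])
  moreover have "map (\<lambda>i. a + i) [0..<b - a] = [a..<b]" for a b :: nat
    by (cases "a \<le> b") (simp_all add: map_add_upt add.commute[of a])
  ultimately show ?thesis by simp
qed

lemma pt_drop [pt_rules]:
  assumes "pt n" "pt f"
  shows "pt (\<lambda>x. drop (n x) (f x))"
proof -
  have s: "((\<lambda>ys. case ys of [] \<Rightarrow> [] | y # ys' \<Rightarrow> ys') ^^ k) ys = drop k ys" for k and ys :: "'b list"
    by (induction k) (auto split: list.splits simp: drop_Suc drop_tl)
  have "pt (\<lambda>x. ((\<lambda>ys. case ys of [] \<Rightarrow> [] | y # ys' \<Rightarrow> ys') ^^ n x) (f x))"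
    by (rule pt_iterate[OF assms _ pt_on_pb_len[OF assms(2)]])
      (intro pt_rules, simp only: s len_drop_le)
  then show ?thesis by (simp only: s)
qed

text \<open>\<open>!\<close> is unspecified beyond the end of the list, so no program can be shown
  to compute it; the default makes access total.\<close>

definition sel :: "'a \<Rightarrow> 'a list \<Rightarrow> nat \<Rightarrow> 'a" where
  "sel d xs n = (if n < length xs then xs ! n else d)"

lemma sel_nth: "n < length xs \<Longrightarrow> sel d xs n = xs ! n"
  by (simp add: sel_def)

lemma pt_sel [pt_rules]:
  assumes "pt xs" "pt n"
  shows "pt (\<lambda>x. sel d (xs x) (n x))"
proof -
  have "pt (\<lambda>x. case drop (n x) (xs x) of [] \<Rightarrow> d | y # ys \<Rightarrow> y)"
    by (intro pt_rules assms)
  moreover have "(case drop n xs of [] \<Rightarrow> d | y # ys \<Rightarrow> y) = sel d xs n" for n xs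
    by (cases "n < length xs") (auto simp: sel_def Cons_nth_drop_Suc[symmetric])
  ultimately show ?thesis by simp
qed

lemma pt_rev [pt_rules]:
  assumes "pt f"
  shows "pt (\<lambda>x. rev (f x))"
proof -
  have "pt (\<lambda>x. fold (\<lambda>y a. y # a) (f x) [])"
  proof (rule pt_fold_add[OF assms _ pt_const])
    show "pb_on UNIV (\<lambda>x. 2 * len (f x) + 1)" by (intro pb_intros pt_on_pb_len assms)
    show "len (y # a) \<le> len a + (2 * len (f x) + 1)" if "y \<in> set (f x)" for x y a
      using len_mem[OF that] by (simp add: len_simps)
  qed (intro pt_rules)
  then show ?thesis by (simp add: rev_conv_fold)
qed

lemma pt_Raw [pt_rules]:
  assumes "pt f"
  shows "pt (\<lambda>x. Raw (f x))"
proof -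
  let ?app = "\<lambda>r r'. Raw (unraw r @ unraw r')"
  have bit: "pt (\<lambda>b :: bool. Raw [b])"
    by (rule pt_on_recast[OF pt_id, of _ "\<lambda>x. x"]) (simp add: word_of_simps)
  have "pt (\<lambda>x. fold (\<lambda>b a. ?app a (Raw [b])) (f x) (Raw []))"
  proof (rule pt_fold_add[OF assms _ pt_const pb_const[of _ 1]])
    show "pt (\<lambda>p. ?app (snd (snd p)) (Raw [fst (snd p)]))"
      by (rule pt_lift2[where h = ?app, OF pt_append0])
        (simp_all add: word_of_raw_def pt_snd pt_fst pt_id pt_lift1[OF bit])
  qed (simp add: word_of_raw_def)
  moreover have "fold (\<lambda>b a. ?app a (Raw [b])) ys r = ?app r (Raw ys)" for ys r
    by (induction ys arbitrary: r) auto
  ultimately show ?thesis by simp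
qed

lemma pt_delim [pt_rules]: "pt f \<Longrightarrow> pt (\<lambda>x. delim (f x))"
  unfolding delim_def by (intro pt_rules)

lemma length_binary: "length (binary n) \<le> n"
proof (induction n rule: binary.induct)
  case (1 n)
  then show ?case by (subst binary.simps) auto
qed

lemma pt_binary [pt_rules]:
  assumes "pt f"
  shows "pt (\<lambda>x. binary (f x))"
proof -
  let ?g = "\<lambda>(m :: nat, a). if m = 0 then (m, a) else (m div 2, a @ [m mod 2 = 1])"
  \<comment> \<open>The bits written so far, followed by those of the rest \<open>m\<close>, are
    always \<open>binary n\<close>. Each halving lowers a nonzero rest by at least one, so
    \<open>n\<close> rounds exhaust it, which is affordable because \<open>n\<close> is
    unary.\<close>
  have s: "fst ((?g ^^ k) (n, [])) \<le> n - k \<and>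
      snd ((?g ^^ k) (n, [])) @ binary (fst ((?g ^^ k) (n, []))) = binary n" for k n
  proof (induction k)
    case (Suc k)
    obtain m a where ma: "(?g ^^ k) (n, []) = (m, a)" by fastforce
    then have "m \<le> n - k" "a @ binary m = binary n" using Suc by auto
    moreover have "binary m = odd m # binary (m div 2)" if "m \<noteq> 0"
      using that by (subst binary.simps) simp
    moreover have "m div 2 \<le> n - Suc k" if "m \<noteq> 0"
      using that \<open>m \<le> n - k\<close> by linarith
    ultimately show ?case by (auto simp: ma odd_iff_mod_2_eq_one)
  qed simp
  have "pt (\<lambda>x. (?g ^^ f x) (f x, []))"
  proof (rule pt_iterate[OF assms])
    show "pt (\<lambda>x. (f x, [] :: bool list))" by (intro pt_rules assms)
    show "pt (\<lambda>p. case snd p of (m :: nat, a) \<Rightarrow> if m = 0 then (m, a) else (m div 2, a @ [m mod 2 = 1]))"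
      by (intro pt_rules)
    show "pb_on UNIV (\<lambda>x. 2 * f x + (3 * f x + 1))" by (intro pb_intros pt_pb assms)
    fix x k
    obtain m a where ma: "(?g ^^ k) (f x, []) = (m, a)" by fastforce
    then have "m \<le> f x" "length a \<le> f x"
      using s[of k "f x"] length_binary[of "f x"] by (auto dest: arg_cong[where f = length])
    moreover have "len a = 3 * length a" for a :: "bool list"
      by (induction a) (auto simp: len_simps)
    ultimately show "len ((?g ^^ k) (f x, [])) \<le> 2 * f x + (3 * f x + 1)"
      unfolding ma len_simps by simp
  qed
  from pt_snd[OF this] show ?thesis
  proof (rule pt_on_cong)
    show "snd ((?g ^^ f x) (f x, [])) = binary (f x)" for x
      using s[of "f x" "f x"] by (auto simp: binary.simps[of 0])
  qed
qed

lemma pt_enc_nat [pt_rules]: "pt f \<Longrightarrow> pt (\<lambda>x. enc_nat (f x))"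
  unfolding enc_nat_def by (intro pt_rules)

text \<open>The list \<open>gs\<close> does not depend on the input, so each element may have a
  program of its own. Thus loops over the states, tapes and symbols of a fixed machine are unrolled,
  and its transition function, about which nothing is computable a priori, becomes a finite
  table.\<close>

lemma pt_concat_const:
  "(\<And>g. g \<in> set gs \<Longrightarrow> pt (f g)) \<Longrightarrow> pt (\<lambda>x. concat (map (\<lambda>g. f g x) gs))"
  by (induction gs) (simp_all add: pt_append pt_const)

lemma len_bools: "len (w :: bool list) = 3 * length w"
  by (induction w) (auto simp: len_simps)

section \<open>Greedy sensing\<close>

lemma in_passes_iff:
  assumes "target_ordering G \<sigma>"
  shows "(t, s) \<in> set (passes G \<sigma> l) \<longleftrightarrow> t \<in> targets G \<and> s \<in> sensors G \<and> \<sigma> t + s = l"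
proof -
  have bij: "bij_betw \<sigma> (targets G) {1..num_targets G}" using assms by (simp add: target_ordering_def)
  have 1: "inv_into (targets G) \<sigma> (\<sigma> t) = t" if "t \<in> targets G" for t
    using bij that by (simp add: bij_betw_def inv_into_f_f)
  have 2: "inv_into (targets G) \<sigma> i \<in> targets G \<and> \<sigma> (inv_into (targets G) \<sigma> i) = i"
    if "1 \<le> i" "i \<le> num_targets G" for i
    using bij that by (auto simp: bij_betw_def intro!: inv_into_into f_inv_into_f)
  have 3: "1 \<le> \<sigma> t \<and> \<sigma> t \<le> num_targets G" if "t \<in> targets G" for t
    using bij that by (auto simp: bij_betw_def)
  have "(t, s) \<in> set (passes G \<sigma> l) \<longleftrightarrow>
      (\<exists>i. 1 \<le> i \<and> i \<le> num_targets G \<and> s < num_sensors G \<and> i + s = l \<and> t = inv_into (targets G) \<sigma> i)"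
    by (auto simp: passes_def less_Suc_eq_le)
  also have "\<dots> \<longleftrightarrow> t \<in> targets G \<and> s \<in> sensors G \<and> \<sigma> t + s = l"
    using 1 2 3 by (auto simp: sensors_def)
  finally show ?thesis .
qed

definition schedule :: "esg \<Rightarrow> (nat \<Rightarrow> nat) \<Rightarrow> (nat \<times> nat) list" where
  "schedule G \<sigma> = concat (map (passes G \<sigma>) [1..<num_targets G + num_sensors G])"

lemma set_schedule:
  assumes "target_ordering G \<sigma>"
  shows "set (schedule G \<sigma>) = targets G \<times> sensors G"
proof -
  have "1 \<le> \<sigma> t + s \<and> \<sigma> t + s < num_targets G + num_sensors G" if "t \<in> targets G" "s \<in> sensors G" for t s
  proof -
    have "\<sigma> t \<in> {1..num_targets G}"
      using assms that(1) by (auto simp: target_ordering_def bij_betw_def)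
    then show ?thesis using that(2) by (auto simp: sensors_def)
  qed
  then show ?thesis
    unfolding schedule_def by (auto simp: in_passes_iff[OF assms])
qed

lemma sorted_concat_levels:
  assumes "\<And>l y. y \<in> set (f l) \<Longrightarrow> key y = (l :: nat)"
  shows "sorted (map key (concat (map f [a..<b])))"
proof (induction b)
  case (Suc b)
  have "sorted (map key (f b))"
    by (rule sorted_iff_nth_mono[THEN iffD2]) (simp add: assms[OF nth_mem])
  then show ?case
    using Suc by (auto simp: sorted_append assms dest: less_imp_le)
qed simp

text \<open>The schedule is sorted by steps. Within one step the order is left open, hence the weak
  inequality in one direction and the strict one in the other.\<close>

lemma schedule_split:
  assumes "target_ordering G \<sigma>" "schedule G \<sigma> = pre @ (t, s) # post"
  shows "\<And>t' s'. (t', s') \<in> set pre \<Longrightarrow> \<sigma> t' + s' \<le> \<sigma> t + s"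
    "\<And>t' s'. t' \<in> targets G \<Longrightarrow> s' \<in> sensors G \<Longrightarrow> \<sigma> t' + s' < \<sigma> t + s \<Longrightarrow> (t', s') \<in> set pre"
proof -
  let ?key = "\<lambda>(t, s). \<sigma> t + s"
  have "sorted (map ?key (schedule G \<sigma>))"
    unfolding schedule_def by (rule sorted_concat_levels) (auto simp: in_passes_iff[OF assms(1)])
  then have srt: "\<forall>y \<in> set pre. ?key y \<le> \<sigma> t + s" "\<forall>y \<in> set post. \<sigma> t + s \<le> ?key y"
    unfolding assms(2) by (auto simp: sorted_append)
  show "\<sigma> t' + s' \<le> \<sigma> t + s" if "(t', s') \<in> set pre" for t' s'
    using srt(1) that by auto
  show "(t', s') \<in> set pre" if "t' \<in> targets G" "s' \<in> sensors G" "\<sigma> t' + s' < \<sigma> t + s" for t' s'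
  proof -
    have "(t', s') \<in> set (pre @ (t, s) # post)"
      using that set_schedule[OF assms(1)] assms(2) by simp
    then show ?thesis using srt(2) that(3) by fastforce
  qed
qed

lemma extension_iff:
  assumes "sensing_plan G \<psi>" "valid_plan G \<sigma> \<psi>" "t \<in> targets G" "s \<in> sensors G"
  shows "sensing_plan G (\<psi>(s := insert t (\<psi> s))) \<and> valid_plan G \<sigma> (\<psi>(s := insert t (\<psi> s))) \<longleftrightarrow>
    can_sense G s t \<and> (\<forall>s' \<in> sensors G. s' \<noteq> s \<longrightarrow> t \<notin> \<psi> s') \<and>
    (\<forall>t' \<in> \<psi> s. t' \<noteq> t \<longrightarrow> recharge G < enat (nat \<bar>int (\<sigma> t) - int (\<sigma> t')\<bar>))"
    (is "?L \<longleftrightarrow> ?R")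
proof
  assume L: ?L
  have "t \<notin> \<psi> s'" if "s' \<in> sensors G" "s' \<noteq> s" for s'
  proof -
    have "(\<psi>(s := insert t (\<psi> s))) s \<inter> (\<psi>(s := insert t (\<psi> s))) s' = {}"
      using L that assms(4) unfolding sensing_plan_def disjoint_family_on_def by metis
    then show ?thesis using that by auto
  qed
  then show ?R using L assms(4) unfolding valid_plan_def by auto
next
  assume R: ?R
  have "disjoint_family_on (\<psi>(s := insert t (\<psi> s))) (sensors G)"
    using R assms(1) unfolding sensing_plan_def disjoint_family_on_def by auto
  moreover have "recharge G < enat (nat \<bar>int (\<sigma> t') - int (\<sigma> t)\<bar>)" if "t' \<in> \<psi> s" "t' \<noteq> t" for t'
  proof -
    have "\<bar>int (\<sigma> t') - int (\<sigma> t)\<bar> = \<bar>int (\<sigma> t) - int (\<sigma> t')\<bar>" by simp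
    then show ?thesis using R that by metis
  qed
  ultimately show ?L
    using R assms unfolding sensing_plan_def valid_plan_def by auto
qed

definition sensed_upto :: "esg \<Rightarrow> (nat \<Rightarrow> nat) \<Rightarrow> (nat \<times> nat) list \<Rightarrow> plan" where
  "sensed_upto G \<sigma> L = fold (try_sense G \<sigma>) L (\<lambda>_. {})"

lemma greedy_plan_schedule: "greedy_plan G \<sigma> = sensed_upto G \<sigma> (schedule G \<sigma>)"
  by (simp add: greedy_plan_def sensed_upto_def schedule_def)

lemma sensed_upto_snoc:
  "sensed_upto G \<sigma> (L @ [(t, s)]) =
    (let \<psi> = sensed_upto G \<sigma> L; \<psi>' = \<psi>(s := insert t (\<psi> s))
     in if sensing_plan G \<psi>' \<and> valid_plan G \<sigma> \<psi>' then \<psi>' else \<psi>)"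
  by (simp add: sensed_upto_def Let_def)

lemma sensed_upto_inv:
  "sensing_plan G (sensed_upto G \<sigma> L) \<and> valid_plan G \<sigma> (sensed_upto G \<sigma> L)"
proof (induction L rule: rev_induct)
  case Nil
  then show ?case
    by (simp add: sensed_upto_def sensing_plan_def valid_plan_def disjoint_family_on_def)
next
  case (snoc x L)
  then show ?case by (cases x) (simp add: sensed_upto_snoc Let_def)
qed

lemma sensed_upto_subset: "t \<in> sensed_upto G \<sigma> L s \<Longrightarrow> (t, s) \<in> set L"
proof (induction L rule: rev_induct)
  case Nil
  then show ?case by (simp add: sensed_upto_def)
next
  case (snoc x L)
  then show ?case by (cases x) (auto simp: sensed_upto_snoc Let_def split: if_splits)
qed

lemma sensed_upto_mono: "sensed_upto G \<sigma> L s \<subseteq> sensed_upto G \<sigma> (L @ L') s"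
proof (induction L' rule: rev_induct)
  case (snoc x L')
  have "sensed_upto G \<sigma> (L @ L') s \<subseteq> sensed_upto G \<sigma> ((L @ L') @ [x]) s"
    by (cases x) (auto simp: sensed_upto_snoc Let_def simp del: append_assoc)
  then show ?case using snoc by simp
qed simp

text \<open>When \<open>t\<close> meets \<open>s\<close>, either \<open>t\<close> is added, or
  \<open>s\<close> is already occupied, or \<open>t\<close> has been sensed before; a single target
  meets the sensors in increasing order, hence \<open>s' \<le> s\<close>.\<close>

lemma greedy_blocked:
  assumes "target_ordering G \<sigma>" "recharge G = \<infinity>" "t \<in> targets G" "s \<in> sensors G" "can_sense G s t"
  shows "greedy_plan G \<sigma> s \<noteq> {} \<or> (\<exists>s' \<in> sensors G. s' \<le> s \<and> t \<in> greedy_plan G \<sigma> s')"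
proof -
  have "(t, s) \<in> set (schedule G \<sigma>)" using set_schedule[OF assms(1)] assms by simp
  then obtain pre post where sp: "schedule G \<sigma> = pre @ (t, s) # post"
    by (meson split_list)
  let ?\<psi> = "sensed_upto G \<sigma> pre"
  have mono: "sensed_upto G \<sigma> (pre @ [(t, s)]) s' \<subseteq> greedy_plan G \<sigma> s'" "?\<psi> s' \<subseteq> greedy_plan G \<sigma> s'" for s'
    using sensed_upto_mono[of G \<sigma> "pre @ [(t, s)]" s' post] sensed_upto_mono[of G \<sigma> pre s' "(t, s) # post"]
    by (simp_all add: greedy_plan_schedule sp)
  note iff = extension_iff[OF conjunct1[OF sensed_upto_inv] conjunct2[OF sensed_upto_inv] assms(3,4), of \<sigma> pre]
  consider "can_sense G s t \<and> (\<forall>s' \<in> sensors G. s' \<noteq> s \<longrightarrow> t \<notin> ?\<psi> s') \<and>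
    (\<forall>t' \<in> ?\<psi> s. t' \<noteq> t \<longrightarrow> recharge G < enat (nat \<bar>int (\<sigma> t) - int (\<sigma> t')\<bar>))"
    | s' where "s' \<in> sensors G" "t \<in> ?\<psi> s'" | "?\<psi> s \<noteq> {}"
    using assms(5) by blast
  then show ?thesis
  proof cases
    case 1
    then have "t \<in> sensed_upto G \<sigma> (pre @ [(t, s)]) s"
      using iff by (simp add: sensed_upto_snoc Let_def)
    then show ?thesis using mono(1)[of s] by blast
  next
    case 2
    then have "(t, s') \<in> set pre" using sensed_upto_subset by blast
    then have "s' \<le> s" using schedule_split(1)[OF assms(1) sp] by fastforce
    then show ?thesis using 2 mono(2)[of s'] by blast
  next
    case 3
    then show ?thesis using mono(2)[of s] by blast
  qed
qed

lemma greedy_plan_props: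
  assumes "recharge G = \<infinity>" "s \<in> sensors G" "t \<in> greedy_plan G \<sigma> s"
  shows "t \<in> targets G" "can_sense G s t"
    "\<And>t'. t' \<in> greedy_plan G \<sigma> s \<Longrightarrow> t' = t"
    "\<And>s'. s' \<in> sensors G \<Longrightarrow> t \<in> greedy_plan G \<sigma> s' \<Longrightarrow> s' = s"
proof -
  note inv = sensed_upto_inv[of G \<sigma> "schedule G \<sigma>", folded greedy_plan_schedule]
  show "t \<in> targets G" "can_sense G s t" "\<And>t'. t' \<in> greedy_plan G \<sigma> s \<Longrightarrow> t' = t"
    using inv assms unfolding sensing_plan_def valid_plan_def by auto
  show "s' = s" if "s' \<in> sensors G" "t \<in> greedy_plan G \<sigma> s'" for s'
    using inv that assms(2,3) unfolding sensing_plan_def disjoint_family_on_def by blast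
qed

text \<open>By \<open>block\<close>, a sensor that could catch a target before its intended one is
  intended for some other target; by \<open>mono\<close>, that other target passes first and
  occupies it. So greedy sensing never deviates from \<open>M\<close>.\<close>

lemma sensed_upto_matching:
  assumes ord: "target_ordering G \<sigma>" and inf: "recharge G = \<infinity>"
    and sens: "\<And>t s. t \<in> targets G \<Longrightarrow> M t = Some s \<Longrightarrow> s \<in> sensors G \<and> can_sense G s t"
    and inj: "\<And>t t' s. t \<in> targets G \<Longrightarrow> t' \<in> targets G \<Longrightarrow> M t = Some s \<Longrightarrow> M t' = Some s \<Longrightarrow> t = t'"
    and block: "\<And>t s. t \<in> targets G \<Longrightarrow> s \<in> sensors G \<Longrightarrow> can_sense G s t \<Longrightarrow> (\<And>s'. M t = Some s' \<Longrightarrow> s < s') \<Longrightarrow>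
      \<exists>t' \<in> targets G. M t' = Some s"
    and mono: "\<And>t t' s. t \<in> targets G \<Longrightarrow> t' \<in> targets G \<Longrightarrow> M t = Some s \<Longrightarrow>
      (\<And>s'. M t' = Some s' \<Longrightarrow> s < s') \<Longrightarrow> \<sigma> t < \<sigma> t'"
    and pre: "schedule G \<sigma> = pre @ post"
  shows "t \<in> sensed_upto G \<sigma> pre s \<longleftrightarrow> (t, s) \<in> set pre \<and> M t = Some s"
  using pre
proof (induction pre arbitrary: post t s rule: rev_induct)
  case Nil
  then show ?case by (simp add: sensed_upto_def)
next
  case (snoc x pre)
  obtain t0 s0 where x: "x = (t0, s0)" by fastforce
  have sp: "schedule G \<sigma> = pre @ (t0, s0) # post" using snoc.prems x by simp
  have IH: "t \<in> sensed_upto G \<sigma> pre s \<longleftrightarrow> (t, s) \<in> set pre \<and> M t = Some s" for t s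
    using snoc.IH[of "(t0, s0) # post"] sp by simp
  have sub: "set pre \<subseteq> targets G \<times> sensors G" and ts: "t0 \<in> targets G" "s0 \<in> sensors G"
    using set_schedule[OF ord] unfolding sp by auto
  let ?\<psi> = "sensed_upto G \<sigma> pre"
  note iff = extension_iff[OF conjunct1[OF sensed_upto_inv] conjunct2[OF sensed_upto_inv] ts, of \<sigma> pre]
  show ?case
  proof (cases "M t0 = Some s0")
    case True
    have "can_sense G s0 t0" using sens[OF ts(1) True] by simp
    moreover have "t0 \<notin> ?\<psi> s'" if "s' \<noteq> s0" for s' using that IH True by simp
    moreover have "t' = t0" if "t' \<in> ?\<psi> s0" for t'
      using that IH inj[OF _ ts(1) _ True] sub by auto
    ultimately have "sensed_upto G \<sigma> (pre @ [x]) = ?\<psi>(s0 := insert t0 (?\<psi> s0))"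
      using iff by (auto simp: x sensed_upto_snoc Let_def)
    then show ?thesis using IH True by (auto simp: x)
  next
    case False
    have "\<not> (can_sense G s0 t0 \<and> (\<forall>s' \<in> sensors G. s' \<noteq> s0 \<longrightarrow> t0 \<notin> ?\<psi> s') \<and>
      (\<forall>t' \<in> ?\<psi> s0. t' \<noteq> t0 \<longrightarrow> recharge G < enat (nat \<bar>int (\<sigma> t0) - int (\<sigma> t')\<bar>)))"
    proof
      assume add: "can_sense G s0 t0 \<and> (\<forall>s' \<in> sensors G. s' \<noteq> s0 \<longrightarrow> t0 \<notin> ?\<psi> s') \<and>
      (\<forall>t' \<in> ?\<psi> s0. t' \<noteq> t0 \<longrightarrow> recharge G < enat (nat \<bar>int (\<sigma> t0) - int (\<sigma> t')\<bar>))"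
      show False
      \<comment> \<open>If the intended sensor comes earlier, \<open>t0\<close> has been sensed
        there already. Otherwise \<open>s0\<close> is occupied by the target intended for it, and
        with infinite recharging time it stays occupied.\<close>
      proof (cases "\<exists>s'. M t0 = Some s' \<and> s' < s0")
        case True
        then obtain s' where s': "M t0 = Some s'" "s' < s0" by blast
        then have "s' \<in> sensors G" using ts(2) by (simp add: sensors_def)
        then have "(t0, s') \<in> set pre"
          using schedule_split(2)[OF ord sp ts(1)] s' by simp
        then have "t0 \<in> ?\<psi> s'" using IH s' by simp
        then show False using add s' \<open>s' \<in> sensors G\<close> by auto
      next
        case later: False
        have gt: "s0 < s'" if "M t0 = Some s'" for s'
          using later False that by (metis linorder_neqE_nat)
        obtain t' where t': "t' \<in> targets G" "M t' = Some s0"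
          using block[OF ts] add gt by blast
        have "\<sigma> t' < \<sigma> t0" using mono[OF t'(1) ts(1) t'(2)] gt by blast
        then have "(t', s0) \<in> set pre" "t' \<noteq> t0"
          using schedule_split(2)[OF ord sp t'(1) ts(2)] by auto
        then show False using add IH t'(2) inf by auto
      qed
    qed
    then have "sensed_upto G \<sigma> (pre @ [x]) = ?\<psi>"
      using iff by (auto simp: x sensed_upto_snoc Let_def)
    then show ?thesis using IH False by (auto simp: x)
  qed
qed

lemma matching_ordering:
  fixes key :: "nat \<Rightarrow> nat"
  shows "\<exists>\<sigma>. target_ordering G \<sigma> \<and> (\<forall>t \<in> targets G. \<forall>t' \<in> targets G. key t < key t' \<longrightarrow> \<sigma> t < \<sigma> t')"
proof -
  let ?n = "num_targets G"
  define xs where "xs = sort_key key [0..<?n]"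
  have xs: "distinct xs" "set xs = targets G" "length xs = ?n" "sorted (map key xs)"
    by (auto simp: xs_def targets_def)
  have bij: "bij_betw ((!) xs) {..<?n} (targets G)"
    using bij_betw_nth[OF xs(1), of "{..<?n}" "targets G"] xs by simp
  define \<sigma> where "\<sigma> t = Suc (inv_into {..<?n} ((!) xs) t)" for t
  have inv: "bij_betw (inv_into {..<?n} ((!) xs)) (targets G) {..<?n}"
    using bij by (rule bij_betw_inv_into)
  have "bij_betw Suc {..<?n} {1..?n}"
    by (auto simp: bij_betw_def image_Suc_lessThan)
  from bij_betw_trans[OF inv this] have "target_ordering G \<sigma>"
    unfolding target_ordering_def \<sigma>_def comp_def .
  moreover have "\<sigma> t < \<sigma> t'" if t: "t \<in> targets G" "t' \<in> targets G" "key t < key t'" for t t'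
  proof (rule ccontr)
    let ?i = "inv_into {..<?n} ((!) xs)"
    assume "\<not> \<sigma> t < \<sigma> t'"
    then have "?i t' \<le> ?i t" by (simp add: \<sigma>_def)
    moreover have "?i t < ?n" "?i t' < ?n" using inv t by (auto simp: bij_betw_def)
    moreover have "xs ! ?i t = t" "xs ! ?i t' = t'"
      using bij t by (auto simp: bij_betw_def intro: f_inv_into_f)
    ultimately have "key t' \<le> key t"
      using sorted_nth_mono[OF xs(4), of "?i t'" "?i t"] xs(3) by simp
    then show False using t(3) by simp
  qed
  ultimately show ?thesis by blast
qed

text \<open>Sorting the targets by their intended sensors yields the condition \<open>mono\<close>
  of \<open>sensed_upto_matching\<close>.\<close>

lemma greedy_realizes_matching:
  assumes inf: "recharge G = \<infinity>"
    and sens: "\<And>t s. t \<in> targets G \<Longrightarrow> M t = Some s \<Longrightarrow> s \<in> sensors G \<and> can_sense G s t"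
    and inj: "\<And>t t' s. t \<in> targets G \<Longrightarrow> t' \<in> targets G \<Longrightarrow> M t = Some s \<Longrightarrow> M t' = Some s \<Longrightarrow> t = t'"
    and block: "\<And>t s. t \<in> targets G \<Longrightarrow> s \<in> sensors G \<Longrightarrow> can_sense G s t \<Longrightarrow> (\<And>s'. M t = Some s' \<Longrightarrow> s < s') \<Longrightarrow>
      \<exists>t' \<in> targets G. M t' = Some s"
  shows "\<exists>\<sigma>. target_ordering G \<sigma> \<and> (\<forall>s t. t \<in> greedy_plan G \<sigma> s \<longrightarrow> M t = Some s)"
proof -
  \<comment> \<open>Targets that are to stay unsensed get a key above all sensors, so they pass last
    and find every sensor that could catch them occupied.\<close>
  let ?key = "\<lambda>t. case M t of None \<Rightarrow> num_sensors G | Some s \<Rightarrow> s"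
  obtain \<sigma> where \<sigma>: "target_ordering G \<sigma>"
    "\<And>t t'. t \<in> targets G \<Longrightarrow> t' \<in> targets G \<Longrightarrow> ?key t < ?key t' \<Longrightarrow> \<sigma> t < \<sigma> t'"
    using matching_ordering[of G ?key] by blast
  have mono: "\<sigma> t < \<sigma> t'" if "t \<in> targets G" "t' \<in> targets G" "M t = Some s"
    "\<And>s'. M t' = Some s' \<Longrightarrow> s < s'" for t t' s
    using that(4) sens[OF that(1,3)] by (intro \<sigma>(2)[OF that(1,2)]) (auto simp: that(3) sensors_def split: option.splits)
  have "t \<in> sensed_upto G \<sigma> (schedule G \<sigma>) s \<longleftrightarrow> (t, s) \<in> set (schedule G \<sigma>) \<and> M t = Some s" for t s
    by (rule sensed_upto_matching[OF \<sigma>(1) inf sens inj block mono, where post = "[]"]) auto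
  then show ?thesis using \<sigma>(1) by (auto simp: greedy_plan_schedule)
qed

section \<open>From satisfiability to sensing games\<close>

text \<open>A formula is the list of its literals, each clause being a block of four consecutive ones.\<close>

type_synonym 'v formula = "(bool \<times> 'v) list"

definition clauses_hold :: "'v formula \<Rightarrow> ('v \<Rightarrow> bool) \<Rightarrow> bool" where
  "clauses_hold F \<alpha> \<longleftrightarrow>
    (\<forall>j < length F div 4. \<exists>r<4. \<alpha> (snd (F ! (4 * j + r))) = fst (F ! (4 * j + r)))"

text \<open>The previous occurrence of the same variable. Linking only neighbouring occurrences adds
  at most two entries to the column of each sensor \<open>V\<close>.\<close>

definition pred_slot :: "'v formula \<Rightarrow> nat \<Rightarrow> nat \<Rightarrow> bool" where
  "pred_slot F r u \<longleftrightarrow> r < u \<and> snd (F ! r) = snd (F ! u) \<and>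
    (\<forall>q \<in> {r<..<u}. snd (F ! q) \<noteq> snd (F ! u))"

text \<open>
  There is one copy of a variable for each slot \<open>u < N\<close>. The sensor \<open>V\<^sub>b\<^sub>,\<^sub>u = (4 + b) N + u\<close> is met
  iff the copy has value \<open>b\<close>; \<open>N + u\<close> chooses this value by sensing one of the targets
  \<open>(1 + b) N + u\<close>, and the other one goes on to \<open>V\<^sub>b\<^sub>,\<^sub>u\<close>. The four targets of a clause compete for
  three private sensors, so one of them goes on to the sensor \<open>V\<close> of its literal, where it
  costs nothing iff the literal is true. In the same way the sensor \<open>(2 + o) N + u\<close> and the two
  targets \<open>(3 + 2 o + i) N + u\<close> form a clause with two literals, which for \<open>o = 0, 1\<close> make the copy
  at \<open>u\<close> equal to the previous copy of the same variable.
\<close>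

definition adj :: "'v formula \<Rightarrow> nat \<Rightarrow> nat \<Rightarrow> bool" where
  "adj F t s = (let N = length F; ty = t div N; u = t mod N; k = (ty - 3) div 2 in
     if ty = 0 then s < N \<and> s div 4 = u div 4 \<and> s mod 4 \<noteq> 3 \<or> s = (if fst (F ! u) then 5 * N + u else 4 * N + u)
     else if ty < 3 then s = N + u \<or> s = (3 + ty) * N + u
     else s = (2 + k) * N + u \<or>
       (\<exists>r<u. pred_slot F r u \<and> s = (if odd (ty - 3) then (5 - k) * N + u else (4 + k) * N + r)))"

definition gadget :: "'v formula \<Rightarrow> esg" where
  "gadget F = \<lparr>target_values = replicate (7 * length F) 1, num_sensors = 6 * length F,
    recharge = \<infinity>, sensing = map (\<lambda>t. map (adj F t) [0..<6 * length F]) [0..<7 * length F]\<rparr>"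

section \<open>The numbering of the targets and sensors of the gadget\<close>

locale formula =
  fixes F :: "'v formula" and m N :: nat
  assumes len: "length F = N" and N: "N = 4 * m"
begin

abbreviation "G \<equiv> gadget F"

text \<open>Names for the blocks of \<open>adj\<close>: clause targets \<open>tA\<close>, choice
  targets \<open>tB\<close>, link targets \<open>tL\<close>, and the sensors that choose
  (\<open>sA\<close>), link (\<open>sE\<close>) and stand for a value (\<open>sV\<close>). The
  private sensors of clause \<open>j\<close> are \<open>4 * j\<close>, \<open>4 * j + 1\<close> and
  \<open>4 * j + 2\<close>; the sensor \<open>4 * j + 3\<close> can sense nothing and only fills up
  the block.\<close>

definition tA :: "nat \<Rightarrow> nat" where "tA u = u"
definition tB :: "bool \<Rightarrow> nat \<Rightarrow> nat" where "tB b u = (if b then 2 * N + u else N + u)"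
definition tL :: "bool \<Rightarrow> bool \<Rightarrow> nat \<Rightarrow> nat" where
  "tL o1 i u = (if o1 then if i then 6 * N + u else 5 * N + u else if i then 4 * N + u else 3 * N + u)"
definition sA :: "nat \<Rightarrow> nat" where "sA u = N + u"
definition sE :: "bool \<Rightarrow> nat \<Rightarrow> nat" where "sE b u = (if b then 3 * N + u else 2 * N + u)"
definition sV :: "bool \<Rightarrow> nat \<Rightarrow> nat" where "sV b u = (if b then 5 * N + u else 4 * N + u)"

lemmas ids = tA_def tB_def tL_def sA_def sE_def sV_def

lemma block: "u < N \<Longrightarrow> (c * N + u) div N = c" "u < N \<Longrightarrow> (c * N + u) mod N = u"
  by simp_all

lemma block_N: "u < N \<Longrightarrow> (N + u) div N = 1" "u < N \<Longrightarrow> (N + u) mod N = u"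
  using block[of u 0] block[of u 1] by simp_all

lemma targets_G: "targets G = {..<7 * N}" and sensors_G: "sensors G = {..<6 * N}"
  by (simp_all add: targets_def num_targets_def sensors_def gadget_def len)

lemma recharge_G: "recharge G = \<infinity>"
  by (simp add: gadget_def)

lemma can_sense_G: "t < 7 * N \<Longrightarrow> s < 6 * N \<Longrightarrow> can_sense G s t \<longleftrightarrow> adj F t s"
  by (simp add: can_sense_def gadget_def len)

lemma adj_A: "u < N \<Longrightarrow> adj F (tA u) s \<longleftrightarrow>
    s < N \<and> s div 4 = u div 4 \<and> s mod 4 \<noteq> 3 \<or> s = sV (fst (F ! u)) u"
  by (simp add: adj_def Let_def len block_N ids)

lemma adj_B: "u < N \<Longrightarrow> adj F (tB b u) s \<longleftrightarrow> s = sA u \<or> s = sV b u"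
  by (simp add: adj_def Let_def len block block_N ids)

lemma adj_L: "u < N \<Longrightarrow> adj F (tL k i u) s \<longleftrightarrow>
    s = sE k u \<or> (\<exists>r<u. pred_slot F r u \<and> s = (if i then sV (\<not> k) u else sV k r))"
  by (cases k; cases i) (simp_all add: adj_def Let_def len block block_N ids)

lemma id_less: "u < N \<Longrightarrow> tA u < 7 * N" "u < N \<Longrightarrow> tB b u < 7 * N" "u < N \<Longrightarrow> tL k i u < 7 * N"
  "u < N \<Longrightarrow> sA u < 6 * N" "u < N \<Longrightarrow> sE b u < 6 * N" "u < N \<Longrightarrow> sV b u < 6 * N"
  by (auto simp: ids)

lemma target_cases:
  assumes "t < 7 * N"
  obtains u where "u < N" "t = tA u" | u b where "u < N" "t = tB b u" | u k i where "u < N" "t = tL k i u"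
proof -
  define ty u where "ty = t div N" and "u = t mod N"
  have N0: "N > 0" using assms by (cases "N = 0") auto
  have t: "t = ty * N + u" "u < N" using N0 by (simp_all add: ty_def u_def)
  have "ty < 7" unfolding ty_def using assms N0 by (simp add: div_less_iff_less_mult)
  then consider "ty = 0" | "ty = 1" | "ty = 2" | "ty = 3" | "ty = 4" | "ty = 5" | "ty = 6" by linarith
  then show ?thesis
  proof cases
    case 1 then show ?thesis using that(1)[of u] t by (simp add: ids)
  next
    case 2 then show ?thesis using that(2)[of u False] t by (simp add: ids)
  next
    case 3 then show ?thesis using that(2)[of u True] t by (simp add: ids)
  next
    case 4 then show ?thesis using that(3)[of u False False] t by (simp add: ids)
  next
    case 5 then show ?thesis using that(3)[of u False True] t by (simp add: ids)
  next
    case 6 then show ?thesis using that(3)[of u True False] t by (simp add: ids)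
  next
    case 7 then show ?thesis using that(3)[of u True True] t by (simp add: ids)
  qed
qed

text \<open>The comparisons matter for the fixed sensor order: the sensors \<open>V\<close> come
  last, so a target reaches one only after passing all its other sensors.\<close>

lemma id_eqs:
  assumes "u < N" "v < N"
  shows "sV b u = sV c v \<longleftrightarrow> b = c \<and> u = v" "sE b u = sE c v \<longleftrightarrow> b = c \<and> u = v" "sA u = sA v \<longleftrightarrow> u = v"
    "sV b u \<noteq> sE c v" "sV b u \<noteq> sA v" "sE b u \<noteq> sA v" "sE c v \<noteq> sV b u" "sA v \<noteq> sV b u" "sA v \<noteq> sE b u"
    "sV b u \<noteq> v" "sE b u \<noteq> v" "sA u \<noteq> v" "v \<noteq> sV b u" "v \<noteq> sE b u" "v \<noteq> sA u"
    "\<not> sA u < N" "\<not> sE b u < N" "\<not> sV b u < N" "sE b u < sV c v" "sA u < sV c v" "u < sV c v" "u < sE c v" "u < sA v" "sA u < sE c v"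
  using assms by (auto simp: ids split: if_splits)

lemma pred_slot_unique: "pred_slot F r u \<Longrightarrow> pred_slot F r' u \<Longrightarrow> r = r'"
  by (metis greaterThanLessThan_iff linorder_neqE_nat pred_slot_def)

lemma succ_slot_unique: "pred_slot F r u \<Longrightarrow> pred_slot F r u' \<Longrightarrow> u = u'"
  by (metis greaterThanLessThan_iff linorder_neqE_nat pred_slot_def)

text \<open>Equality is passed along the chain of previous occurrences, from \<open>u\<close> down
  to \<open>r\<close>.\<close>

lemma same_copies:
  fixes z :: "nat \<Rightarrow> bool"
  assumes "\<And>r u. u < N \<Longrightarrow> pred_slot F r u \<Longrightarrow> z r = z u" "u < N" "r \<le> u" "snd (F ! r) = snd (F ! u)"
  shows "z r = z u"
  using assms(2-)
proof (induction u rule: less_induct)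
  case (less u)
  show ?case
  proof (cases "r = u")
    case False
    define q where "q = Max {q. q < u \<and> snd (F ! q) = snd (F ! u)}"
    have fin: "finite {q. q < u \<and> snd (F ! q) = snd (F ! u)}" by simp
    have r: "r \<in> {q. q < u \<and> snd (F ! q) = snd (F ! u)}" using less.prems False by simp
    have q: "q < u" "snd (F ! q) = snd (F ! u)"
      using Max_in[OF fin] r unfolding q_def by blast+
    have "r \<le> q" using Max_ge[OF fin r] by (simp add: q_def)
    have "pred_slot F q u"
      unfolding pred_slot_def using q Max_ge[OF fin] unfolding q_def[symmetric]
      by (auto simp: not_le[symmetric])
    then have "z q = z u" using assms(1) less.prems(1) by blast
    moreover have "z r = z q"
      using less.IH[OF q(1)] q less.prems \<open>r \<le> q\<close> by simp
    ultimately show ?thesis by simp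
  qed simp
qed

section \<open>Row and column sums of the gadget\<close>

lemma wf_G: "wf_esg G"
  by (auto simp: wf_esg_def gadget_def num_targets_def)

lemma card_le4: "A \<subseteq> {a, b, c, d} \<Longrightarrow> card A \<le> 4"
  using card_mono[of "{a, b, c, d}" A] card_insert_le_m1[of 4 "{b, c, d}" a]
    card_insert_le_m1[of 3 "{c, d}" b] card_insert_le_m1[of 2 "{d}" c] by simp

lemma row_sum_G:
  assumes "t < 7 * N"
  shows "row_sum G t \<le> 4"
proof -
  have eq: "{s \<in> sensors G. can_sense G s t} \<subseteq> {s. adj F t s}"
    using assms by (auto simp: sensors_G can_sense_G)
  from assms show ?thesis
  proof (cases rule: target_cases)
    case (1 u)
    have "s = 4 * (u div 4) \<or> s = 4 * (u div 4) + 1 \<or> s = 4 * (u div 4) + 2"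
      if "s div 4 = u div 4" "s mod 4 \<noteq> 3" for s
      using that mult_div_mod_eq[of 4 s] mod_less_divisor[of 4 s] by simp linarith
    then have "{s. adj F t s} \<subseteq> {4 * (u div 4), 4 * (u div 4) + 1, 4 * (u div 4) + 2, sV (fst (F ! u)) u}"
      using 1 by (auto simp: adj_A)
    then show ?thesis unfolding row_sum_def by (intro card_le4[OF subset_trans[OF eq]])
  next
    case (2 u b)
    then have "{s. adj F t s} \<subseteq> {sA u, sV b u, sV b u, sV b u}" by (auto simp: adj_B)
    then show ?thesis unfolding row_sum_def by (intro card_le4[OF subset_trans[OF eq]])
  next
    case (3 u k i)
    let ?s = "if i then sV (\<not> k) u else sV k (SOME r. pred_slot F r u)"
    have "r = (SOME r. pred_slot F r u)" if "pred_slot F r u" for r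
      using pred_slot_unique[OF that someI[of "\<lambda>r. pred_slot F r u", OF that]] .
    then have "{s. adj F t s} \<subseteq> {sE k u, ?s, ?s, ?s}" using 3 by (auto simp: adj_L split: if_splits)
    then show ?thesis unfolding row_sum_def by (intro card_le4[OF subset_trans[OF eq]])
  qed
qed

lemma sensor_cases:
  assumes "s < 6 * N"
  obtains "s < N" | u where "u < N" "s = sA u" | u b where "u < N" "s = sE b u" | u b where "u < N" "s = sV b u"
proof -
  define ty u where "ty = s div N" and "u = s mod N"
  have N0: "N > 0" using assms by (cases "N = 0") auto
  have t: "s = ty * N + u" "u < N" using N0 by (simp_all add: ty_def u_def)
  have "ty < 6" unfolding ty_def using assms N0 by (simp add: div_less_iff_less_mult)
  then consider "ty = 0" | "ty = 1" | "ty = 2" | "ty = 3" | "ty = 4" | "ty = 5" by linarith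
  then show ?thesis
  proof cases
    case 1 then show ?thesis using that(1) t by (simp add: ids)
  next
    case 2 then show ?thesis using that(2)[of u] t by (simp add: ids)
  next
    case 3 then show ?thesis using that(3)[of u False] t by (simp add: ids)
  next
    case 4 then show ?thesis using that(3)[of u True] t by (simp add: ids)
  next
    case 5 then show ?thesis using that(4)[of u False] t by (simp add: ids)
  next
    case 6 then show ?thesis using that(4)[of u True] t by (simp add: ids)
  qed
qed

lemma col_sum_le4:
  assumes "\<And>t. t < 7 * N \<Longrightarrow> adj F t s \<Longrightarrow> t \<in> {a, b, c, d}" "s < 6 * N"
  shows "col_sum G s \<le> 4"
proof -
  have "t \<in> {a, b, c, d}" if "t \<in> targets G" "can_sense G s t" for t
    using that assms(1)[of t] assms(2) by (simp only: targets_G can_sense_G lessThan_iff)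
  then show ?thesis unfolding col_sum_def by (intro card_le4) blast
qed

lemma col_sum_G:
  assumes "s < 6 * N"
  shows "col_sum G s \<le> 4"
  using assms
proof (cases rule: sensor_cases)
    case 1
    have "t \<in> {4 * (s div 4), 4 * (s div 4) + 1, 4 * (s div 4) + 2, 4 * (s div 4) + 3}"
      if "t < 7 * N" "adj F t s" for t
      using that(1)
    proof (cases rule: target_cases)
      case (1 u)
      then have "s div 4 = u div 4" using that \<open>s < N\<close> by (auto simp: adj_A id_eqs)
      then show ?thesis using mult_div_mod_eq[of 4 u] mod_less_divisor[of 4 u]
        unfolding 1(2) tA_def insert_iff empty_iff by simp linarith
    next
      case (2 u b)
      then show ?thesis using that \<open>s < N\<close> by (auto simp: adj_B id_eqs)
    next
      case (3 u k i)
      then show ?thesis using that \<open>s < N\<close> by (auto simp: adj_L id_eqs split: if_splits)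
    qed
    then show ?thesis by (rule col_sum_le4[OF _ assms])
  next
    case (2 v)
    have "t \<in> {tB False v, tB True v, tB True v, tB True v}" if "t < 7 * N" "adj F t s" for t
      using that(1)
    proof (cases rule: target_cases)
      case (1 u)
      then show ?thesis using that 2 by (auto simp: adj_A id_eqs)
    next
      case (2 u b)
      then show ?thesis using that \<open>v < N\<close> \<open>s = sA v\<close> by (cases b) (auto simp: adj_B id_eqs)
    next
      case (3 u k i)
      then show ?thesis using that 2 by (auto simp: adj_L id_eqs split: if_splits)
    qed
    then show ?thesis by (rule col_sum_le4[OF _ assms])
  next
    case (3 v c)
    have "t \<in> {tL c False v, tL c True v, tL c True v, tL c True v}" if "t < 7 * N" "adj F t s" for t
      using that(1)
    proof (cases rule: target_cases)
      case (1 u)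
      then show ?thesis using that 3 by (auto simp: adj_A id_eqs)
    next
      case (2 u b)
      then show ?thesis using that 3 by (auto simp: adj_B id_eqs)
    next
      case (3 u k i)
      then show ?thesis using that \<open>v < N\<close> \<open>s = sE c v\<close>
        by (cases i) (auto simp: adj_L id_eqs split: if_splits)
    qed
    then show ?thesis by (rule col_sum_le4[OF _ assms])
  next
    case (4 v c)
    \<comment> \<open>The clause target and a choice target of the slot, one link target of the slot
      itself, and one of the next copy. The next copy is unique; if there is none, the
      \<open>SOME\<close> term is a mere filler.\<close>
    have "t \<in> {tA v, tB c v, tL c False (SOME w. pred_slot F v w), tL (\<not> c) True v}"
      if "t < 7 * N" "adj F t s" for t
      using that(1)
    proof (cases rule: target_cases)
      case (1 u)
      then show ?thesis using that 4 by (auto simp: adj_A id_eqs)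
    next
      case (2 u b)
      then show ?thesis using that 4 by (auto simp: adj_B id_eqs)
    next
      case (3 u k i)
      have "u = (SOME w. pred_slot F v w)" if "pred_slot F v u"
        using succ_slot_unique[OF that someI[of "pred_slot F v", OF that]] .
      then show ?thesis using that \<open>v < N\<close> \<open>s = sV c v\<close> 3
        by (cases i) (auto simp: adj_L id_eqs split: if_splits)
    qed
    then show ?thesis by (rule col_sum_le4[OF _ assms])
qed

lemma restricted_G: "restricted_esg G"
proof -
  have "\<forall>v \<in> set (target_values G). v = 1" by (simp add: gadget_def)
  then show ?thesis
    unfolding restricted_esg_def
    using row_sum_G col_sum_G by (simp add: targets_G sensors_G recharge_G)
qed

section \<open>Correctness of the gadget\<close>

lemma unsensed_value_G:
  "unsensed_value G \<psi> = of_nat (card (targets G - (\<Union>s \<in> sensors G. \<psi> s)))"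
proof -
  have "target_values G ! t = 1" if "t \<in> targets G" for t
    using that by (simp add: targets_G) (simp add: gadget_def len)
  then show ?thesis by (simp add: unsensed_value_def)
qed

text \<open>Each used sensor senses a target of its own, so at most
  \<open>7 * N - 9 * m = 19 * m\<close> sensors are used. As many are forced by pigeonhole arguments
  in every ordering, hence exactly one sensor \<open>V\<close> is used for each slot.\<close>

lemma satisfying_of_ordering:
  assumes ord: "target_ordering G \<sigma>" and val: "9 * m \<le> card (targets G - (\<Union>s \<in> sensors G. greedy_plan G \<sigma> s))"
  shows "\<exists>\<alpha>. clauses_hold F \<alpha>"
proof -
  let ?\<psi> = "greedy_plan G \<sigma>"
  define U where "U = {s \<in> sensors G. ?\<psi> s \<noteq> {}}"
  note props = greedy_plan_props[OF recharge_G, of _ _ \<sigma>]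
  let ?S = "\<Union>s \<in> sensors G. ?\<psi> s"
  have fin: "finite (targets G)" "finite (sensors G)" by (simp_all add: targets_G sensors_G)
  have sub: "?S \<subseteq> targets G" using props(1) by blast
  have "card ?S = 7 * N - card (targets G - ?S)"
    using card_Diff_subset[OF finite_subset[OF sub fin(1)] sub] card_mono[OF fin(1) sub]
    by (simp add: targets_G)
  then have cS: "card ?S \<le> 19 * m" using val N by simp
  have "card U \<le> card ?S"
  proof (rule card_inj_on_le)
    let ?f = "\<lambda>s. SOME t. t \<in> ?\<psi> s"
    have f: "?f s \<in> ?\<psi> s" if "s \<in> U" for s
      using that by (simp add: U_def some_in_eq)
    show "inj_on ?f U"
      by (rule inj_onI) (metis (mono_tags, lifting) U_def f mem_Collect_eq props(4))
    show "?f ` U \<subseteq> ?S" using f by (auto simp: U_def)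
    show "finite ?S" using finite_subset[OF sub fin(1)] .
  qed
  then have cU: "card U \<le> 19 * m" using cS by simp
  have blocked: "s \<in> U \<or> (\<exists>s' < s. s' < 6 * N \<and> adj F t s' \<and> t \<in> ?\<psi> s')"
    if "t < 7 * N" "s < 6 * N" "adj F t s" for t s
  proof -
    have "?\<psi> s \<noteq> {} \<or> (\<exists>s' \<in> sensors G. s' \<le> s \<and> t \<in> ?\<psi> s')"
      by (rule greedy_blocked[OF ord recharge_G]) (use that in \<open>auto simp: targets_G sensors_G can_sense_G\<close>)
    then show ?thesis
    proof
      assume "\<exists>s' \<in> sensors G. s' \<le> s \<and> t \<in> ?\<psi> s'"
      then obtain s' where s': "s' \<in> sensors G" "s' \<le> s" "t \<in> ?\<psi> s'" by blast
      have "adj F t s'" using props(2)[OF s'(1,3)] s'(1) that(1) by (simp add: can_sense_G sensors_G)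
      then show ?thesis using s' by (cases "s' = s") (auto simp: U_def sensors_G)
    qed (use that in \<open>auto simp: U_def sensors_G\<close>)
  qed
  have single: "t = t'" if "s < 6 * N" "t \<in> ?\<psi> s" "t' \<in> ?\<psi> s" for s t t'
    using props(3)[of s t'] that by (simp add: sensors_G)
  \<comment> \<open>\<open>sA u\<close> senses at most one of the two choice targets. The other one
    is stopped nowhere else before, so \<open>sA u\<close> is used and then its sensor
    \<open>V\<close> as well.\<close>
  have choice: "sA u \<in> U \<and> (sV False u \<in> U \<or> sV True u \<in> U)" if u: "u < N" for u
  proof -
    have "tB False u \<noteq> tB True u" using u by (simp add: ids)
    then obtain b where b: "tB b u \<notin> ?\<psi> (sA u)"
      using single[of "sA u"] id_less(4)[OF u] by blast
    have "sA u \<in> U"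
      using blocked[of "tB b u" "sA u"] u b id_eqs(20)[OF u u, of b]
      by (auto simp: id_less adj_B dest: less_asym)
    moreover have "sV b u \<in> U"
      using blocked[of "tB b u" "sV b u"] u b by (auto simp: id_less adj_B id_eqs)
    ultimately show ?thesis by (cases b) auto
  qed
  \<comment> \<open>Again one of two targets escapes \<open>sE k u\<close> and goes on to a sensor
    \<open>V\<close>. Once these determine values, this says that copy \<open>r\<close> has value
    \<open>k\<close> or copy \<open>u\<close> has not; for both \<open>k\<close> together, the
    copies agree.\<close>
  have link: "sE k u \<in> U \<and> (\<forall>r. pred_slot F r u \<longrightarrow> sV k r \<in> U \<or> sV (\<not> k) u \<in> U)" if u: "u < N" for k u
  proof -
    have "tL k False u \<noteq> tL k True u" using u by (simp add: ids)
    then obtain i where i: "tL k i u \<notin> ?\<psi> (sE k u)"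
      using single[of "sE k u"] id_less(5)[OF u] by blast
    have lt: "sE k u < (if i then sV (\<not> k) u else sV k r)" if "r < u" for r
      using u that by (simp add: id_eqs)
    have "\<not> adj F (tL k i u) s'" if s': "s' < sE k u" for s'
    proof
      assume "adj F (tL k i u) s'"
      then obtain r where "r < u" "s' = (if i then sV (\<not> k) u else sV k r)"
        using u s' by (auto simp: adj_L)
      then have "sE k u < s'" using lt by simp
      then show False using s' by simp
    qed
    then have "sE k u \<in> U"
      using blocked[of "tL k i u" "sE k u"] u by (auto simp: id_less adj_L)
    moreover have "sV k r \<in> U \<or> sV (\<not> k) u \<in> U" if r: "pred_slot F r u" for r
    proof -
      have "r < u" using r by (simp add: pred_slot_def)
      let ?s = "if i then sV (\<not> k) u else sV k r"
      have "s' = sE k u \<or> s' = ?s" if "adj F (tL k i u) s'" for s'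
        using that u pred_slot_unique[OF r] by (auto simp: adj_L split: if_splits)
      moreover have "adj F (tL k i u) ?s" using u r \<open>r < u\<close> by (auto simp: adj_L)
      ultimately have "?s \<in> U"
        using blocked[of "tL k i u" ?s] u i \<open>r < u\<close> by (auto simp: id_less split: if_splits)
      then show ?thesis by (auto split: if_splits)
    qed
    ultimately show ?thesis by blast
  qed
  have clause: "(\<forall>d<3. 4 * j + d \<in> U) \<and> (\<exists>r<4. sV (fst (F ! (4 * j + r))) (4 * j + r) \<in> U)" if j: "j < m" for j
  proof -
    have less: "4 * j + r < N" if "r < 4" for r using that j N by simp
    \<comment> \<open>Pigeonhole: three private sensors cannot sense all four targets of a clause.
      One that escapes them finds all three used and goes on to the sensor of its literal.\<close>
    have "\<exists>r<4. \<forall>d<3. 4 * j + r \<notin> ?\<psi> (4 * j + d)"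
    proof (rule ccontr)
      assume "\<not> ?thesis"
      then obtain f where f: "\<And>r. r < 4 \<Longrightarrow> f r < 3 \<and> 4 * j + r \<in> ?\<psi> (4 * j + f r)" by metis
      have "inj_on f {..<4 :: nat}"
      proof (rule inj_onI)
        fix r r' :: nat assume "r \<in> {..<4}" "r' \<in> {..<4}" "f r = f r'"
        then show "r = r'"
          using f[of r] f[of r'] single[of "4 * j + f r" "4 * j + r" "4 * j + r'"] less[of "f r"] by simp
      qed
      moreover have "f ` {..<4} \<subseteq> {..<3}" using f by auto
      ultimately have "card {..<4 :: nat} \<le> card {..<3 :: nat}" by (intro card_inj_on_le) auto
      then show False by simp
    qed
    then obtain r where r: "r < 4" "\<And>d. d < 3 \<Longrightarrow> 4 * j + r \<notin> ?\<psi> (4 * j + d)" by blast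
    let ?u = "4 * j + r"
    have u: "?u < N" using less r by simp
    have C: "s' = sV (fst (F ! ?u)) ?u \<or> s' < N \<and> ?u \<notin> ?\<psi> s'" if "adj F (tA ?u) s'" for s'
    proof -
      have "?u div 4 = j" using r(1) by simp
      then have "s' = sV (fst (F ! ?u)) ?u \<or> s' < N \<and> s' div 4 = j \<and> s' mod 4 \<noteq> 3"
        using that u unfolding adj_A[OF u] by metis
      moreover have "s' = 4 * j + (s' mod 4) \<and> s' mod 4 < 3" if "s' div 4 = j" "s' mod 4 \<noteq> 3"
        using that mult_div_mod_eq[of 4 s'] mod_less_divisor[of 4 s'] by simp
      ultimately show ?thesis using r(2) by metis
    qed
    have "4 * j + d \<in> U" if d: "d < 3" for d
    proof -
      have "adj F (tA ?u) (4 * j + d)"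
        using d r(1) u less[of d] by (simp add: adj_A)
      then show ?thesis
        using blocked[of "tA ?u" "4 * j + d"] C id_less(1)[OF u] less[of d] d
          id_eqs(21)[OF less[of d] u, of "fst (F ! ?u)"]
        by (fastforce simp: tA_def)
    qed
    moreover have "sV (fst (F ! ?u)) ?u \<in> U"
    proof -
      have "adj F (tA ?u) (sV (fst (F ! ?u)) ?u)" using u by (simp add: adj_A)
      from blocked[OF id_less(1)[OF u] id_less(6)[OF u] this] show ?thesis
      proof
        assume "\<exists>s'<sV (fst (F ! ?u)) ?u. s' < 6 * N \<and> adj F (tA ?u) s' \<and> tA ?u \<in> ?\<psi> s'"
        then obtain s' where "s' < sV (fst (F ! ?u)) ?u" "adj F (tA ?u) s'" "tA ?u \<in> ?\<psi> s'" by blast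
        then show ?thesis using C[of s'] by (simp add: tA_def)
      qed
    qed
    ultimately show ?thesis using r(1) by blast
  qed
  define z where "z u \<longleftrightarrow> sV True u \<in> U" for u
  have z: "sV (z u) u \<in> U" if "u < N" for u
    using choice[OF that] by (cases "z u") (auto simp: z_def)
  \<comment> \<open>The forced sensors: \<open>3 * m\<close> private ones, \<open>3 * N\<close> for
    choices and links, and one \<open>V\<close> for each slot, together
    \<open>3 * m + 4 * N = 19 * m\<close>.\<close>
  define W where "W = {s. s < N \<and> s mod 4 \<noteq> 3} \<union> {N..<4 * N} \<union> (\<lambda>u. sV (z u) u) ` {..<N}"
  have WU: "W \<subseteq> U"
  proof -
    have "s \<in> U" if "s < N" "s mod 4 \<noteq> 3" for s
    proof -
      have "s div 4 < m" "s mod 4 < 3" using that N mod_less_divisor[of 4 s] by simp_all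
      then have "4 * (s div 4) + s mod 4 \<in> U" using clause by blast
      then show ?thesis by simp
    qed
    moreover have "s \<in> U" if "N \<le> s" "s < 4 * N" for s
    proof -
      have "s < 6 * N" using that by simp
      then show ?thesis
        by (cases rule: sensor_cases) (use that choice link in \<open>auto simp: sV_def split: if_splits\<close>)
    qed
    ultimately show ?thesis using z by (auto simp: W_def)
  qed
  have finU: "finite U" using fin by (simp add: U_def)
  have cW: "card W \<ge> 19 * m"
  proof -
    have "{s. s < N \<and> s mod 4 \<noteq> 3} = {..<N} - (\<lambda>j. 4 * j + 3) ` {..<m}"
    proof -
      have "s \<in> (\<lambda>j. 4 * j + 3) ` {..<m}" if "s < N" "s mod 4 = 3" for s
        using that N mult_div_mod_eq[of 4 s] by (intro image_eqI[of _ _ "s div 4"]) auto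
      then show ?thesis by auto
    qed
    then have "card {s. s < N \<and> s mod 4 \<noteq> 3} \<ge> N - card ((\<lambda>j. 4 * j + 3) ` {..<m})"
      using diff_card_le_card_Diff[of "(\<lambda>j. 4 * j + 3) ` {..<m}" "{..<N}"] by simp
    moreover have "card ((\<lambda>j. 4 * j + 3) ` {..<m}) \<le> m"
      using card_image_le[of "{..<m}"] by simp
    ultimately have c1: "card {s. s < N \<and> s mod 4 \<noteq> 3} \<ge> 3 * m" using N by linarith
    have "inj_on (\<lambda>u. sV (z u) u) {..<N}"
      by (rule inj_onI) (simp add: id_eqs)
    then have c2: "card ((\<lambda>u. sV (z u) u) ` {..<N}) = N" by (simp add: card_image)
    let ?A = "{s. s < N \<and> s mod 4 \<noteq> 3}" and ?C = "(\<lambda>u. sV (z u) u) ` {..<N}"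
    have "card (?A \<union> {N..<4 * N}) = card ?A + 3 * N"
      by (subst card_Un_disjoint) auto
    moreover have "(?A \<union> {N..<4 * N}) \<inter> ?C = {}"
      by (auto simp: sV_def split: if_splits)
    ultimately have "card W = card ?A + 3 * N + N"
      unfolding W_def by (subst card_Un_disjoint) (simp_all add: c2)
    then show ?thesis using c1 N by simp
  qed
  \<comment> \<open>The other sensor \<open>V\<close> of a slot would raise the number of used
    sensors above \<open>19 * m\<close>.\<close>
  have unique: "b = z u" if "u < N" "sV b u \<in> U" for b u
  proof (rule ccontr)
    assume "b \<noteq> z u"
    then have "sV b u \<notin> W"
      using that(1) id_eqs(1)[OF that(1)] by (auto simp: W_def sV_def)
    then have "card (insert (sV b u) W) = card W + 1"
      using finite_subset[OF WU finU] by simp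
    moreover have "card (insert (sV b u) W) \<le> card U"
      using WU that(2) finU by (intro card_mono) auto
    ultimately show False using cU cW by simp
  qed
  have zeq: "z r = z u" if u: "u < N" and r: "pred_slot F r u" for r u
  proof -
    have "r < N" using u r by (simp add: pred_slot_def)
    have "z r = k \<or> z u = (\<not> k)" for k
      using link[OF u, of k] r unique[OF u, of "\<not> k"] unique[OF \<open>r < N\<close>, of k] by blast
    from this[of True] this[of False] show ?thesis by auto
  qed
  define \<alpha> where "\<alpha> v = z (SOME u. u < N \<and> snd (F ! u) = v)" for v
  have \<alpha>: "\<alpha> (snd (F ! u)) = z u" if u: "u < N" for u
  proof -
    let ?r = "SOME r. r < N \<and> snd (F ! r) = snd (F ! u)"
    have r: "?r < N \<and> snd (F ! ?r) = snd (F ! u)" by (rule someI[of _ u]) (simp add: u)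
    then show ?thesis
      using same_copies[of z u ?r, OF zeq] same_copies[of z ?r u, OF zeq] u
      by (cases "?r \<le> u") (auto simp: \<alpha>_def)
  qed
  have "clauses_hold F \<alpha>"
    unfolding clauses_hold_def
  proof (intro allI impI)
    fix j assume "j < length F div 4"
    then have j: "j < m" using len N by simp
    then obtain r where r: "r < 4" "sV (fst (F ! (4 * j + r))) (4 * j + r) \<in> U" using clause by blast
    have "4 * j + r < N" using j r(1) N by simp
    then show "\<exists>r<4. \<alpha> (snd (F ! (4 * j + r))) = fst (F ! (4 * j + r))"
      using r \<alpha> unique by blast
  qed
  then show ?thesis by blast
qed

text \<open>Leaving out \<open>c\<close> and closing the gap is injective; this distributes three of
  the four targets of a clause over its three private sensors.\<close>

lemma skip_inject:
  fixes a b c :: nat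
  assumes "a \<noteq> c" "b \<noteq> c" "(if a < c then a else a - 1) = (if b < c then b else b - 1)"
  shows "a = b"
  using assms by (cases "a < c"; cases "b < c") auto

text \<open>An intended matching \<open>M\<close> is read off the assignment and handed to
  \<open>greedy_realizes_matching\<close>. It uses exactly the forced sensors, where the sensor
  \<open>V\<close> of a slot is the one of its true value.\<close>

lemma ordering_of_satisfying:
  assumes sat: "clauses_hold F \<alpha>"
  shows "\<exists>\<sigma>. target_ordering G \<sigma> \<and> 9 * m \<le> card (targets G - (\<Union>s \<in> sensors G. greedy_plan G \<sigma> s))"
proof -
  define z where "z u = \<alpha> (snd (F ! u))" for u
  define g where "g j = (SOME r. r < 4 \<and> z (4 * j + r) = fst (F ! (4 * j + r)))" for j
  have g: "g j < 4" "z (4 * j + g j) = fst (F ! (4 * j + g j))" if "j < m" for j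
  proof -
    have "\<exists>r. r < 4 \<and> z (4 * j + r) = fst (F ! (4 * j + r))"
      using sat that len N unfolding clauses_hold_def z_def by auto
    then have "g j < 4 \<and> z (4 * j + g j) = fst (F ! (4 * j + g j))"
      unfolding g_def by (rule someI_ex)
    then show "g j < 4" "z (4 * j + g j) = fst (F ! (4 * j + g j))" by auto
  qed
  have zr: "z r = z u" if "pred_slot F r u" for r u
    using that by (simp add: z_def pred_slot_def)
  define x where "x u = (if u mod 4 < g (u div 4) then u mod 4 else u mod 4 - 1)" for u
  have j: "u div 4 < m" if "u < N" for u using that N by auto
  have x3: "x u < 3" if "u < N" "u mod 4 \<noteq> g (u div 4)" for u
  proof -
    have "u mod 4 < 4" by simp
    then show ?thesis using g(1)[OF j[OF that(1)]] that(2) unfolding x_def by (auto split: if_splits)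
  qed
  \<comment> \<open>In a clause, the target at the true literal chosen by \<open>g\<close> is left
    out and the others take the private sensors. The choice target of the true value takes its
    sensor \<open>V\<close>, the other one takes \<open>sA\<close>. Of two link targets, the one
    whose sensor \<open>V\<close> belongs to a true value is left out and the other takes
    \<open>sE\<close>.\<close>
  define M where "M t = (if t < N then if t mod 4 = g (t div 4) then None else Some (4 * (t div 4) + x t)
    else let u = t mod N; ty = t div N in
      if ty < 3 then Some (if z u = (ty = 2) then sV (z u) u else sA u)
      else let k = (5 \<le> ty); i = even ty in
        if z u = (k \<noteq> i) then None else Some (sE k u))" for t
  have M_A: "M (tA u) = (if u mod 4 = g (u div 4) then None else Some (4 * (u div 4) + x u))" if "u < N" for u
    using that by (simp add: M_def tA_def)
  have M_B: "M (tB b u) = Some (if z u = b then sV b u else sA u)" if "u < N" for b u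
    using that by (auto simp: M_def tB_def block block_N Let_def)
  have M_L: "M (tL k i u) = (if z u = (k \<noteq> i) then None else Some (sE k u))" if "u < N" for k i u
    using that by (auto simp: M_def tL_def block Let_def)
  have xN: "4 * (u div 4) + x u < N" if "u < N" "u mod 4 \<noteq> g (u div 4)" for u
    using x3[OF that] j[OF that(1)] N by linarith
  have xdiv: "(4 * (u div 4) + x u) div 4 = u div 4" "(4 * (u div 4) + x u) mod 4 = x u"
    if "u < N" "u mod 4 \<noteq> g (u div 4)" for u
    using x3[OF that] by auto
  \<comment> \<open>\<open>R1\<close> to \<open>R4\<close> supply an occupant for every sensor that
    could catch a target too early; they discharge the blocking condition below.\<close>
  have R1: "\<exists>t \<in> targets G. M t = Some v" if v: "v < N" "v mod 4 \<noteq> 3" for v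
  proof -
    define r where "r = (if v mod 4 < g (v div 4) then v mod 4 else v mod 4 + 1)"
    define u where "u = 4 * (v div 4) + r"
    have "v mod 4 < 4" by simp
    then have r: "r < 4" "r \<noteq> g (v div 4)" using v(2) by (auto simp: r_def)
    have d: "u div 4 = v div 4" "u mod 4 = r" using r(1) by (auto simp: u_def)
    have uN: "u < N" using j[OF v(1)] r(1) N by (simp add: u_def)
    have "x u = v mod 4" unfolding x_def d by (auto simp: r_def)
    then have "M (tA u) = Some v" unfolding M_A[OF uN] d using r(2) by simp
    then show ?thesis using id_less(1)[OF uN] by (auto simp: targets_G)
  qed
  have R2: "\<exists>t \<in> targets G. M t = Some (sA u)" if "u < N" for u
    using M_B[OF that, of "\<not> z u"] id_less(2)[OF that, of "\<not> z u"]
    by (intro bexI[of _ "tB (\<not> z u) u"]) (auto simp: targets_G)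
  have R3: "\<exists>t \<in> targets G. M t = Some (sE k u)" if "u < N" for k u
    using M_L[OF that, of k "z u = k"] id_less(3)[OF that, of k "z u = k"]
    by (intro bexI[of _ "tL k (z u = k) u"]) (auto simp: targets_G)
  have R4: "\<exists>t \<in> targets G. M t = Some (sV (z u) u)" if "u < N" for u
    using M_B[OF that, of "z u"] id_less(2)[OF that, of "z u"]
    by (intro bexI[of _ "tB (z u) u"]) (auto simp: targets_G)
  have "\<exists>\<sigma>. target_ordering G \<sigma> \<and> (\<forall>s t. t \<in> greedy_plan G \<sigma> s \<longrightarrow> M t = Some s)"
  proof (rule greedy_realizes_matching[OF recharge_G])
    fix t s assume t: "t \<in> targets G" "M t = Some s"
    then have "t < 7 * N" by (simp add: targets_G)
    then have "s < 6 * N \<and> adj F t s"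
    proof (cases rule: target_cases)
      case (1 u)
      then have "u mod 4 \<noteq> g (u div 4)" "s = 4 * (u div 4) + x u" using t by (auto simp: M_A split: if_splits)
      then show ?thesis using xN xdiv x3 1 by (force simp: adj_A)
    next
      case (2 u b)
      then show ?thesis using t id_less by (auto simp: M_B adj_B)
    next
      case (3 u k i)
      then show ?thesis using t id_less by (auto simp: M_L adj_L split: if_splits)
    qed
    then show "s \<in> sensors G \<and> can_sense G s t" using \<open>t < 7 * N\<close> by (simp add: sensors_G can_sense_G)
  next
    fix t t' s assume t: "t \<in> targets G" "t' \<in> targets G" "M t = Some s" "M t' = Some s"
    have low: "\<exists>u<N. t = tA u \<and> u mod 4 \<noteq> g (u div 4) \<and> s = 4 * (u div 4) + x u"
      if "t < 7 * N" "M t = Some s" "s < N" for t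
      using that(1)
    proof (cases rule: target_cases)
      case (1 u) then show ?thesis using that by (auto simp: M_A split: if_splits)
    next
      case (2 u b) then show ?thesis using that by (auto simp: M_B id_eqs split: if_splits)
    next
      case (3 u k i) then show ?thesis using that by (auto simp: M_L id_eqs split: if_splits)
    qed
    show "t = t'"
    proof (cases "s < N")
      case True
      obtain u where u: "u < N" "t = tA u" "u mod 4 \<noteq> g (u div 4)" "s = 4 * (u div 4) + x u"
        using low[of t] t True by (auto simp: targets_G)
      obtain u' where u': "u' < N" "t' = tA u'" "u' mod 4 \<noteq> g (u' div 4)" "s = 4 * (u' div 4) + x u'"
        using low[of t'] t True by (auto simp: targets_G)
      have d: "u div 4 = u' div 4" using xdiv(1)[OF u(1,3)] xdiv(1)[OF u'(1,3)] u(4) u'(4) by simp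
      have "x u = s mod 4" unfolding u(4) by (simp only: xdiv(2)[OF u(1,3)])
      also have "\<dots> = x u'" unfolding u'(4) by (simp only: xdiv(2)[OF u'(1,3)])
      finally have "x u = x u'" .
      then have "u mod 4 = u' mod 4"
        unfolding x_def d by (rule skip_inject[OF u(3)[unfolded d] u'(3)])
      then have "u = u'" using d by (metis div_mult_mod_eq)
      then show ?thesis using u u' by simp
    next
      case False
      have high: "(\<exists>u<N. (s = sV (z u) u \<and> t = tB (z u) u) \<or> (s = sA u \<and> t = tB (\<not> z u) u) \<or>
          (\<exists>k. s = sE k u \<and> t = tL k (z u = k) u))"
        if "t < 7 * N" "M t = Some s" for t
        using that(1)
      proof (cases rule: target_cases)
        case (1 u) then show ?thesis using that False xN by (auto simp: M_A split: if_splits)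
      next
        case (2 u b) then show ?thesis using that by (cases b; cases "z u") (auto simp: M_B)
      next
        case (3 u k i)
        then have "s = sE k u" "i = (z u = k)" using that by (auto simp: M_L split: if_splits)
        then show ?thesis using 3 by blast
      qed
      show ?thesis
        using high[of t] high[of t'] t by (auto simp: targets_G id_eqs)
    qed
  next
    fix t s assume t: "t \<in> targets G" "s \<in> sensors G" "can_sense G s t" and before: "\<And>s'. M t = Some s' \<Longrightarrow> s < s'"
    have t7: "t < 7 * N" and adj: "adj F t s" using t by (auto simp: targets_G sensors_G can_sense_G)
    from t7 show "\<exists>t' \<in> targets G. M t' = Some s"
    proof (cases rule: target_cases)
      case (1 u)
      from adj have "s < N \<and> s mod 4 \<noteq> 3 \<or> s = sV (fst (F ! u)) u" using 1 by (auto simp: adj_A)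
      then show ?thesis
      proof
        assume s: "s = sV (fst (F ! u)) u"
        \<comment> \<open>Only the target chosen by \<open>g\<close> gets as far as the sensor of
          its literal. As this literal is true, that sensor is taken by a choice target.\<close>
        have "u mod 4 = g (u div 4)"
        proof (rule ccontr)
          assume a: "u mod 4 \<noteq> g (u div 4)"
          then have "s < 4 * (u div 4) + x u" using before 1 by (simp add: M_A)
          then show False using xN[OF 1(1) a] 1(1) by (auto simp: s sV_def split: if_splits)
        qed
        then have "4 * (u div 4) + g (u div 4) = u" by (metis mult_div_mod_eq)
        then have "z u = fst (F ! u)" using g(2)[OF j[OF 1(1)]] by simp
        then show ?thesis using R4[OF 1(1)] s by simp
      qed (use R1 in blast)
    next
      case (2 u b)
      then consider "s = sA u" | "s = sV b u" using adj by (auto simp: adj_B)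
      then show ?thesis
      proof cases
        case 1
        then show ?thesis using R2 2 by simp
      next
        case s: 2
        have "s < (if z u = b then sV b u else sA u)" using before 2 by (simp add: M_B)
        then show ?thesis using id_eqs(20)[OF 2(1) 2(1), of b] s by (auto split: if_splits)
      qed
    next
      case (3 u k i)
      from adj consider "s = sE k u" | r where "r < u" "pred_slot F r u" "s = (if i then sV (\<not> k) u else sV k r)"
        using 3 by (auto simp: adj_L)
      then show ?thesis
      proof cases
        case 1
        then show ?thesis using R3 3 by simp
      next
        case (2 r)
        have rN: "r < N" using 2 3 by simp
        have zru: "z r = z u" using zr 2 by blast
        show ?thesis
        proof (cases "z u = (k \<noteq> i)")
          case True
          then have "s = (if i then sV (z u) u else sV (z r) r)" using 2 zru by (cases i) auto
          then show ?thesis using R4[OF rN] R4[OF 3(1)] by auto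
        next
          case False
          then have "s < sE k u" using before 3 by (simp add: M_L)
          then show ?thesis using 2 id_eqs(19)[OF 3(1) rN, of k k] id_eqs(19)[OF 3(1) 3(1), of k "\<not> k"]
            by (auto split: if_splits)
        qed
      qed
    qed
  qed
  then obtain \<sigma> where \<sigma>: "target_ordering G \<sigma>" "\<And>s t. t \<in> greedy_plan G \<sigma> s \<Longrightarrow> M t = Some s" by blast
  \<comment> \<open>One target for each clause and two for each slot stay unsensed:
    \<open>m + 2 * N = 9 * m\<close>.\<close>
  let ?A = "(\<lambda>j. 4 * j + g j) ` {..<m}" and ?L = "(\<lambda>(u, k). tL k (z u \<noteq> k) u) ` ({..<N} \<times> UNIV)"
  have AN: "4 * j + g j < N" if "j < m" for j using g(1)[OF that] that N by linarith
  have M_A0: "M (4 * j + g j) = None" if "j < m" for j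
    using M_A[OF AN[OF that]] g(1)[OF that] by (simp add: tA_def)
  have "?A \<union> ?L \<subseteq> targets G - (\<Union>s \<in> sensors G. greedy_plan G \<sigma> s)"
  proof
    fix t assume "t \<in> ?A \<union> ?L"
    then have "t < 7 * N \<and> M t = None"
    proof
      assume "t \<in> ?A"
      then obtain j where "j < m" "t = 4 * j + g j" by blast
      then show ?thesis using AN[of j] M_A0[of j] by simp
    next
      assume "t \<in> ?L"
      then obtain u k where "u < N" "t = tL k (z u \<noteq> k) u" by auto
      then show ?thesis using id_less(3)[of u] M_L[of u k "z u \<noteq> k"] by (cases k; cases "z u") auto
    qed
    then show "t \<in> targets G - (\<Union>s \<in> sensors G. greedy_plan G \<sigma> s)"
      using \<sigma>(2)[of t] by (auto simp: targets_G)
  qed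
  then have "card (?A \<union> ?L) \<le> card (targets G - (\<Union>s \<in> sensors G. greedy_plan G \<sigma> s))"
    by (intro card_mono) (simp_all add: targets_G)
  moreover have "card (?A \<union> ?L) = 9 * m"
  proof -
    have "inj_on (\<lambda>j. 4 * j + g j) {..<m}"
    proof (rule inj_onI)
      fix i j assume "i \<in> {..<m}" "j \<in> {..<m}" "4 * i + g i = 4 * j + g j"
      then show "i = j" using g(1)[of i] g(1)[of j] by auto
    qed
    then have "card ?A = m" by (simp add: card_image)
    moreover have "inj_on (\<lambda>(u, k). tL k (z u \<noteq> k) u) ({..<N} \<times> UNIV)"
      by (rule inj_onI) (auto simp: tL_def split: if_splits)
    then have "card ?L = 8 * m" using N by (simp add: card_image card_cartesian_product)
    moreover have "?A \<inter> ?L = {}" using AN by (fastforce simp: tL_def split: if_splits)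
    ultimately show ?thesis by (subst card_Un_disjoint) auto
  qed
  ultimately show ?thesis using \<sigma>(1) by auto
qed

end

theorem gadget_correct:
  assumes "length F = 4 * m"
  shows "wf_esg (gadget F)" "restricted_esg (gadget F)"
    "best_blue_response (gadget F) (of_nat (9 * m)) \<longleftrightarrow> (\<exists>\<alpha>. clauses_hold F \<alpha>)"
proof -
  interpret formula F m "4 * m" using assms by unfold_locales auto
  show "wf_esg (gadget F)" "restricted_esg (gadget F)" by (rule wf_G restricted_G)+
  show "best_blue_response (gadget F) (of_nat (9 * m)) \<longleftrightarrow> (\<exists>\<alpha>. clauses_hold F \<alpha>)"
    unfolding best_blue_response_def unsensed_value_G of_nat_le_iff
    using satisfying_of_ordering ordering_of_satisfying by blast
qed

section \<open>Computations as formulas\<close>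

lemma clauses_hold_concat:
  assumes "\<forall>c \<in> set cs. length c = 4"
  shows "clauses_hold (concat cs) \<alpha> \<longleftrightarrow> (\<forall>c \<in> set cs. \<exists>l \<in> set c. \<alpha> (snd l) = fst l)"
    "length (concat cs) = 4 * length cs"
proof -
  have len: "length (concat cs) = 4 * length cs" using assms by (induction cs) auto
  then show "length (concat cs) = 4 * length cs" .
  have nth: "concat cs ! (4 * j + r) = cs ! j ! r" if "j < length cs" "r < 4" for j r
    using assms that
  proof (induction cs arbitrary: j)
    case (Cons c cs)
    show ?case
    proof (cases j)
      case 0
      then show ?thesis using Cons.prems by (simp add: nth_append)
    next
      case (Suc j')
      then have "concat (c # cs) ! (4 * j + r) = concat cs ! (4 * j' + r)"
        using Cons.prems by (simp add: nth_append)
      then show ?thesis using Suc Cons by simp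
    qed
  qed simp
  have "(\<exists>r<4. \<alpha> (snd (cs ! j ! r)) = fst (cs ! j ! r)) \<longleftrightarrow> (\<exists>l \<in> set (cs ! j). \<alpha> (snd l) = fst l)"
    if "j < length cs" for j
  proof -
    have "length (cs ! j) = 4" using assms that by simp
    then show ?thesis unfolding Bex_def in_set_conv_nth by metis
  qed
  then show "clauses_hold (concat cs) \<alpha> \<longleftrightarrow> (\<forall>c \<in> set cs. \<exists>l \<in> set c. \<alpha> (snd l) = fst l)"
    unfolding clauses_hold_def len by (simp add: nth all_set_conv_all_nth cong: conj_cong)
qed

section \<open>The clauses of a computation\<close>

type_synonym clause = "(bool \<times> nat list) list"

text \<open>Since every clause is a block of exactly four literals, shorter clauses repeat a
  literal.\<close>

definition unit :: "nat list \<Rightarrow> clause" where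
  "unit v = replicate 4 (True, v)"
definition no :: "nat list \<Rightarrow> clause" where
  "no v = replicate 4 (False, v)"
definition or3 :: "nat list \<Rightarrow> nat list \<Rightarrow> nat list \<Rightarrow> clause" where
  "or3 a b c = [(True, a), (True, a), (True, b), (True, c)]"
definition imp3 :: "nat list \<Rightarrow> nat list \<Rightarrow> nat list \<Rightarrow> nat list \<Rightarrow> clause" where
  "imp3 a b c d = [(False, a), (False, b), (False, c), (True, d)]"

lemmas clause_defs = unit_def no_def or3_def imp3_def

definition sat :: "(nat list \<Rightarrow> bool) \<Rightarrow> clause \<Rightarrow> bool" where
  "sat \<alpha> c \<longleftrightarrow> (\<exists>l \<in> set c. \<alpha> (snd l) = fst l)"

lemma sat_simps [simp]:
  "sat \<alpha> (unit v) \<longleftrightarrow> \<alpha> v" "sat \<alpha> (no v) \<longleftrightarrow> \<not> \<alpha> v" "sat \<alpha> (or3 a b c) \<longleftrightarrow> \<alpha> a \<or> \<alpha> b \<or> \<alpha> c"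
  "sat \<alpha> (imp3 a b c d) \<longleftrightarrow> (\<alpha> a \<and> \<alpha> b \<and> \<alpha> c \<longrightarrow> \<alpha> d)"
  by (auto simp: sat_def clause_defs)

text \<open>
  \<open>PreV t j q as\<close>: at time \<open>t\<close> the state is \<open>q\<close> and the first \<open>j\<close> heads read \<open>as\<close>;
  \<open>CellV t j i a\<close>: cell \<open>i\<close> of tape \<open>j\<close> contains \<open>a\<close>; \<open>HeadV t j i\<close> and \<open>NoV t j i\<close>: the head
  of tape \<open>j\<close> is, or is not, at cell \<open>i\<close>. Cells are numbered from the left end of a window in which
  the start cell has number \<open>T\<close>. All clauses about steps are implications between variables
  that are true in the run, so a satisfying assignment contains the run and nothing has to
  exclude further true variables.
\<close>

definition PreV :: "nat \<Rightarrow> nat \<Rightarrow> nat \<Rightarrow> nat list \<Rightarrow> nat list" where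
  "PreV t j q as = 0 # t # j # q # as"
definition CellV :: "nat \<Rightarrow> nat \<Rightarrow> nat \<Rightarrow> nat \<Rightarrow> nat list" where
  "CellV t j i a = [1, t, j, i, a]"
definition HeadV :: "nat \<Rightarrow> nat \<Rightarrow> nat \<Rightarrow> nat list" where
  "HeadV t j i = [2, t, j, i]"
definition NoV :: "nat \<Rightarrow> nat \<Rightarrow> nat \<Rightarrow> nat list" where
  "NoV t j i = [3, t, j, i]"

lemmas var_defs = PreV_def CellV_def HeadV_def NoV_def

text \<open>The halting state is made a fixed point, so the configuration at one fixed time
  \<open>T\<close> decides about acceptance.\<close>

definition total_trans :: "tm \<Rightarrow> nat \<Rightarrow> nat list \<Rightarrow> nat \<times> (nat \<times> move) list" where
  "total_trans M q rs = (if q < num_states M then trans M q rs else (q, stay rs))"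

definition moved :: "move \<Rightarrow> nat \<Rightarrow> nat \<Rightarrow> bool" where
  "moved d i i' \<longleftrightarrow> (case d of MoveLeft \<Rightarrow> i = Suc i' | Stay \<Rightarrow> i' = i | MoveRight \<Rightarrow> i' = Suc i)"

lemma moved_iff: "moved d i i' \<longleftrightarrow> int i' = int i + shift d"
  by (cases d) (auto simp: moved_def)

text \<open>The cells of tape \<open>0\<close> are absent here; \<open>input_clauses\<close> deals
  with them.\<close>

definition init_clauses :: "tm \<Rightarrow> nat \<Rightarrow> clause list" where
  "init_clauses M T = unit (PreV 0 0 0 []) #
    concat (map (\<lambda>j. map (\<lambda>i. unit (if i = T then HeadV 0 j i else NoV 0 j i)) [0..<2 * T + 1]) [0..<num_tapes M]) @
    concat (map (\<lambda>j. map (\<lambda>i. unit (CellV 0 j i 0)) [0..<2 * T + 1]) [1..<num_tapes M])"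

text \<open>The \<open>k\<close> cells behind \<open>w\<close> are left open for the certificate. A
  blank there must be followed by a blank, so they spell a word of length at most
  \<open>k\<close>.\<close>

definition input_clauses :: "nat \<Rightarrow> nat \<Rightarrow> bool list \<Rightarrow> clause list" where
  "input_clauses T k w = concat (map (\<lambda>i.
    if i < T \<or> T + length w + k \<le> i then [unit (CellV 0 0 i 0)]
    else if i < T + length w then [unit (CellV 0 0 i (if sel False w (i - T) then 2 else 1))]
    else [or3 (CellV 0 0 i 0) (CellV 0 0 i 1) (CellV 0 0 i 2),
      imp3 (CellV 0 0 i 0) (CellV 0 0 i 0) (CellV 0 0 i 0) (CellV 0 0 (i + 1) 0)]) [0..<2 * T + 1])"

text \<open>A transition depends on all heads at once, too many premises for one clause. So
  \<open>PreV\<close> collects the symbols that are read one head at a time.\<close>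

definition read_clauses :: "tm \<Rightarrow> nat \<Rightarrow> nat \<Rightarrow> clause list" where
  "read_clauses M T t = concat (map (\<lambda>j. concat (map (\<lambda>q. concat (map (\<lambda>as. concat (map (\<lambda>a.
    map (\<lambda>i. imp3 (PreV t j q as) (HeadV t j i) (CellV t j i a) (PreV t (Suc j) q (as @ [a]))) [0..<2 * T + 1])
    [0..<num_syms M])) (List.n_lists j [0..<num_syms M]))) [0..<num_states M + 1])) [0..<num_tapes M])"

definition write_clauses :: "tm \<Rightarrow> nat \<Rightarrow> nat \<Rightarrow> clause list" where
  "write_clauses M T t = concat (map (\<lambda>q. concat (map (\<lambda>as. concat (map (\<lambda>j.
    concat (map (\<lambda>i.
      let P = PreV t (num_tapes M) q as; H = HeadV t j i; d = snd (snd (total_trans M q as) ! j) in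
        imp3 P P P (PreV (Suc t) 0 (fst (total_trans M q as)) []) #
        imp3 P P H (CellV (Suc t) j i (fst (snd (total_trans M q as) ! j))) #
        map (\<lambda>i'. imp3 P P H (if moved d i i' then HeadV (Suc t) j i' else NoV (Suc t) j i')) [0..<2 * T + 1])
      [0..<2 * T + 1])) [0..<num_tapes M]))
    (List.n_lists (num_tapes M) [0..<num_syms M]))) [0..<num_states M + 1])"

text \<open>\<open>NoV\<close> is a variable of its own: with the negation of \<open>HeadV\<close>
  as premise, a surplus true \<open>HeadV\<close> would release a cell from keeping its
  symbol.\<close>

definition keep_clauses :: "tm \<Rightarrow> nat \<Rightarrow> nat \<Rightarrow> clause list" where
  "keep_clauses M T t = concat (map (\<lambda>j. concat (map (\<lambda>a.
    map (\<lambda>i. imp3 (NoV t j i) (NoV t j i) (CellV t j i a) (CellV (Suc t) j i a)) [0..<2 * T + 1])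
    [0..<num_syms M])) [0..<num_tapes M])"

text \<open>The output is \<open>[True]\<close> iff its first cell holds \<open>2\<close> and the
  next one a blank. The actual symbols of the run are always true, so it suffices to forbid all
  wrong ones.\<close>

definition accept_clauses :: "tm \<Rightarrow> nat \<Rightarrow> clause list" where
  "accept_clauses M T =
    concat (map (\<lambda>a. (if a \<noteq> 2 then [no (CellV T (num_tapes M - 1) T a)] else []) @
      (if a \<noteq> 0 then [no (CellV T (num_tapes M - 1) (T + 1) a)] else [])) [0..<num_syms M])"

definition cnf :: "tm \<Rightarrow> nat \<Rightarrow> nat \<Rightarrow> bool list \<Rightarrow> clause list" where
  "cnf M T k w = init_clauses M T @ input_clauses T k w @
    concat (map (\<lambda>t. read_clauses M T t @ write_clauses M T t @ keep_clauses M T t) [0..<T]) @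
    accept_clauses M T"

lemma list_all_rules:
  "list_all P [] \<longleftrightarrow> True" "list_all P (c # cs) \<longleftrightarrow> P c \<and> list_all P cs"
  "list_all P (cs @ ds) \<longleftrightarrow> list_all P cs \<and> list_all P ds"
  "list_all P (concat (map f xs)) \<longleftrightarrow> (\<forall>x \<in> set xs. list_all P (f x))"
  "list_all P (map g xs) \<longleftrightarrow> (\<forall>x \<in> set xs. P (g x))"
  "list_all P (if b then cs else ds) \<longleftrightarrow> (if b then list_all P cs else list_all P ds)"
  "(if b then Q else True) \<longleftrightarrow> (b \<longrightarrow> Q)"
  by (auto simp: list_all_iff)

lemma length_clauses [simp]: "length (unit v) = 4" "length (no v) = 4" "length (or3 a b c) = 4"
  "length (imp3 a b c d) = 4"
  by (simp_all add: clause_defs)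

lemma cnf_length4: "\<forall>c \<in> set (cnf M T k w). length c = 4"
proof -
  have "list_all (\<lambda>c. length c = 4) (cnf M T k w)"
    unfolding cnf_def init_clauses_def input_clauses_def read_clauses_def
      write_clauses_def keep_clauses_def accept_clauses_def Let_def
    by (simp only: list_all_rules length_clauses simp_thms if_cancel ball_triv simp_thms)
  then show ?thesis by (simp add: list_all_iff)
qed

lemma in_n_lists: "as \<in> set (List.n_lists j [0..<m]) \<longleftrightarrow> length as = j \<and> set as \<subseteq> {..<m}"
  by (auto simp: set_n_lists)

abbreviation sats :: "(nat list \<Rightarrow> bool) \<Rightarrow> clause list \<Rightarrow> bool" where
  "sats \<alpha> \<equiv> list_all (sat \<alpha>)"

lemma ball_upt: "(\<forall>x \<in> set [0..<n]. P x) \<longleftrightarrow> (\<forall>x<n. P x)" "x < n + 1 \<longleftrightarrow> x \<le> n" for n :: nat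
  by auto

lemmas sats_rules = list_all_rules sat_simps ball_upt simp_thms conj_absorb conj_left_absorb

lemma sat_init:
  "sats \<alpha> (init_clauses M T) \<longleftrightarrow> \<alpha> (PreV 0 0 0 []) \<and>
    (\<forall>j < num_tapes M. \<forall>i \<le> 2 * T. \<alpha> (if i = T then HeadV 0 j i else NoV 0 j i)) \<and>
    (\<forall>j \<in> set [1..<num_tapes M]. \<forall>i \<le> 2 * T. \<alpha> (CellV 0 j i 0))"
  unfolding init_clauses_def by (simp only: sats_rules)

lemma sat_read:
  "sats \<alpha> (read_clauses M T t) \<longleftrightarrow>
    (\<forall>j < num_tapes M. \<forall>q \<le> num_states M. \<forall>as \<in> set (List.n_lists j [0..<num_syms M]).
      \<forall>a < num_syms M. \<forall>i \<le> 2 * T. \<alpha> (PreV t j q as) \<and> \<alpha> (HeadV t j i) \<and> \<alpha> (CellV t j i a) \<longrightarrow>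
        \<alpha> (PreV t (Suc j) q (as @ [a])))"
  unfolding read_clauses_def by (simp only: sats_rules)

lemma sat_write:
  "sats \<alpha> (write_clauses M T t) \<longleftrightarrow>
    (\<forall>q \<le> num_states M. \<forall>as \<in> set (List.n_lists (num_tapes M) [0..<num_syms M]).
      \<forall>j < num_tapes M. \<forall>i \<le> 2 * T.
        (\<alpha> (PreV t (num_tapes M) q as) \<longrightarrow> \<alpha> (PreV (Suc t) 0 (fst (total_trans M q as)) [])) \<and>
        (\<alpha> (PreV t (num_tapes M) q as) \<and> \<alpha> (HeadV t j i) \<longrightarrow>
          \<alpha> (CellV (Suc t) j i (fst (snd (total_trans M q as) ! j)))) \<and>
        (\<forall>i' \<le> 2 * T. \<alpha> (PreV t (num_tapes M) q as) \<and> \<alpha> (HeadV t j i) \<longrightarrow>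
          \<alpha> (if moved (snd (snd (total_trans M q as) ! j)) i i' then HeadV (Suc t) j i' else NoV (Suc t) j i')))"
  unfolding write_clauses_def Let_def by (simp only: sats_rules)

lemma sat_keep:
  "sats \<alpha> (keep_clauses M T t) \<longleftrightarrow>
    (\<forall>j < num_tapes M. \<forall>a < num_syms M. \<forall>i \<le> 2 * T. \<alpha> (NoV t j i) \<and> \<alpha> (CellV t j i a) \<longrightarrow> \<alpha> (CellV (Suc t) j i a))"
  unfolding keep_clauses_def by (simp only: sats_rules)

lemma sat_accept:
  "sats \<alpha> (accept_clauses M T) \<longleftrightarrow>
    (\<forall>a < num_syms M. (a \<noteq> 2 \<longrightarrow> \<not> \<alpha> (CellV T (num_tapes M - 1) T a)) \<and>
      (a \<noteq> 0 \<longrightarrow> \<not> \<alpha> (CellV T (num_tapes M - 1) (T + 1) a)))"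
  unfolding accept_clauses_def by (simp only: sats_rules)

lemma sat_input:
  "sats \<alpha> (input_clauses T k w) \<longleftrightarrow> (\<forall>i \<le> 2 * T.
    if i < T \<or> T + length w + k \<le> i then \<alpha> (CellV 0 0 i 0)
    else if i < T + length w then \<alpha> (CellV 0 0 i (if sel False w (i - T) then 2 else 1))
    else (\<alpha> (CellV 0 0 i 0) \<or> \<alpha> (CellV 0 0 i 1) \<or> \<alpha> (CellV 0 0 i 2)) \<and>
      (\<alpha> (CellV 0 0 i 0) \<longrightarrow> \<alpha> (CellV 0 0 (i + 1) 0)))"
  unfolding input_clauses_def by (simp only: sats_rules)

lemma sat_cnf:
  "sats \<alpha> (cnf M T k w) \<longleftrightarrow>
    sats \<alpha> (init_clauses M T) \<and> sats \<alpha> (input_clauses T k w) \<and>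
    (\<forall>t < T. sats \<alpha> (read_clauses M T t) \<and> sats \<alpha> (write_clauses M T t) \<and> sats \<alpha> (keep_clauses M T t)) \<and>
    sats \<alpha> (accept_clauses M T)"
  unfolding cnf_def by (simp only: sats_rules)

subsection \<open>Runs of Turing machines\<close>

definition run :: "tm \<Rightarrow> bool list \<Rightarrow> nat \<Rightarrow> config" where
  "run M w t = (step M ^^ t) (init_config M w)"

lemma run_0: "run M w 0 = init_config M w"
  by (simp add: run_def)

lemma run_Suc: "run M w (Suc t) = step M (run M w t)"
  by (simp add: run_def)

text \<open>In \<open>t\<close> steps a head moves at most \<open>t\<close> cells; hence the window
  of \<open>2 * T + 1\<close> cells is large enough for \<open>T\<close> steps.\<close>

definition good_config :: "tm \<Rightarrow> nat \<Rightarrow> config \<Rightarrow> bool" where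
  "good_config M t c \<longleftrightarrow> fst c \<le> num_states M \<and> length (snd c) = num_tapes M \<and>
    (\<forall>j < num_tapes M. (\<forall>i. fst (snd c ! j) i < num_syms M) \<and> \<bar>snd (snd c ! j)\<bar> \<le> int t)"

lemma read_lt: "good_config M t (q, tps) \<Longrightarrow> set (map read tps) \<subseteq> {..<num_syms M}"
  by (force simp: good_config_def read_def in_set_conv_nth)

lemma total_trans_wf:
  assumes "wf_tm M" "good_config M t (q, tps)"
  shows "fst (total_trans M q (map read tps)) \<le> num_states M"
    "length (snd (total_trans M q (map read tps))) = num_tapes M"
    "\<And>j. j < num_tapes M \<Longrightarrow> fst (snd (total_trans M q (map read tps)) ! j) < num_syms M"
proof -
  have l: "length (map read tps) = num_tapes M" using assms(2) by (simp add: good_config_def)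
  note r = read_lt[OF assms(2)]
  have "fst (total_trans M q (map read tps)) \<le> num_states M \<and>
    length (snd (total_trans M q (map read tps))) = num_tapes M \<and>
    (\<forall>x \<in> set (snd (total_trans M q (map read tps))). fst x < num_syms M)"
  proof (cases "q < num_states M")
    case True
    obtain q' as where e: "trans M q (map read tps) = (q', as)" by fastforce
    have "\<forall>q < num_states M. \<forall>rs. length rs = num_tapes M \<and> set rs \<subseteq> {..<num_syms M} \<longrightarrow>
       (case trans M q rs of (q', as) \<Rightarrow>
          q' \<le> num_states M \<and> length as = num_tapes M \<and> (\<forall>(a, m) \<in> set as. a < num_syms M))"
      using assms(1) unfolding wf_tm_def by (elim conjE)
    from this[rule_format, OF True conjI[OF l r]]
    have "q' \<le> num_states M" "length as = num_tapes M" "\<forall>x \<in> set as. fst x < num_syms M"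
      unfolding e by auto
    then show ?thesis using True unfolding total_trans_def e by simp
  next
    case False
    then show ?thesis using assms(2) r unfolding total_trans_def good_config_def stay_def
      by (simp add: subset_iff)
  qed
  then show "fst (total_trans M q (map read tps)) \<le> num_states M"
    "length (snd (total_trans M q (map read tps))) = num_tapes M"
    "\<And>j. j < num_tapes M \<Longrightarrow> fst (snd (total_trans M q (map read tps)) ! j) < num_syms M"
    by (auto simp del: list.map)
qed

lemma step_total_trans:
  assumes "good_config M t (q, tps)"
  shows "step M (q, tps) = (fst (total_trans M q (map read tps)), map2 act (snd (total_trans M q (map read tps))) tps)"
  using assms map2_act_stay[of tps] by (auto simp: total_trans_def split_def)

lemma step_tape:
  assumes "wf_tm M" "good_config M t (q, tps)" "j < num_tapes M"
  shows "snd (step M (q, tps)) ! j =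
    ((fst (tps ! j))(snd (tps ! j) := fst (snd (total_trans M q (map read tps)) ! j)),
      snd (tps ! j) + shift (snd (snd (total_trans M q (map read tps)) ! j)))"
proof -
  have "snd (step M (q, tps)) ! j = act (snd (total_trans M q (map read tps)) ! j) (tps ! j)"
    unfolding step_total_trans[OF assms(2)]
    using total_trans_wf(2)[OF assms(1,2)] assms(2,3) by (simp add: good_config_def)
  then show ?thesis
    by (cases "snd (total_trans M q (map read tps)) ! j"; cases "tps ! j") simp
qed

lemma good_step:
  assumes "wf_tm M" "good_config M t (q, tps)"
  shows "good_config M (Suc t) (step M (q, tps))"
proof -
  note tt = total_trans_wf[OF assms]
  have 1: "\<bar>shift d\<bar> \<le> 1" for d by (cases d) auto
  have sh: "\<bar>h + shift d\<bar> \<le> int (Suc t)" if "\<bar>h\<bar> \<le> int t" for h d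
    using that abs_triangle_ineq[of h "shift d"] 1[of d] by simp
  have "(\<forall>i. fst (snd (step M (q, tps)) ! j) i < num_syms M) \<and> \<bar>snd (snd (step M (q, tps)) ! j)\<bar> \<le> int (Suc t)"
    if "j < num_tapes M" for j
    using assms(2) that tt(3)[OF that] sh unfolding step_tape[OF assms that] good_config_def by auto
  then show ?thesis
    using tt(1,2) assms(2) step_total_trans[OF assms(2)] by (simp add: good_config_def)
qed

lemma good_run:
  assumes "wf_tm M"
  shows "good_config M t (run M w t)"
proof (induction t)
  case 0
  have "num_syms M \<ge> 3" "num_tapes M \<ge> 1" using assms by (auto simp: wf_tm_def)
  moreover have "bit_sym b < 3" for b by (simp add: bit_sym_def)
  then have "bit_sym b < num_syms M" for b using calculation(1) less_le_trans by blast
  ultimately show ?case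
    by (auto simp: run_0 good_config_def init_config_def nth_Cons word_tape_def split: nat.splits)
next
  case (Suc t)
  then show ?case using good_step[OF assms] unfolding run_Suc by (cases "run M w t") auto
qed

lemma run_halted:
  assumes "fst (run M w t) = num_states M" "t \<le> t'"
  shows "run M w t' = run M w t"
  using assms(2)
proof (induction t' rule: dec_induct)
  case (step k)
  then show ?case using assms(1) unfolding run_Suc by (cases "run M w t") simp
qed simp

text \<open>Bits are never blank, so the first two cells determine whether the output is exactly
  \<open>[True]\<close>.\<close>

lemma tape_output_True:
  assumes "tape_output tp y"
  shows "y = [True] \<longleftrightarrow> fst tp 0 = 2 \<and> fst tp 1 = 0"
proof -
  consider "y = []" | b where "y = [b]" | b b' ys where "y = b # b' # ys"
    by (metis list.exhaust)
  then show ?thesis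
  proof cases
    case 3
    have "\<forall>i < length y. fst tp (int i) = bit_sym (y ! i)" using assms by (simp add: tape_output_def)
    from this[rule_format, of 1] show ?thesis using 3 by auto
  qed (use assms in \<open>auto simp: tape_output_def bit_sym_def\<close>)
qed

subsection \<open>Runs and satisfying assignments\<close>

text \<open>Only facts of the run are true here: each cell holds one symbol, hence the negative
  clauses of \<open>accept_clauses\<close> hold too when the run accepts.\<close>

definition run_val :: "tm \<Rightarrow> nat \<Rightarrow> bool list \<Rightarrow> nat list \<Rightarrow> bool" where
  "run_val M T w v \<longleftrightarrow>
    (\<exists>t j as. v = PreV t j (fst (run M w t)) as \<and> as = map read (take j (snd (run M w t)))) \<or>
    (\<exists>t j i. v = CellV t j i (fst (snd (run M w t) ! j) (int i - int T))) \<or>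
    (\<exists>t j i. v = HeadV t j i \<and> snd (snd (run M w t) ! j) = int i - int T) \<or>
    (\<exists>t j i. v = NoV t j i \<and> snd (snd (run M w t) ! j) \<noteq> int i - int T)"

lemma run_val_simps:
  "run_val M T w (PreV t j q as) \<longleftrightarrow> q = fst (run M w t) \<and> as = map read (take j (snd (run M w t)))"
  "run_val M T w (CellV t j i a) \<longleftrightarrow> a = fst (snd (run M w t) ! j) (int i - int T)"
  "run_val M T w (HeadV t j i) \<longleftrightarrow> snd (snd (run M w t) ! j) = int i - int T"
  "run_val M T w (NoV t j i) \<longleftrightarrow> snd (snd (run M w t) ! j) \<noteq> int i - int T"
  by (auto simp: run_val_def var_defs)

lemma init_tape:
  assumes "wf_tm M" "j < num_tapes M"
  shows "snd (run M w 0) ! j = word_tape (if j = 0 then w else [])"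
  using assms by (cases j) (auto simp: run_0 init_config_def)

lemma init_state: "fst (run M w 0) = 0"
  by (simp add: run_0 init_config_def)

lemma word_tape_nth: "fst (word_tape w) z = (if 0 \<le> z \<and> z < int (length w) then bit_sym (w ! nat z) else 0)"
  "snd (word_tape w) = 0"
  by (simp_all add: word_tape_def)

lemma word_tape_shift:
  "fst (word_tape w) (int i - int T) = (if T \<le> i \<and> i < T + length w then bit_sym (w ! (i - T)) else 0)"
proof -
  have "nat (int i - int T) = i - T" by simp
  then show ?thesis unfolding word_tape_nth(1) by auto
qed

definition accepts_at :: "tm \<Rightarrow> bool list \<Rightarrow> nat \<Rightarrow> bool" where
  "accepts_at M w T \<longleftrightarrow> fst (snd (run M w T) ! (num_tapes M - 1)) 0 = 2 \<and>
    fst (snd (run M w T) ! (num_tapes M - 1)) 1 = 0"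

lemma sats_of_run:
  assumes wf: "wf_tm M" and k: "length u \<le> k" and acc: "accepts_at M (X @ u) T"
  shows "sats (run_val M T (X @ u)) (cnf M T k X)"
proof -
  let ?w = "X @ u"
  have K: "num_tapes M > 0" using wf by (simp add: wf_tm_def)
  have step: "snd (run M ?w (Suc t)) ! j =
    (let tps = snd (run M ?w t); x = snd (total_trans M (fst (run M ?w t)) (map read tps)) ! j in
      ((fst (tps ! j))(snd (tps ! j) := fst x), snd (tps ! j) + shift (snd x)))"
    and state: "fst (run M ?w (Suc t)) = fst (total_trans M (fst (run M ?w t)) (map read (snd (run M ?w t))))"
    if "j < num_tapes M" for t j
    using step_tape[OF wf, of t "fst (run M ?w t)" "snd (run M ?w t)"]
      step_total_trans[of M t "fst (run M ?w t)" "snd (run M ?w t)"] good_run[OF wf, of t ?w] that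
    by (simp_all add: run_Suc Let_def)
  have lenK: "length (snd (run M ?w t)) = num_tapes M" for t
    using good_run[OF wf, of t ?w] by (simp add: good_config_def)
  have init: "sats (run_val M T ?w) (init_clauses M T)"
    unfolding sat_init by (auto simp: run_val_simps init_tape[OF wf] init_state word_tape_nth)
  have input: "sats (run_val M T ?w) (input_clauses T k X)"
    unfolding sat_input run_val_simps init_tape[OF wf K] if_P[OF refl] word_tape_shift
  proof (intro allI impI)
    let ?c = "\<lambda>i. if T \<le> i \<and> i < T + length ?w then bit_sym (?w ! (i - T)) else 0"
    fix i
    consider "i < T" | "T + length X + k \<le> i" "\<not> i < T" | "T \<le> i" "i < T + length X" | "T + length X \<le> i" "i < T + length X + k"
      by linarith
    then show "if i < T \<or> T + length X + k \<le> i then 0 = ?c i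
      else if i < T + length X then (if sel False X (i - T) then 2 else 1) = ?c i
      else (0 = ?c i \<or> 1 = ?c i \<or> 2 = ?c i) \<and> (0 = ?c i \<longrightarrow> 0 = ?c (i + 1))"
    proof cases
      case 2
      then show ?thesis using k by simp
    next
      case 3
      then have "i - T < length X" by linarith
      then show ?thesis using 3 by (simp add: sel_def nth_append bit_sym_def)
    next
      case 4
      have "?c i = 0 \<longleftrightarrow> T + length ?w \<le> i" using 4 by auto
      then show ?thesis using 4 by (auto simp: bit_sym_def)
    qed simp
  qed
  have read: "sats (run_val M T ?w) (read_clauses M T t)" for t
    unfolding sat_read run_val_simps
  proof (intro allI impI ballI)
    fix j q as a i
    assume j: "j < num_tapes M" and h: "(q = fst (run M ?w t) \<and> as = map read (take j (snd (run M ?w t)))) \<and>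
      snd (snd (run M ?w t) ! j) = int i - int T \<and> a = fst (snd (run M ?w t) ! j) (int i - int T)"
    have "a = read (snd (run M ?w t) ! j)" using h by (simp add: read_def)
    then show "q = fst (run M ?w t) \<and> as @ [a] = map read (take (Suc j) (snd (run M ?w t)))"
      using h j lenK[of t] by (simp add: take_Suc_conv_app_nth)
  qed
  have wr: "sats (run_val M T ?w) (write_clauses M T t)" for t
    unfolding sat_write
  proof (intro allI impI ballI)
    fix q as j i
    assume j: "j < num_tapes M"
    show "(run_val M T ?w (PreV t (num_tapes M) q as) \<longrightarrow> run_val M T ?w (PreV (Suc t) 0 (fst (total_trans M q as)) [])) \<and>
      (run_val M T ?w (PreV t (num_tapes M) q as) \<and> run_val M T ?w (HeadV t j i) \<longrightarrow>
        run_val M T ?w (CellV (Suc t) j i (fst (snd (total_trans M q as) ! j)))) \<and>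
      (\<forall>i' \<le> 2 * T. run_val M T ?w (PreV t (num_tapes M) q as) \<and> run_val M T ?w (HeadV t j i) \<longrightarrow>
        run_val M T ?w (if moved (snd (snd (total_trans M q as) ! j)) i i' then HeadV (Suc t) j i' else NoV (Suc t) j i'))"
      unfolding if_distrib[of "run_val M T ?w"] run_val_simps step[OF j] state[OF j] Let_def
      using lenK[of t] by (auto simp: moved_iff)
  qed
  have keep: "sats (run_val M T ?w) (keep_clauses M T t)" for t
    unfolding sat_keep run_val_simps by (auto simp: step Let_def)
  have accept: "sats (run_val M T ?w) (accept_clauses M T)"
    unfolding sat_accept run_val_simps using acc by (auto simp: accepts_at_def)
  show ?thesis unfolding sat_cnf using init input read wr keep accept by simp
qed

text \<open>A certificate is read off the open cells, and induction on time shows that all facts of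
  the run on it are true under \<alpha>. Further variables may be true as well; this does no harm,
  as every step clause is an implication with positive premises.\<close>

lemma run_of_sats:
  assumes wf: "wf_tm M" and T: "length X + k + 2 \<le> T" and sat: "sats \<alpha> (cnf M T k X)"
  shows "\<exists>u. length u \<le> k \<and> accepts_at M (X @ u) T"
proof -
  let ?n = "length X"
  have K: "num_tapes M > 0" and syms: "num_syms M \<ge> 3" using wf by (auto simp: wf_tm_def)
  have init: "\<alpha> (PreV 0 0 0 [])" "\<And>j i. j < num_tapes M \<Longrightarrow> i \<le> 2 * T \<Longrightarrow> \<alpha> (if i = T then HeadV 0 j i else NoV 0 j i)"
    "\<And>j i. 1 \<le> j \<Longrightarrow> j < num_tapes M \<Longrightarrow> i \<le> 2 * T \<Longrightarrow> \<alpha> (CellV 0 j i 0)"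
    using sat unfolding sat_cnf sat_init by auto
  have input: "if i < T \<or> T + ?n + k \<le> i then \<alpha> (CellV 0 0 i 0)
    else if i < T + ?n then \<alpha> (CellV 0 0 i (if sel False X (i - T) then 2 else 1))
    else (\<alpha> (CellV 0 0 i 0) \<or> \<alpha> (CellV 0 0 i 1) \<or> \<alpha> (CellV 0 0 i 2)) \<and>
      (\<alpha> (CellV 0 0 i 0) \<longrightarrow> \<alpha> (CellV 0 0 (i + 1) 0))" if "i \<le> 2 * T" for i
    using sat that unfolding sat_cnf sat_input by blast
  have steps: "sats \<alpha> (read_clauses M T t)" "sats \<alpha> (write_clauses M T t)" "sats \<alpha> (keep_clauses M T t)" if "t < T" for t
    using sat that unfolding sat_cnf by auto
  \<comment> \<open>The length of the certificate: up to the first open cell that may be blank, or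
    \<open>k\<close> if there is none.\<close>
  define d where "d = (LEAST d. d = k \<or> \<alpha> (CellV 0 0 (T + ?n + d) 0))"
  have d: "d = k \<or> \<alpha> (CellV 0 0 (T + ?n + d) 0)" unfolding d_def by (rule LeastI[of _ k]) simp
  have dk: "d \<le> k" unfolding d_def by (rule Least_le) simp
  have nd: "\<not> \<alpha> (CellV 0 0 (T + ?n + e) 0)" if "e < d" for e
    using not_less_Least[of e "\<lambda>d. d = k \<or> \<alpha> (CellV 0 0 (T + ?n + d) 0)"] that unfolding d_def by blast
  \<comment> \<open>If a cell admits both bits, either choice agrees with \<alpha>; \<open>2\<close>
    is preferred.\<close>
  define u where "u = map (\<lambda>e. \<alpha> (CellV 0 0 (T + ?n + e) 2)) [0..<d]"
  have u: "length u = d" "\<And>e. e < d \<Longrightarrow> u ! e = \<alpha> (CellV 0 0 (T + ?n + e) 2)" by (simp_all add: u_def)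
  have blank: "\<alpha> (CellV 0 0 (T + ?n + e) 0)" if "d \<le> e" "T + ?n + e \<le> 2 * T" for e
  proof (cases "k \<le> e")
    case True
    then show ?thesis using input[OF that(2)] by simp
  next
    case False
    then have "\<alpha> (CellV 0 0 (T + ?n + d) 0)" using d that(1) by simp
    with that(1) show ?thesis using False
    proof (induction e rule: dec_induct)
      case (step e)
      then have "\<alpha> (CellV 0 0 (T + ?n + e) 0)" by simp
      then show ?case using input[of "T + ?n + e"] step.prems T by simp
    qed simp
  qed
  let ?w = "X @ u"
  let ?c = "\<lambda>t j i. fst (snd (run M ?w t) ! j) (int i - int T)" and ?h = "\<lambda>t j. snd (snd (run M ?w t) ! j)"
  have cell0: "\<alpha> (CellV 0 0 i (?c 0 0 i))" if i: "i \<le> 2 * T" for i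
  proof -
    have c: "?c 0 0 i = (if T \<le> i \<and> i < T + ?n + d then bit_sym (?w ! (i - T)) else 0)"
      unfolding init_tape[OF wf K] if_P[OF refl] word_tape_shift by (simp add: u(1) add.assoc)
    consider "i < T" | "T \<le> i" "i < T + ?n" | e where "i = T + ?n + e" "e < d" | e where "i = T + ?n + e" "d \<le> e"
      by (metis add.assoc le_Suc_ex linorder_not_le)
    then show ?thesis
    proof cases
      case 1
      then show ?thesis using input[OF i] unfolding c by simp
    next
      case 2
      then have "?c 0 0 i = (if sel False X (i - T) then 2 else 1)"
        unfolding c by (auto simp: sel_def nth_append bit_sym_def)
      then show ?thesis using input[OF i] 2 by simp
    next
      case 3
      then have "?c 0 0 i = (if \<alpha> (CellV 0 0 i 2) then 2 else 1)"
        unfolding c using u by (auto simp: nth_append bit_sym_def)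
      moreover have "\<alpha> (CellV 0 0 i 1) \<or> \<alpha> (CellV 0 0 i 2)"
        using input[OF i] nd[OF 3(2)] 3 dk by simp
      ultimately show ?thesis by auto
    next
      case 4
      then show ?thesis using blank[of e] i unfolding c by simp
    qed
  qed
  have good: "good_config M t (fst (run M ?w t), snd (run M ?w t))" for t using good_run[OF wf] by simp
  have inv: "\<alpha> (PreV t 0 (fst (run M ?w t)) []) \<and> (\<forall>j < num_tapes M. \<forall>i \<le> 2 * T.
      \<alpha> (CellV t j i (?c t j i)) \<and> \<alpha> (if ?h t j = int i - int T then HeadV t j i else NoV t j i))"
    if "t \<le> T" for t
    using that
  proof (induction t)
    case 0
    have "\<alpha> (CellV 0 j i (?c 0 j i))" if "j < num_tapes M" "i \<le> 2 * T" for j i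
      using cell0[OF that(2)] init(3)[OF _ that] by (cases "j = 0") (auto simp: init_tape[OF wf that(1)] word_tape_nth)
    moreover have "\<alpha> (if ?h 0 j = int i - int T then HeadV 0 j i else NoV 0 j i)" if "j < num_tapes M" "i \<le> 2 * T" for j i
      using init(2)[OF that] by (simp add: init_tape[OF wf that(1)] word_tape_nth split: if_splits)
    ultimately show ?case using init(1) by (simp add: init_state)
  next
    case (Suc t)
    define q where "q = fst (run M ?w t)"
    define tps where "tps = snd (run M ?w t)"
    have g: "good_config M t (q, tps)" using good by (simp add: q_def tps_def)
    have t: "t < T" using Suc.prems by simp
    have q: "q \<le> num_states M" and lenK: "length tps = num_tapes M" using g by (auto simp: good_config_def)
    have IHq: "\<alpha> (PreV t 0 q [])" using Suc by (simp add: q_def)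
    have IHc: "\<alpha> (CellV t j i (fst (tps ! j) (int i - int T)))" if "j < num_tapes M" "i \<le> 2 * T" for j i
      using Suc that by (simp add: tps_def)
    have IHh: "\<alpha> (if snd (tps ! j) = int i - int T then HeadV t j i else NoV t j i)" if "j < num_tapes M" "i \<le> 2 * T" for j i
      using Suc that by (simp add: tps_def)
    have sym: "fst (tps ! j) z < num_syms M" if "j < num_tapes M" for j z
      using g that by (simp add: good_config_def)
    \<comment> \<open>The number of the cell under head \<open>j\<close>, counted from the left end
      of the window.\<close>
    define p where "p j = nat (snd (tps ! j) + int T)" for j
    have p: "p j \<le> 2 * T" "int (p j) - int T = snd (tps ! j)" if "j < num_tapes M" for j
    proof -
      have "\<bar>snd (tps ! j)\<bar> \<le> int t" using g that by (simp add: good_config_def)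
      then show "p j \<le> 2 * T" "int (p j) - int T = snd (tps ! j)" using t unfolding p_def by auto
    qed
    have H: "\<alpha> (HeadV t j (p j))" if "j < num_tapes M" for j
      using IHh[OF that p(1)[OF that]] p(2)[OF that] by simp
    have reads: "set (map read tps) \<subseteq> {..<num_syms M}" using read_lt[OF g] .
    have pre: "\<alpha> (PreV t j q (map read (take j tps)))" if "j \<le> num_tapes M" for j
      using that
    proof (induction j)
      case (Suc j)
      then have j: "j < num_tapes M" by simp
      have "set (map read (take j tps)) \<subseteq> {..<num_syms M}" using reads set_take_subset[of j tps] by auto
      then have "map read (take j tps) \<in> set (List.n_lists j [0..<num_syms M])"
        unfolding in_n_lists using j lenK by simp
      then have "\<alpha> (PreV t (Suc j) q (map read (take j tps) @ [read (tps ! j)]))"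
        using steps(1)[OF t, unfolded sat_read, rule_format, OF j q _ _ p(1)[OF j], of "map read (take j tps)" "read (tps ! j)"]
          Suc H[OF j] IHc[OF j p(1)[OF j]] sym[OF j] p(2)[OF j] by (simp add: read_def)
      then show ?case using j lenK by (simp add: take_Suc_conv_app_nth)
    qed (simp add: IHq)
    let ?as = "map read tps"
    have as: "?as \<in> set (List.n_lists (num_tapes M) [0..<num_syms M])"
      unfolding in_n_lists using lenK reads by simp
    have preK: "\<alpha> (PreV t (num_tapes M) q ?as)" using pre[of "num_tapes M"] lenK by simp
    note wr = steps(2)[OF t, unfolded sat_write, rule_format, OF q as _ p(1)]
    have state: "fst (run M ?w (Suc t)) = fst (total_trans M q ?as)"
      using step_total_trans[OF g] by (simp add: run_Suc q_def tps_def)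
    have tape: "snd (run M ?w (Suc t)) ! j = ((fst (tps ! j))(snd (tps ! j) := fst (snd (total_trans M q ?as) ! j)),
      snd (tps ! j) + shift (snd (snd (total_trans M q ?as) ! j)))" if "j < num_tapes M" for j
      using step_tape[OF wf g that] by (simp add: run_Suc q_def tps_def)
    have "\<alpha> (PreV (Suc t) 0 (fst (total_trans M q ?as)) [])" using wr[OF K K] preK by blast
    moreover have "\<alpha> (CellV (Suc t) j i (?c (Suc t) j i))" if j: "j < num_tapes M" and i: "i \<le> 2 * T" for j i
    proof (cases "i = p j")
      case True
      then show ?thesis using wr[OF j j] preK H[OF j] p(2)[OF j] by (simp add: tape[OF j])
    next
      case False
      then have ne: "snd (tps ! j) \<noteq> int i - int T" using p(2)[OF j] by linarith
      then have "\<alpha> (NoV t j i)" using IHh[OF j i] by simp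
      then have "\<alpha> (CellV (Suc t) j i (fst (tps ! j) (int i - int T)))"
        using steps(3)[OF t, unfolded sat_keep, rule_format, OF j sym[OF j] i] IHc[OF j i] by blast
      then show ?thesis using ne by (auto simp: tape[OF j])
    qed
    moreover have "\<alpha> (if ?h (Suc t) j = int i - int T then HeadV (Suc t) j i else NoV (Suc t) j i)"
      if j: "j < num_tapes M" and i: "i \<le> 2 * T" for j i
    proof -
      have "?h (Suc t) j = int i - int T \<longleftrightarrow> moved (snd (snd (total_trans M q ?as) ! j)) (p j) i"
        using p(2)[OF j] unfolding moved_iff by (auto simp: tape[OF j])
      then show ?thesis using wr[OF j j] preK H[OF j] i by auto
    qed
    ultimately show ?case using state by simp
  qed
  let ?l = "num_tapes M - 1"
  have l: "?l < num_tapes M" using K by simp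
  have cells: "\<forall>i \<le> 2 * T. \<alpha> (CellV T ?l i (?c T ?l i))" using inv[OF order_refl] l by blast
  have fin: "\<alpha> (CellV T ?l T (?c T ?l T))" "\<alpha> (CellV T ?l (T + 1) (?c T ?l (T + 1)))"
    by (rule cells[rule_format], use T in linarith)+
  have acc: "(a \<noteq> 2 \<longrightarrow> \<not> \<alpha> (CellV T ?l T a)) \<and> (a \<noteq> 0 \<longrightarrow> \<not> \<alpha> (CellV T ?l (T + 1) a))" if "a < num_syms M" for a
    using sat that unfolding sat_cnf sat_accept by blast
  have "?c T ?l z < num_syms M" for z using good[of T] l by (simp add: good_config_def)
  \<comment> \<open>The actual symbols are true by \<open>inv\<close>, but every symbol other than
    the right one is forbidden.\<close>
  then have "?c T ?l T = 2" "?c T ?l (T + 1) = 0" using fin acc by blast+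
  then show ?thesis using u(1) dk by (intro exI[of _ u]) (simp add: accepts_at_def)
qed

section \<open>NP-hardness\<close>

text \<open>\<open>pair_word x u\<close> has length at most \<open>2 * length x + 1 + k\<close>. The
  first summand of \<open>T\<close> bounds the time on all these words, and the second one makes the
  window hold such a word.\<close>

lemma accepts_iff_sat:
  assumes wf: "wf_tm M" and V: "\<And>x. \<exists>t \<le> poly p (length x). halts_with M ((step M ^^ t) (init_config M x)) (V x)"
    and T: "T = poly p (2 * length x + 1 + k) + (2 * length x + 1 + k + 2)"
  shows "(\<exists>u. length u \<le> k \<and> V (pair_word x u) = [True]) \<longleftrightarrow>
    (\<exists>\<alpha>. clauses_hold (concat (cnf M T k (delim x))) \<alpha>)"
proof -
  have acc: "V (delim x @ u) = [True] \<longleftrightarrow> accepts_at M (delim x @ u) T" if u: "length u \<le> k" for u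
  proof -
    let ?w = "delim x @ u"
    obtain t where t: "t \<le> poly p (length ?w)" "halts_with M (run M ?w t) (V ?w)"
      using V[of ?w] unfolding run_def by blast
    have "length ?w \<le> 2 * length x + 1 + k" using u by simp
    then have "t \<le> T" using t(1) poly_nat_mono[of _ _ p] unfolding T by (meson le_add1 le_trans)
    then have run: "run M ?w T = run M ?w t"
      using t(2) by (intro run_halted) (auto simp: halts_with_def)
    have "length (snd (run M ?w T)) = num_tapes M" "num_tapes M \<ge> 1"
      using good_run[OF wf, of T ?w] wf by (auto simp: good_config_def wf_tm_def)
    then have "last (snd (run M ?w T)) = snd (run M ?w T) ! (num_tapes M - 1)"
      by (metis last_conv_nth length_0_conv not_one_le_zero)
    then show ?thesis
      using t(2) tape_output_True unfolding accepts_at_def run halts_with_def by metis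
  qed
  have hold: "clauses_hold (concat (cnf M T k (delim x))) \<alpha> \<longleftrightarrow> sats \<alpha> (cnf M T k (delim x))" for \<alpha>
    unfolding clauses_hold_concat(1)[OF cnf_length4] by (simp add: list_all_iff sat_def)
  have T': "length (delim x) + k + 2 \<le> T" by (simp add: T)
  show ?thesis
    unfolding hold pair_word_def using acc sats_of_run[OF wf] run_of_sats[OF wf T'] by blast
qed

definition reduction :: "tm \<Rightarrow> nat poly \<Rightarrow> nat poly \<Rightarrow> bool list \<Rightarrow> clause list" where
  "reduction M p q x = (let k = poly q (length x) in
    cnf M (poly p (2 * length x + 1 + k) + (2 * length x + 1 + k + 2)) k (delim x))"

definition gadget_word :: "clause list \<Rightarrow> bool list" where
  "gadget_word cs = enc_instance (gadget (concat cs)) (of_nat (9 * length cs))"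

lemma gadget_word_iff:
  assumes "\<forall>c \<in> set cs. length c = 4"
  shows "gadget_word cs \<in> BBR \<longleftrightarrow> (\<exists>\<alpha>. clauses_hold (concat cs) \<alpha>)"
    "gadget_word cs \<in> restricted_BBR \<longleftrightarrow> (\<exists>\<alpha>. clauses_hold (concat cs) \<alpha>)"
proof -
  note g = gadget_correct[OF clauses_hold_concat(2)[OF assms]]
  have "gadget_word cs \<in> BBR \<longleftrightarrow> best_blue_response (gadget (concat cs)) (of_nat (9 * length cs))"
    using g(1) unfolding BBR_def gadget_word_def by (auto simp: enc_instance_inject)
  then show "gadget_word cs \<in> BBR \<longleftrightarrow> (\<exists>\<alpha>. clauses_hold (concat cs) \<alpha>)" using g(3) by simp
  have "gadget_word cs \<in> restricted_BBR \<longleftrightarrow> best_blue_response (gadget (concat cs)) (of_nat (9 * length cs))"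
    using g(1,2) unfolding restricted_BBR_def gadget_word_def by (auto simp: enc_instance_inject)
  then show "gadget_word cs \<in> restricted_BBR \<longleftrightarrow> (\<exists>\<alpha>. clauses_hold (concat cs) \<alpha>)" using g(3) by simp
qed

subsection \<open>The formula is computable in polynomial time\<close>

lemma pt_PreV [pt_rules]: "pt t \<Longrightarrow> pt (\<lambda>x. PreV (t x) j q as)"
  unfolding PreV_def by (intro pt_Cons pt_const)

lemma pt_CellV [pt_rules]: "pt t \<Longrightarrow> pt i \<Longrightarrow> pt a \<Longrightarrow> pt (\<lambda>x. CellV (t x) j (i x) (a x))"
  unfolding CellV_def by (intro pt_Cons pt_const)

lemma pt_HeadV [pt_rules]: "pt t \<Longrightarrow> pt i \<Longrightarrow> pt (\<lambda>x. HeadV (t x) j (i x))"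
  unfolding HeadV_def by (intro pt_Cons pt_const)

lemma pt_NoV [pt_rules]: "pt t \<Longrightarrow> pt i \<Longrightarrow> pt (\<lambda>x. NoV (t x) j (i x))"
  unfolding NoV_def by (intro pt_Cons pt_const)

lemma replicate4: "replicate 4 x = [x, x, x, x]"
  by (simp add: numeral_eq_Suc)

lemma pt_clauses [pt_rules]:
  "pt v \<Longrightarrow> pt (\<lambda>x. unit (v x))" "pt v \<Longrightarrow> pt (\<lambda>x. no (v x))"
  "pt a \<Longrightarrow> pt b \<Longrightarrow> pt c \<Longrightarrow> pt (\<lambda>x. or3 (a x) (b x) (c x))"
  "pt a \<Longrightarrow> pt b \<Longrightarrow> pt c \<Longrightarrow> pt d \<Longrightarrow> pt (\<lambda>x. imp3 (a x) (b x) (c x) (d x))"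
  unfolding clause_defs replicate4 by (intro pt_Cons pt_Pair pt_const; assumption)+

lemma pt_moved [pt_rules]: "pt i \<Longrightarrow> pt i' \<Longrightarrow> pt (\<lambda>x. moved d (i x) (i' x))"
  unfolding moved_def by (cases d) (simp_all add: pt_rules)

lemma pt_cnf:
  assumes T: "pt T" and k: "pt k" and w: "pt w"
  shows "pt (\<lambda>x. cnf M (T x) (k x) (w x))"
proof -
  have init: "pt (\<lambda>x. init_clauses M (T x))"
    unfolding init_clauses_def
    by (intro pt_Cons pt_append pt_concat_const) (intro pt_rules pt_comp[OF T])+
  have input: "pt (\<lambda>x. input_clauses (T x) (k x) (w x))"
    unfolding input_clauses_def by (intro pt_rules pt_comp[OF T] pt_comp[OF k] pt_comp[OF w])
  have rd: "pt (\<lambda>p. read_clauses M (T (fst p)) (snd p))"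
    unfolding read_clauses_def
    apply (rule pt_concat_const)+
    apply (intro pt_rules pt_comp[OF T])
    done
  have wr: "pt (\<lambda>p. write_clauses M (T (fst p)) (snd p))"
    unfolding write_clauses_def Let_def
    apply (rule pt_concat_const)
    apply (rule pt_concat_const)
    apply (rule pt_concat_const)
    apply (intro pt_rules pt_comp[OF T])
    done
  have keep: "pt (\<lambda>p. keep_clauses M (T (fst p)) (snd p))"
    unfolding keep_clauses_def
    apply (rule pt_concat_const)+
    apply (intro pt_rules pt_comp[OF T])
    done
  have accept: "pt (\<lambda>x. accept_clauses M (T x))"
    unfolding accept_clauses_def
    apply (rule pt_concat_const)
    apply (intro pt_append)
    subgoal for a by (cases "a = 2") (simp_all add: pt_rules T)
    subgoal for a by (cases "a = 0") (simp_all add: pt_rules T)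
    done
  show ?thesis
    unfolding cnf_def
    by (intro pt_append init input accept pt_concat_map pt_upt pt_const T rd wr keep)
qed

lemma pt_reduction: "pt (\<lambda>x. reduction M p q (unraw x))"
proof -
  have k: "pt (\<lambda>x. poly q (length (unraw x)))" by (intro pt_rules)
  have "pt (\<lambda>x. cnf M (poly p (2 * length (unraw x) + 1 + poly q (length (unraw x))) +
     (2 * length (unraw x) + 1 + poly q (length (unraw x)) + 2)) (poly q (length (unraw x))) (delim (unraw x)))"
    by (intro pt_cnf) (intro pt_rules)+
  then show ?thesis by (simp add: reduction_def Let_def)
qed

subsection \<open>The game is computable in polynomial time\<close>

text \<open>A computable form: quantifiers range over explicit lists, and access is total by means
  of the default literal \<open>d\<close>.\<close>

definition pred_slot_code :: "'v formula \<Rightarrow> nat \<Rightarrow> nat \<Rightarrow> (bool \<times> 'v) \<Rightarrow> bool" where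
  "pred_slot_code F r u d \<longleftrightarrow> snd (sel d F r) = snd (sel d F u) \<and>
    (\<forall>q \<in> set [Suc r..<u]. snd (sel d F q) \<noteq> snd (sel d F u))"

definition adj_code :: "'v formula \<Rightarrow> nat \<Rightarrow> nat \<Rightarrow> (bool \<times> 'v) \<Rightarrow> bool" where
  "adj_code F t s d = (let N = length F; ty = t div N; u = t mod N; k = (ty - 3) div 2 in
     if ty = 0 then s < N \<and> s div 4 = u div 4 \<and> s mod 4 \<noteq> 3 \<or> s = (if fst (sel d F u) then 5 * N + u else 4 * N + u)
     else if ty < 3 then s = N + u \<or> s = (3 + ty) * N + u
     else s = (2 + k) * N + u \<or>
       (\<exists>r \<in> set [0..<u]. pred_slot_code F r u d \<and> s = (if (ty - 3) mod 2 = 1 then (5 - k) * N + u else (4 + k) * N + r)))"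

lemma pred_slot_code: "u < length F \<Longrightarrow> r < u \<Longrightarrow> pred_slot_code F r u d = pred_slot F r u"
  unfolding pred_slot_code_def pred_slot_def by (auto simp: sel_nth)

text \<open>A nonempty formula makes \<open>t mod N < N\<close>, so every access is within range.
  For the empty formula the matrix has no rows to be computed.\<close>

lemma adj_code: "length F > 0 \<Longrightarrow> adj_code F t s d = adj F t s"
  unfolding adj_code_def adj_def Let_def odd_iff_mod_2_eq_one
  by (simp add: sel_nth Bex_def pred_slot_code cong: conj_cong)

lemma enc_rat_of_nat: "enc_rat (of_nat n) = False # enc_nat n @ enc_nat 1"
  by (simp add: enc_rat_def)

lemma gadget_word_code:
  "gadget_word cs = (let F = concat cs; N = length F in
    enc_nat (7 * N) @ enc_nat (6 * N) @ [True] @ concat (map (\<lambda>_. False # enc_nat 1 @ enc_nat 1) [0..<7 * N]) @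
    concat (map (\<lambda>t. map (\<lambda>s. adj_code F t s (False, [])) [0..<6 * N]) [0..<7 * N]) @
    False # enc_nat (9 * length cs) @ enc_nat 1)"
proof -
  let ?F = "concat cs"
  have rows: "sensing (gadget ?F) = map (\<lambda>t. map (\<lambda>s. adj_code ?F t s (False, [])) [0..<6 * length ?F]) [0..<7 * length ?F]"
    unfolding gadget_def by (cases "length ?F = 0") (simp_all add: adj_code)
  have vals: "map enc_rat (target_values (gadget ?F)) = map (\<lambda>_. False # enc_nat 1 @ enc_nat 1) [0..<7 * length ?F]"
    using enc_rat_of_nat[of 1] by (simp add: gadget_def map_replicate_const)
  have rest: "num_targets (gadget ?F) = 7 * length ?F" "num_sensors (gadget ?F) = 6 * length ?F"
    "enc_enat (recharge (gadget ?F)) = [True]"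
    by (simp_all add: num_targets_def gadget_def enc_enat_def)
  show ?thesis
    unfolding gadget_word_def enc_instance_def enc_rat_of_nat Let_def rows vals rest ..
qed

lemma pt_pred_slot_code [pt_rules]:
  assumes "pt F" "pt r" "pt u"
  shows "pt (\<lambda>x. pred_slot_code (F x) (r x) (u x) d)"
  unfolding pred_slot_code_def
  by (intro pt_rules pt_comp[OF assms(1)] pt_comp[OF assms(2)] pt_comp[OF assms(3)])

lemma pt_adj_code [pt_rules]:
  assumes "pt F" "pt t" "pt s"
  shows "pt (\<lambda>x. adj_code (F x) (t x) (s x) d)"
  unfolding adj_code_def
  by (intro pt_rules pt_comp[OF assms(1)] pt_comp[OF assms(2)] pt_comp[OF assms(3)])

lemma pt_gadget_word: "pt gadget_word"
  unfolding gadget_word_code[abs_def] by (intro pt_rules)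

text \<open>Stated for any \<open>L\<close>, because the same reduction serves the full and the
  restricted language: all its games are restricted.\<close>

lemma NP_hard_of_gadget_word:
  assumes "\<And>cs. \<forall>c \<in> set cs. length c = 4 \<Longrightarrow> gadget_word cs \<in> L \<longleftrightarrow> (\<exists>\<alpha>. clauses_hold (concat cs) \<alpha>)"
  shows "NP_hard L"
  unfolding NP_hard_def
proof
  fix L' assume "L' \<in> NP"
  then obtain V q where V: "polytime V"
    "\<And>x. x \<in> L' \<longleftrightarrow> (\<exists>u. length u \<le> poly q (length x) \<and> V (pair_word x u) = [True])"
    unfolding NP_def by blast
  obtain M p where M: "wf_tm M"
    "\<And>x. \<exists>t \<le> poly p (length x). halts_with M ((step M ^^ t) (init_config M x)) (V x)"
    using V(1) unfolding polytime_def by blast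
  have "x \<in> L' \<longleftrightarrow> gadget_word (reduction M p q x) \<in> L" for x
    unfolding V(2) accepts_iff_sat[OF M refl]
    by (subst assms) (simp_all add: reduction_def Let_def cnf_length4)
  moreover have "pt (\<lambda>x. Raw (gadget_word (reduction M p q (unraw x))))"
    by (intro pt_Raw pt_lift1[OF pt_gadget_word] pt_reduction)
  then have "polytime (\<lambda>x. gadget_word (reduction M p q x))"
    using polytime_of_pt by fastforce
  ultimately show "poly_reducible L' L" unfolding poly_reducible_def by blast
qed

lemma NP_hard_BBR: "NP_hard BBR" "NP_hard restricted_BBR"
  by (rule NP_hard_of_gadget_word, erule gadget_word_iff)+

section \<open>Arithmetic on bit lists\<close>

fun bits_val :: "bool list \<Rightarrow> nat" where
  "bits_val [] = 0"
| "bits_val (b # bs) = of_bool b + 2 * bits_val bs"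

lemma bits_val_append: "bits_val (xs @ ys) = bits_val xs + 2 ^ length xs * bits_val ys"
  by (induction xs) (auto simp: algebra_simps)

lemma bits_val_binary [simp]: "bits_val (binary n) = n"
proof (induction n rule: binary.induct)
  case (1 n)
  show ?case
  proof (cases "n = 0")
    case False
    then show ?thesis using 1 by (subst binary.simps) (auto simp: of_bool_odd_eq_mod_2)
  qed (subst binary.simps, simp)
qed

text \<open>The range of \<open>binary\<close>: the most significant bit, which comes last, is
  set.\<close>

definition canonical :: "bool list \<Rightarrow> bool" where
  "canonical bs \<longleftrightarrow> (case rev bs of [] \<Rightarrow> True | b # _ \<Rightarrow> b)"

lemma canonical_simps: "canonical []" "canonical (b # bs) \<longleftrightarrow> canonical bs \<and> (bs = [] \<longrightarrow> b)"
  by (cases "rev bs"; auto simp: canonical_def split: list.splits)+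

lemma bits_val_pos: "canonical bs \<Longrightarrow> bs \<noteq> [] \<Longrightarrow> bits_val bs > 0"
proof (induction bs)
  case (Cons b bs)
  then show ?case by (cases "bs = []") (auto simp: canonical_simps)
qed simp

lemma binary_bits_val: "canonical bs \<Longrightarrow> binary (bits_val bs) = bs"
proof (induction bs)
  case Nil
  then show ?case by (simp add: binary.simps)
next
  case (Cons b bs)
  have IH: "binary (bits_val bs) = bs" using Cons by (simp add: canonical_simps)
  have "bits_val (b # bs) \<noteq> 0" using bits_val_pos[OF Cons.prems] by simp
  moreover have "(of_bool b + 2 * bits_val bs) div 2 = bits_val bs" by (cases b) auto
  ultimately show ?case using IH by (subst binary.simps) simp
qed

lemma canonical_binary: "canonical (binary n)"
proof (induction n rule: binary.induct)
  case (1 n)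
  show ?case
  proof (cases "n = 0")
    case False
    moreover have "odd n" if "binary (n div 2) = []"
    proof -
      have "n div 2 = 0" using bits_val_binary[of "n div 2"] that by simp
      then have "n = 1" using False by (simp add: div_eq_0_iff)
      then show ?thesis by simp
    qed
    ultimately show ?thesis using 1 by (subst binary.simps) (auto simp: canonical_simps)
  qed (subst binary.simps, simp add: canonical_simps)
qed

lemma binary_Nil_iff: "binary n = [] \<longleftrightarrow> n = 0"
  by (subst binary.simps) simp

lemma length_binary_mono: "m \<le> n \<Longrightarrow> length (binary m) \<le> length (binary n)"
proof (induction n arbitrary: m rule: binary.induct)
  case (1 n)
  show ?case
  proof (cases "m = 0")
    case False
    then have "length (binary (m div 2)) \<le> length (binary (n div 2))"
      using 1 by (intro "1.IH") auto
    then show ?thesis using False 1(2) by (subst (1 2) binary.simps) simp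
  qed (simp add: binary.simps)
qed

lemma length_binary_Suc: "length (binary (Suc n)) \<le> Suc (length (binary n))"
proof (induction n rule: binary.induct)
  case (1 n)
  show ?case
  proof (cases "n = 0")
    case False
    have "length (binary (Suc n div 2)) \<le> Suc (length (binary (n div 2)))"
    proof (cases "even n")
      case True
      then have "Suc n div 2 = n div 2" by simp
      then show ?thesis by simp
    next
      case odd: False
      then have "Suc n div 2 = Suc (n div 2)" by simp
      then show ?thesis using "1.IH"[OF False] by simp
    qed
    moreover have "length (binary (Suc n)) = Suc (length (binary (Suc n div 2)))"
      by (subst binary.simps) simp
    moreover have "length (binary n) = Suc (length (binary (n div 2)))"
      using False by (subst binary.simps) simp
    ultimately show ?thesis by simp
  qed (simp add: binary.simps)
qed

text \<open>The value of the lowest \<open>i\<close> bits, missing ones counting as zero. It is the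
  loop invariant for operations on words of different lengths.\<close>

definition bits_upto :: "bool list \<Rightarrow> nat \<Rightarrow> nat" where
  "bits_upto x i = (\<Sum>j<i. of_bool (sel False x j) * 2 ^ j)"

lemma bits_upto_Suc: "bits_upto x (Suc i) = bits_upto x i + of_bool (sel False x i) * 2 ^ i"
  by (simp add: bits_upto_def)

lemma bits_upto_eq: "length x \<le> i \<Longrightarrow> bits_upto x i = bits_val x"
proof -
  have "bits_upto x (length x) = bits_val x"
  proof (induction x rule: rev_induct)
    case (snoc b x)
    have "bits_upto (x @ [b]) (length x) = bits_upto x (length x)"
      unfolding bits_upto_def by (intro sum.cong) (auto simp: sel_def nth_append)
    then show ?case using snoc by (simp add: bits_upto_Suc bits_val_append sel_def)
  qed (simp add: bits_upto_def)
  moreover have "bits_upto x (length x + k) = bits_upto x (length x)" for k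
    by (induction k) (auto simp: bits_upto_Suc sel_def)
  ultimately show "length x \<le> i \<Longrightarrow> bits_upto x i = bits_val x"
    by (metis le_add_diff_inverse)
qed

definition add_step :: "bool list \<Rightarrow> bool list \<Rightarrow> nat \<Rightarrow> bool \<times> bool list \<Rightarrow> bool \<times> bool list" where
  "add_step x y i s = (let a = sel False x i; b = sel False y i; c = fst s in
    (if a then b \<or> c else b \<and> c, snd s @ [a \<noteq> (b \<noteq> c)]))"

definition add_bits :: "bool list \<Rightarrow> bool list \<Rightarrow> bool list" where
  "add_bits x y = (let n = (if length x \<le> length y then length y else length x);
     s = fold (add_step x y) [0..<n] (False, []) in snd s @ [fst s])"

lemma add_steps:
  "let s = fold (add_step x y) [0..<n] (False, []) in
    bits_val (snd s) + of_bool (fst s) * 2 ^ n = bits_upto x n + bits_upto y n \<and> length (snd s) = n"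
proof (induction n)
  case 0
  then show ?case by (simp add: bits_upto_def)
next
  case (Suc n)
  obtain c a where s: "fold (add_step x y) [0..<n] (False, []) = (c, a)" by fastforce
  then have IH: "bits_val a + of_bool c * 2 ^ n = bits_upto x n + bits_upto y n" "length a = n"
    using Suc by simp_all
  have "fold (add_step x y) [0..<Suc n] (False, []) = add_step x y n (c, a)" using s by simp
  then show ?case using IH
    unfolding Let_def add_step_def bits_upto_Suc
    by (cases "sel False x n"; cases "sel False y n"; cases c) (simp_all add: bits_val_append)
qed

lemma bits_val_add [simp]: "bits_val (add_bits x y) = bits_val x + bits_val y"
  and length_add_bits: "length (add_bits x y) = Suc (max (length x) (length y))"
proof -
  define n where "n = (if length x \<le> length y then length y else length x)"
  have n: "length x \<le> n" "length y \<le> n" "n = max (length x) (length y)" by (auto simp: n_def)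
  obtain c a where s: "fold (add_step x y) [0..<n] (False, []) = (c, a)" by fastforce
  have *: "bits_val a + of_bool c * 2 ^ n = bits_val x + bits_val y" "length a = n"
    using add_steps[of x y n] n(1,2) by (simp_all add: s bits_upto_eq)
  have a: "add_bits x y = a @ [c]"
    unfolding add_bits_def Let_def n_def[symmetric] s by simp
  show "bits_val (add_bits x y) = bits_val x + bits_val y"
    using * by (cases c) (simp_all add: a bits_val_append)
  show "length (add_bits x y) = Suc (max (length x) (length y))"
    using * n(3) by (simp add: a)
qed

text \<open>The bits are scanned from the lowest to the highest, so the last position where they
  differ decides.\<close>

definition le_bits :: "bool list \<Rightarrow> bool list \<Rightarrow> bool" where
  "le_bits x y = fold (\<lambda>i c. if sel False x i = sel False y i then c else sel False y i)
    [0..<length x + length y] True"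

lemma le_bits [simp]: "le_bits x y \<longleftrightarrow> bits_val x \<le> bits_val y"
proof -
  have lt: "bits_upto z i < 2 ^ i" for z i
    by (induction i) (auto simp: bits_upto_Suc bits_upto_def)
  have "fold (\<lambda>i c. if sel False x i = sel False y i then c else sel False y i) [0..<n] True
      \<longleftrightarrow> bits_upto x n \<le> bits_upto y n" for n
  proof (induction n)
    case (Suc n)
    then show ?case using lt[of x n] lt[of y n] by (auto simp: bits_upto_Suc)
  qed (simp add: bits_upto_def)
  from this[of "length x + length y"] show ?thesis
    by (simp add: le_bits_def bits_upto_eq)
qed

definition mult_bits :: "bool list \<Rightarrow> bool list \<Rightarrow> bool list" where
  "mult_bits x y = fold (\<lambda>b a. add_bits (False # a) (if b then x else [])) (rev y) []"

lemma bits_val_mult [simp]: "bits_val (mult_bits x y) = bits_val x * bits_val y"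
  unfolding mult_bits_def foldr_conv_fold[symmetric] by (induction y) auto

lemma length_mult_bits: "length (mult_bits x y) \<le> length x + 2 * length y"
  unfolding mult_bits_def foldr_conv_fold[symmetric] by (induction y) (auto simp: length_add_bits)

lemma pt_add_bits [pt_rules]:
  assumes "pt f" "pt g"
  shows "pt (\<lambda>x. add_bits (f x) (g x))"
proof -
  have fold: "pt (\<lambda>p. fold (add_step (fst (fst p)) (snd (fst p))) [0..<snd p] (False, []))"
  proof (rule pt_fold_add[OF _ _ pt_const pb_const[of _ 3]])
    show "pt (\<lambda>p. add_step (fst (fst (fst p))) (snd (fst (fst p))) (fst (snd p)) (snd (snd p)))"
      unfolding add_step_def by (intro pt_rules)
    show "len (add_step (fst (fst p)) (snd (fst p)) y a) \<le> len a + 3" for p :: "(bool list \<times> bool list) \<times> nat" and y a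
      by (cases a) (simp add: add_step_def Let_def len_simps)
  qed (intro pt_rules)
  have "pt (\<lambda>x. fold (add_step (f x) (g x)) [0..<if length (f x) \<le> length (g x) then length (g x) else length (f x)] (False, []))"
    using pt_comp[OF fold, of _ "\<lambda>x. ((f x, g x), if length (f x) \<le> length (g x) then length (g x) else length (f x))"]
    by (simp add: pt_rules assms)
  then show ?thesis
    unfolding add_bits_def Let_def by (intro pt_append pt_Cons pt_const pt_snd pt_fst)
qed

lemma pt_le_bits [pt_rules]:
  assumes "pt f" "pt g"
  shows "pt (\<lambda>x. le_bits (f x) (g x))"
  unfolding le_bits_def
proof (rule pt_fold_add[OF _ _ pt_const pb_const[of _ 0]])
  show "pt (\<lambda>p. if sel False (f (fst p)) (fst (snd p)) = sel False (g (fst p)) (fst (snd p)) then snd (snd p)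
      else sel False (g (fst p)) (fst (snd p)))"
    by (intro pt_rules pt_comp[OF assms(1)] pt_comp[OF assms(2)])
qed (auto simp: len_simps intro!: pt_rules assms)

lemma pt_mult_bits [pt_rules]:
  assumes "pt f" "pt g"
  shows "pt (\<lambda>x. mult_bits (f x) (g x))"
  unfolding mult_bits_def
proof (rule pt_fold_add[OF _ _ pt_const])
  show "pt (\<lambda>p. add_bits (False # snd (snd p)) (if fst (snd p) then f (fst p) else []))"
    by (intro pt_rules pt_comp[OF assms(1)])
  show "pb_on UNIV (\<lambda>x. 3 * len (f x) + 6)"
    by (intro pb_intros pt_on_pb_len assms)
  show "len (add_bits (False # a) (if b then f x else [])) \<le> len a + (3 * len (f x) + 6)" for b x a
    unfolding len_bools by (auto simp: length_add_bits max_def)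
qed (intro pt_rules assms)

lemma pt_canonical [pt_rules]: "pt f \<Longrightarrow> pt (\<lambda>x. canonical (f x))"
  unfolding canonical_def by (intro pt_rules)

text \<open>Fractions are added without cancelling. The lengths of the denominators only add up, so
  the sum remains of polynomial size.\<close>

definition frac_step :: "bool list \<times> bool list \<Rightarrow> bool list \<times> bool list \<Rightarrow> bool list \<times> bool list" where
  "frac_step y s = (add_bits (mult_bits (fst s) (snd y)) (mult_bits (snd s) (fst y)), mult_bits (snd s) (snd y))"

definition fraction :: "bool list \<times> bool list \<Rightarrow> rat" where
  "fraction y = of_nat (bits_val (fst y)) / of_nat (bits_val (snd y))"

lemma frac_fold:
  assumes "\<forall>y \<in> set ys. bits_val (snd y) > 0" "bits_val (snd s) > 0"
  shows "fraction (fold frac_step ys s) = fraction s + sum_list (map fraction ys) \<and> bits_val (snd (fold frac_step ys s)) > 0"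
  using assms
proof (induction ys arbitrary: s)
  case (Cons y ys)
  have "fraction (frac_step y s) = fraction s + fraction y" "bits_val (snd (frac_step y s)) > 0"
    using Cons.prems by (auto simp: frac_step_def fraction_def add_frac_eq)
  then show ?case using Cons.IH[of "frac_step y s"] Cons.prems by simp
qed simp

lemma pt_frac_fold [pt_rules]:
  assumes "pt f"
  shows "pt (\<lambda>x. fold frac_step (f x) ([], [True]))"
\<comment> \<open>A pair of bit lists of lengths \<open>a\<close> and \<open>b\<close> has a code of
  length \<open>6 * a + 3 * b + 1\<close>, at most \<open>9 * max a b + 1\<close>.\<close>
proof (rule pt_fold_measure[OF assms _ pt_const, where m = "\<lambda>_ s. max (length (fst s)) (length (snd s))" and r = "[:1, 9:]"])
  show "pt (\<lambda>p. frac_step (fst (snd p)) (snd (snd p)))"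
    unfolding frac_step_def by (intro pt_rules)
  show "pb_on UNIV (\<lambda>x. len (f x) + 1)" by (intro pb_intros pt_on_pb_len assms)
  show "pb_on UNIV (\<lambda>x :: 'a. max (length (fst ([] :: bool list, [True]))) (length (snd ([] :: bool list, [True]))))"
    by (rule pb_const)
  show "len s \<le> poly [:1, 9:] (max (length (fst s)) (length (snd s)))" for s :: "bool list \<times> bool list"
    by (cases s) (simp add: len_simps len_bools)
  fix x y and s :: "bool list \<times> bool list" assume y: "y \<in> set (f x)"
  obtain a b where ab: "y = (a, b)" by fastforce
  have "2 * length a + 2 * length b \<le> len (f x)"
    using len_mem[OF y] by (simp add: ab len_simps len_bools)
  then show "max (length (fst (frac_step y s))) (length (snd (frac_step y s)))
      \<le> max (length (fst s)) (length (snd s)) + (len (f x) + 1)"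
    using length_mult_bits[of "fst s" b] length_mult_bits[of "snd s" a] length_mult_bits[of "snd s" b]
    unfolding frac_step_def ab fst_conv snd_conv length_add_bits by linarith
qed

section \<open>Parsing certificates\<close>

text \<open>The state tells whether a data bit comes next and holds the current segment and the
  finished ones.\<close>

definition seg_step :: "bool \<Rightarrow> bool \<times> bool list \<times> bool list list \<Rightarrow> bool \<times> bool list \<times> bool list list" where
  "seg_step b s = (if fst s then (False, fst (snd s) @ [b], snd (snd s))
    else if b then (True, snd s) else (False, [], snd (snd s) @ [fst (snd s)]))"

definition segs :: "bool list \<Rightarrow> bool list list" where
  "segs w = snd (snd (fold seg_step w (False, [], [])))"

lemma fold_seg_delim: "fold seg_step (delim w @ u) (False, cur, acc) = fold seg_step u (False, [], acc @ [cur @ w])"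
  by (induction w arbitrary: cur) (auto simp: seg_step_def)

lemma segs_concat: "segs (concat (map delim ws)) = ws"
proof -
  have "snd (snd (fold seg_step (concat (map delim ws)) (False, [], acc))) = acc @ ws" for acc
    by (induction ws arbitrary: acc) (simp_all add: fold_seg_delim del: fold_append)
  then show ?thesis by (simp add: segs_def)
qed

text \<open>\<open>u\<close> is arbitrary here, since a certificate need not be well formed;
  finished segments are never changed again.\<close>

lemma segs_first: "sel [] (segs (delim x @ u)) 0 = x"
proof -
  have "\<exists>zs. snd (snd (fold seg_step u s)) = snd (snd s) @ zs" for s
  proof (induction u arbitrary: s)
    case (Cons b u)
    obtain zs where "snd (snd (fold seg_step u (seg_step b s))) = snd (snd (seg_step b s)) @ zs"
      using Cons by blast
    moreover have "\<exists>ys. snd (snd (seg_step b s)) = snd (snd s) @ ys"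
      by (simp add: seg_step_def)
    then obtain ys where "snd (snd (seg_step b s)) = snd (snd s) @ ys" by blast
    ultimately show ?case by auto
  qed simp
  from this[of "(False, [], [x])"] show ?thesis
    by (auto simp: segs_def fold_seg_delim sel_def simp del: fold_append)
qed

lemma pt_segs [pt_rules]:
  assumes "pt f"
  shows "pt (\<lambda>x. segs (f x))"
  unfolding segs_def
proof (intro pt_snd pt_fold_add[OF assms _ pt_const pb_const[of _ 6]])
  show "pt (\<lambda>p. seg_step (fst (snd p)) (snd (snd p)))"
    unfolding seg_step_def by (intro pt_rules)
  show "len (seg_step b s) \<le> len s + 6" for b s
    by (cases s) (auto simp: seg_step_def len_simps)
qed

section \<open>Membership in NP\<close>

text \<open>
  A certificate consists of seven tables of bit lists: the parameters (number of sensors, recharging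
  time, whether it is infinite, sign, numerator and denominator of the threshold with Bezout
  coefficients), the numerators and denominators of the values, their Bezout coefficients, the rows
  of the sensing matrix, and words whose lengths are the targets in the order in which they pass.
  The verifier encodes the certificate again and compares the result with its input, so that it
  need not parse the latter; the Bezout coefficients witness that fractions are in lowest terms.
\<close>

definition ent :: "bool list list list \<Rightarrow> nat \<Rightarrow> nat \<Rightarrow> bool list" where
  "ent C i j = sel [] (sel [] C i) j"

definition num_c :: "bool list list list \<Rightarrow> nat" where "num_c C = length (sel [] C 1)"
text \<open>The number of sensors is given in binary and may be exponentially large if there are no
  targets. So loops over sensors run over the length of the first row, which is part of the
  certificate.\<close>

definition width_c :: "bool list list list \<Rightarrow> nat" where "width_c C = length (ent C 5 0)"
definition inf_c :: "bool list list list \<Rightarrow> bool" where "inf_c C \<longleftrightarrow> ent C 0 2 = [True]"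
definition neg_c :: "bool list list list \<Rightarrow> bool" where "neg_c C \<longleftrightarrow> ent C 0 3 = [True]"
definition tgt_c :: "bool list list list \<Rightarrow> nat \<Rightarrow> nat" where "tgt_c C i = length (ent C 6 (i - 1))"

text \<open>The equation \<open>v * b = u * a + 1\<close> implies that \<open>b\<close> is positive
  and coprime to \<open>a\<close>. It is tested by two inequalities, because products of bit lists
  need not be canonical.\<close>

definition reduced :: "bool list \<Rightarrow> bool list \<Rightarrow> bool list \<Rightarrow> bool list \<Rightarrow> bool" where
  "reduced a b u v \<longleftrightarrow> canonical a \<and> canonical b \<and>
    le_bits (mult_bits v b) (add_bits (mult_bits u a) [True]) \<and>
    le_bits (add_bits (mult_bits u a) [True]) (mult_bits v b)"

definition word_c :: "bool list list list \<Rightarrow> bool list" where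
  "word_c C = delim (binary (num_c C)) @ delim (ent C 0 0) @
    (if inf_c C then [True] else False # delim (ent C 0 1)) @
    concat (map (\<lambda>i. False # delim (ent C 1 i) @ delim (ent C 2 i)) [0..<num_c C]) @
    concat (map (\<lambda>i. ent C 5 i) [0..<num_c C]) @
    neg_c C # delim (ent C 0 4) @ delim (ent C 0 5)"

text \<open>It contains positions instead of targets and so does not depend on the ordering;
  replacing positions by \<open>tgt_c\<close> yields \<open>schedule\<close>.\<close>

definition sched :: "nat \<Rightarrow> nat \<Rightarrow> (nat \<times> nat) list" where
  "sched n k = concat (map (\<lambda>l. concat (map (\<lambda>j. concat (map (\<lambda>i. if i + j = l then [(i, j)] else [])
    [1..<n + 1])) [0..<k])) [1..<n + k])"

text \<open>The list \<open>a\<close> holds the pairs of position and sensor sensed so far. The two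
  truncated differences add up to the distance of the positions, which is converted to binary
  because \<tau> may be too large for unary.\<close>

definition sim_ok :: "bool list list list \<Rightarrow> nat \<times> nat \<Rightarrow> (nat \<times> nat) list \<Rightarrow> bool" where
  "sim_ok C y a \<longleftrightarrow> sel False (ent C 5 (tgt_c C (fst y))) (snd y) \<and>
    (\<forall>z \<in> set a. fst z \<noteq> fst y \<and> (snd z = snd y \<longrightarrow> \<not> inf_c C \<and>
      \<not> le_bits (binary ((fst y - fst z) + (fst z - fst y))) (ent C 0 1)))"

definition sim_on :: "bool list list list \<Rightarrow> (nat \<times> nat) list \<Rightarrow> (nat \<times> nat) list" where
  "sim_on C L = fold (\<lambda>y a. if sim_ok C y a then y # a else a) L []"

definition unsensed_c :: "bool list list list \<Rightarrow> nat list" where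
  "unsensed_c C = (let S = sim_on C (sched (num_c C) (width_c C)) in
    filter (\<lambda>i. \<forall>z \<in> set S. fst z \<noteq> i) [1..<num_c C + 1])"

definition total_c :: "bool list list list \<Rightarrow> bool list \<times> bool list" where
  "total_c C = fold frac_step (map (\<lambda>i. (ent C 1 (tgt_c C i), ent C 2 (tgt_c C i))) (unsensed_c C)) ([], [True])"

text \<open>A negative threshold is reached by every ordering; otherwise fractions are compared by
  cross-multiplication.\<close>

definition value_c :: "bool list list list \<Rightarrow> bool" where
  "value_c C \<longleftrightarrow> neg_c C \<or>
    le_bits (mult_bits (ent C 0 4) (snd (total_c C))) (mult_bits (ent C 0 5) (fst (total_c C)))"

text \<open>Nonempty numerators make the values positive and exclude a negative zero, which
  \<open>enc_rat\<close> never writes. Row lengths are compared with the number of sensors in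
  binary, as that number may be large.\<close>

definition static_c :: "bool list list list \<Rightarrow> bool" where
  "static_c C \<longleftrightarrow> canonical (ent C 0 0) \<and> canonical (ent C 0 1) \<and>
    reduced (ent C 0 4) (ent C 0 5) (ent C 0 6) (ent C 0 7) \<and> (neg_c C \<longrightarrow> ent C 0 4 \<noteq> []) \<and>
    (\<forall>i \<in> set [0..<num_c C]. reduced (ent C 1 i) (ent C 2 i) (ent C 3 i) (ent C 4 i) \<and> ent C 1 i \<noteq> [] \<and>
      binary (length (ent C 5 i)) = ent C 0 0)"

definition order_c :: "bool list list list \<Rightarrow> bool" where
  "order_c C \<longleftrightarrow> length (sel [] C 6) = num_c C \<and> (\<forall>t \<in> set [0..<num_c C]. \<exists>w \<in> set (sel [] C 6). length w = t)"

definition restricted_c :: "bool list list list \<Rightarrow> bool" where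
  "restricted_c C \<longleftrightarrow> inf_c C \<and>
    (\<forall>i \<in> set [0..<num_c C]. ent C 1 i = [True] \<and> ent C 2 i = [True] \<and> length (filter (\<lambda>b. b) (ent C 5 i)) \<le> 4) \<and>
    (\<forall>s \<in> set [0..<width_c C]. length (filter (\<lambda>i. sel False (ent C 5 i) s) [0..<num_c C]) \<le> 4)"

definition check :: "bool \<Rightarrow> bool list \<Rightarrow> bool list list list \<Rightarrow> bool" where
  "check res x C \<longleftrightarrow> word_c C = x \<and> static_c C \<and> order_c C \<and> value_c C \<and> (res \<longrightarrow> restricted_c C)"

subsection \<open>The verifier runs in polynomial time\<close>

lemma pt_ent [pt_rules]: "pt f \<Longrightarrow> pt g \<Longrightarrow> pt (\<lambda>x. ent (f x) i (g x))"
  unfolding ent_def by (intro pt_rules)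

lemma pt_num_c [pt_rules]: "pt f \<Longrightarrow> pt (\<lambda>x. num_c (f x))"
  unfolding num_c_def by (intro pt_rules)

lemma pt_width_c [pt_rules]: "pt f \<Longrightarrow> pt (\<lambda>x. width_c (f x))"
  unfolding width_c_def by (intro pt_rules)

lemma pt_inf_c [pt_rules]: "pt f \<Longrightarrow> pt (\<lambda>x. inf_c (f x))"
  unfolding inf_c_def by (intro pt_rules)

lemma pt_neg_c [pt_rules]: "pt f \<Longrightarrow> pt (\<lambda>x. neg_c (f x))"
  unfolding neg_c_def by (intro pt_rules)

lemma pt_tgt_c [pt_rules]: "pt f \<Longrightarrow> pt g \<Longrightarrow> pt (\<lambda>x. tgt_c (f x) (g x))"
  unfolding tgt_c_def by (intro pt_rules)

lemma pt_reduced [pt_rules]: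
  "pt a \<Longrightarrow> pt b \<Longrightarrow> pt u \<Longrightarrow> pt v \<Longrightarrow> pt (\<lambda>x. reduced (a x) (b x) (u x) (v x))"
  unfolding reduced_def by (intro pt_rules)

lemma pt_sched [pt_rules]:
  assumes "pt f" "pt g"
  shows "pt (\<lambda>x. sched (f x) (g x))"
  unfolding sched_def by (intro pt_rules pt_comp[OF assms(1)] pt_comp[OF assms(2)])

lemma pt_fold_select:
  assumes "pt xs" "pt (\<lambda>p. P (fst p) (fst (snd p)) (snd (snd p)))"
  shows "pt (\<lambda>x. fold (\<lambda>y a. if P x y a then y # a else a) (xs x) [])"
proof (rule pt_fold_add[OF assms(1) _ pt_const pt_on_pb_len[OF assms(1)]])
  show "pt (\<lambda>p. if P (fst p) (fst (snd p)) (snd (snd p)) then fst (snd p) # snd (snd p) else snd (snd p))"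
    by (intro pt_rules assms(2))
  show "len (if P x y a then y # a else a) \<le> len a + len (xs x)" if "y \<in> set (xs x)" for x y a
    using len_mem[OF that] by (simp add: len_simps)
qed

lemma pt_sim_on [pt_rules]:
  assumes "pt f" "pt g"
  shows "pt (\<lambda>x. sim_on (f x) (g x))"
  unfolding sim_on_def sim_ok_def
  by (intro pt_fold_select pt_rules assms pt_comp[OF assms(1)])

lemma pt_total_c: "pt total_c"
  unfolding total_c_def[abs_def] unsensed_c_def by (intro pt_rules)

lemma pt_check: "pt (\<lambda>p. check res (fst p) (snd p))"
proof -
  have w: "pt word_c" unfolding word_c_def[abs_def] by (intro pt_rules)
  have s: "pt static_c" unfolding static_c_def[abs_def] by (intro pt_rules)
  have o: "pt order_c" unfolding order_c_def[abs_def] by (intro pt_rules)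
  have v: "pt value_c" unfolding value_c_def[abs_def] by (intro pt_rules pt_lift1[OF pt_total_c])
  have r: "pt restricted_c" unfolding restricted_c_def[abs_def] by (intro pt_rules)
  show ?thesis
    unfolding check_def
    by (intro pt_rules pt_lift1[OF w] pt_lift1[OF s] pt_lift1[OF o] pt_lift1[OF v] pt_lift1[OF r])
qed

text \<open>\<open>delim x\<close> has length \<open>2 * length x + 1\<close>; what follows it is
  the certificate, a list of tables, delimited on two levels.\<close>

definition verifier :: "bool \<Rightarrow> bool list \<Rightarrow> bool list" where
  "verifier res w = (let x = sel [] (segs w) 0 in
    [check res x (map segs (segs (drop (2 * length x + 1) w)))])"

lemma verifier_pair_word: "verifier res (pair_word x u) = [check res x (map segs (segs u))]"
proof -
  have "drop (2 * length x + 1) (pair_word x u) = u" by (simp add: pair_word_def)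
  then show ?thesis by (simp add: verifier_def segs_first pair_word_def)
qed

lemma polytime_verifier: "polytime (verifier res)"
proof -
  have "pt (\<lambda>x. Raw (verifier res (unraw x)))"
    unfolding verifier_def Let_def
    by (intro pt_rules pt_lift2[OF pt_check])
  from polytime_of_pt[OF this] show ?thesis by simp
qed

subsection \<open>The game of a certificate\<close>

definition game_c :: "bool list list list \<Rightarrow> esg" where
  "game_c C = \<lparr>target_values = map (\<lambda>i. fraction (ent C 1 i, ent C 2 i)) [0..<num_c C],
    num_sensors = bits_val (ent C 0 0), recharge = (if inf_c C then \<infinity> else enat (bits_val (ent C 0 1))),
    sensing = map (ent C 5) [0..<num_c C]\<rparr>"

definition threshold_c :: "bool list list list \<Rightarrow> rat" where
  "threshold_c C = (if neg_c C then - fraction (ent C 0 4, ent C 0 5) else fraction (ent C 0 4, ent C 0 5))"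

lemma reducedD:
  assumes "reduced a b u v"
  shows "canonical a" "canonical b" "bits_val b > 0" "coprime (bits_val a) (bits_val b)"
proof -
  have eq: "bits_val v * bits_val b = bits_val u * bits_val a + 1"
    using assms by (simp add: reduced_def)
  show "canonical a" "canonical b" using assms by (simp_all add: reduced_def)
  show "bits_val b > 0" using eq by (cases "bits_val b") auto
  show "coprime (bits_val a) (bits_val b)"
  proof (rule coprimeI)
    fix c assume "c dvd bits_val a" "c dvd bits_val b"
    then have "c dvd bits_val u * bits_val a" "c dvd bits_val u * bits_val a + 1"
      unfolding eq[symmetric] by auto
    then show "is_unit c" using dvd_add_right_iff by blast
  qed
qed

lemma quotient_of_frac:
  assumes "reduced a b u v"
  shows "quotient_of (fraction (a, b)) = (int (bits_val a), int (bits_val b))"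
    "quotient_of (- fraction (a, b)) = (- int (bits_val a), int (bits_val b))"
proof -
  note r = reducedD[OF assms]
  have "fraction (a, b) = Fract (int (bits_val a)) (int (bits_val b))"
    using r(3) by (simp add: fraction_def Fract_of_int_quotient)
  moreover have "- fraction (a, b) = Fract (- int (bits_val a)) (int (bits_val b))"
    using r(3) by (simp add: fraction_def Fract_of_int_quotient)
  moreover have "coprime (int (bits_val a)) (int (bits_val b))" using r(4) by simp
  ultimately show "quotient_of (fraction (a, b)) = (int (bits_val a), int (bits_val b))"
    "quotient_of (- fraction (a, b)) = (- int (bits_val a), int (bits_val b))"
    using r(3) by (simp_all add: quotient_of_Fract normalize_stable)
qed

lemma enc_rat_frac:
  assumes "reduced a b u v"
  shows "enc_rat (fraction (a, b)) = False # delim a @ delim b"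
    "a \<noteq> [] \<Longrightarrow> enc_rat (- fraction (a, b)) = True # delim a @ delim b"
  using quotient_of_frac[OF assms] reducedD[OF assms] bits_val_pos[of a]
  by (simp_all add: enc_rat_def enc_nat_def binary_bits_val)

text \<open>Canonical numbers and reduced fractions are exactly what the encoding produces, so
  encoding the game of the certificate gives back its words unchanged.\<close>

lemma static_game:
  assumes "static_c C"
  shows "wf_esg (game_c C)" "enc_instance (game_c C) (threshold_c C) = word_c C"
proof -
  have red: "reduced (ent C 1 i) (ent C 2 i) (ent C 3 i) (ent C 4 i)" "ent C 1 i \<noteq> []"
    "binary (length (ent C 5 i)) = ent C 0 0" if "i < num_c C" for i
    using assms that by (auto simp: static_c_def)
  have row: "length (ent C 5 i) = bits_val (ent C 0 0)" if "i < num_c C" for i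
    using red(3)[OF that, symmetric] by simp
  have "fraction (ent C 1 i, ent C 2 i) > 0" if "i < num_c C" for i
    using reducedD[OF red(1)[OF that]] bits_val_pos red(2)[OF that] by (simp add: fraction_def)
  then show "wf_esg (game_c C)"
    using row by (auto simp: wf_esg_def game_c_def num_targets_def)
  have vals: "concat (map enc_rat (target_values (game_c C))) =
      concat (map (\<lambda>i. False # delim (ent C 1 i) @ delim (ent C 2 i)) [0..<num_c C])"
    using enc_rat_frac(1)[OF red(1)] by (auto simp: game_c_def intro!: arg_cong[where f = concat])
  have thr: "enc_rat (threshold_c C) = neg_c C # delim (ent C 0 4) @ delim (ent C 0 5)"
    using assms enc_rat_frac by (auto simp: static_c_def threshold_c_def)
  have rest: "num_targets (game_c C) = num_c C" "num_sensors (game_c C) = bits_val (ent C 0 0)"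
    "enc_enat (recharge (game_c C)) = (if inf_c C then [True] else False # delim (ent C 0 1))"
    "concat (sensing (game_c C)) = concat (map (\<lambda>i. ent C 5 i) [0..<num_c C])"
    using assms by (auto simp: num_targets_def game_c_def enc_enat_def enc_nat_def static_c_def binary_bits_val)
  have k: "enc_nat (bits_val (ent C 0 0)) = delim (ent C 0 0)"
    using assms by (simp add: static_c_def enc_nat_def binary_bits_val)
  show "enc_instance (game_c C) (threshold_c C) = word_c C"
    unfolding enc_instance_def word_c_def vals thr rest k by (simp add: enc_nat_def)
qed

lemma restricted_game:
  assumes "static_c C"
  shows "restricted_c C \<longleftrightarrow> restricted_esg (game_c C)"
proof -
  let ?G = "game_c C" and ?n = "num_c C"
  have nt: "targets ?G = {..<?n}" by (simp add: num_targets_def targets_def game_c_def)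
  have red: "reduced (ent C 1 i) (ent C 2 i) (ent C 3 i) (ent C 4 i)" if "i < ?n" for i
    using assms that by (auto simp: static_c_def)
  have row: "length (ent C 5 i) = num_sensors ?G" if "i < ?n" for i
    using assms that bits_val_binary[of "length (ent C 5 i)"] by (auto simp: static_c_def game_c_def)
  have sense: "can_sense ?G s t \<longleftrightarrow> ent C 5 t ! s" if "t < ?n" for s t
    using that by (simp add: can_sense_def game_c_def)
  have one: "fraction (ent C 1 i, ent C 2 i) = 1 \<longleftrightarrow> ent C 1 i = [True] \<and> ent C 2 i = [True]" if "i < ?n" for i
  proof
    assume "fraction (ent C 1 i, ent C 2 i) = 1"
    then have "bits_val (ent C 1 i) = 1" "bits_val (ent C 2 i) = 1"
      using quotient_of_frac(1)[OF red[OF that]] by (simp_all add: quotient_of_number)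
    then show "ent C 1 i = [True] \<and> ent C 2 i = [True]"
      using binary_bits_val[of "ent C 1 i"] binary_bits_val[of "ent C 2 i"] reducedD(1,2)[OF red[OF that]]
      by (simp add: binary.simps)
  qed (simp add: fraction_def)
  have rs: "row_sum ?G t = length (filter (\<lambda>b. b) (ent C 5 t))" if "t < ?n" for t
    using row[OF that] by (simp add: row_sum_def sense[OF that] sensors_def length_filter_conv_card)
  have cs: "col_sum ?G s = length (filter (\<lambda>i. sel False (ent C 5 i) s) [0..<?n])" if "s < num_sensors ?G" for s
  proof -
    have "{t \<in> targets ?G. can_sense ?G s t} = {i. i < length [0..<?n] \<and> sel False (ent C 5 ([0..<?n] ! i)) s}"
      using row that by (auto simp: nt sense sel_def)
    then show ?thesis unfolding col_sum_def length_filter_conv_card by simp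
  qed
  have cols: "(\<forall>s \<in> sensors ?G. col_sum ?G s \<le> 4) \<longleftrightarrow>
      (\<forall>s \<in> set [0..<width_c C]. length (filter (\<lambda>i. sel False (ent C 5 i) s) [0..<?n]) \<le> 4)"
  proof (cases "?n = 0")
    case True
    then show ?thesis by (simp add: col_sum_def nt)
  next
    case False
    then have "num_sensors ?G = width_c C" using row[of 0] by (simp add: width_c_def)
    then show ?thesis using cs by (auto simp: sensors_def)
  qed
  have "recharge ?G = \<infinity> \<longleftrightarrow> inf_c C" by (simp add: game_c_def)
  moreover have "(\<forall>v \<in> set (target_values ?G). v = 1) \<longleftrightarrow>
      (\<forall>i < ?n. ent C 1 i = [True] \<and> ent C 2 i = [True])"
    using one by (auto simp: game_c_def)
  ultimately show ?thesis
    unfolding restricted_c_def restricted_esg_def cols using rs by (auto simp: nt)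
qed

lemma sum_list_eq_sum: "distinct xs \<Longrightarrow> sum_list (map f xs) = sum f (set xs)"
  by (simp add: sum_list_distinct_conv_sum_set)

text \<open>The simulation works with positions, greedy sensing with targets. The bijection
  \<open>tgt_c\<close> translates the schedules, the plans and finally the sets of unsensed targets
  into each other.\<close>

lemma value_iff:
  assumes st: "static_c C" and bij: "bij_betw (tgt_c C) {1..num_c C} {..<num_c C}"
    and ord: "target_ordering (game_c C) \<sigma>" and inv: "\<And>i. 1 \<le> i \<Longrightarrow> i \<le> num_c C \<Longrightarrow> inv_into {..<num_c C} \<sigma> i = tgt_c C i"
  shows "value_c C \<longleftrightarrow> threshold_c C \<le> unsensed_value (game_c C) (greedy_plan (game_c C) \<sigma>)"
proof -
  let ?G = "game_c C" and ?n = "num_c C" and ?k = "width_c C"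
  have nt: "num_targets ?G = ?n" "targets ?G = {..<?n}" by (simp_all add: num_targets_def targets_def game_c_def)
  have red: "reduced (ent C 1 i) (ent C 2 i) (ent C 3 i) (ent C 4 i)" if "i < ?n" for i
    using st that by (auto simp: static_c_def)
  have row: "length (ent C 5 i) = num_sensors ?G" if "i < ?n" for i
    using st that bits_val_binary[of "length (ent C 5 i)"] by (auto simp: static_c_def game_c_def)
  have sens: "sensors ?G = {..<?k}" if "?n > 0"
    using row[OF that] by (simp add: sensors_def width_c_def)
  have tgt: "tgt_c C i < ?n" "\<sigma> (tgt_c C i) = i" if "1 \<le> i" "i \<le> ?n" for i
  proof -
    show "tgt_c C i < ?n" using bij that by (auto simp: bij_betw_def)
    have "i \<in> \<sigma> ` {..<?n}" using ord that by (auto simp: target_ordering_def nt bij_betw_def)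
    from f_inv_into_f[OF this] show "\<sigma> (tgt_c C i) = i" unfolding inv[OF that] .
  qed
  have schedule: "schedule ?G \<sigma> = map (\<lambda>y. (tgt_c C (fst y), snd y)) (sched ?n ?k)"
  proof (cases "?n = 0")
    case True
    then have "set (schedule ?G \<sigma>) = {}" "set (sched ?n ?k) = {}"
      using set_schedule[OF ord] by (auto simp: nt sched_def)
    then show ?thesis by simp
  next
    case False
    then have k: "num_sensors ?G = ?k" using sens by (simp add: sensors_def)
    have "passes ?G \<sigma> l = map (\<lambda>y. (tgt_c C (fst y), snd y)) (concat (map (\<lambda>j. concat (map (\<lambda>i. if i + j = l then [(i, j)] else [])
      [1..<?n + 1])) [0..<?k]))" for l
      unfolding passes_def nt k map_concat map_map comp_def
      by (intro arg_cong[where f = concat] map_cong refl) (auto simp: inv)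
    then have p: "passes ?G \<sigma> = (\<lambda>l. map (\<lambda>y. (tgt_c C (fst y), snd y)) (concat (map (\<lambda>j. concat (map (\<lambda>i. if i + j = l then [(i, j)] else [])
      [1..<?n + 1])) [0..<?k])))"
      by (rule ext)
    show ?thesis
      unfolding schedule_def sched_def nt k p by (simp only: map_concat map_map comp_def)
  qed
  have main: "sensed_upto ?G \<sigma> (map (\<lambda>y. (tgt_c C (fst y), snd y)) L) s = tgt_c C ` {i. (i, s) \<in> set (sim_on C L)} \<and>
      set (sim_on C L) \<subseteq> set L"
    if "set L \<subseteq> {1..?n} \<times> {..<?k}" for L s
    using that
  proof (induction L arbitrary: s rule: rev_induct)
    case Nil
    then show ?case by (simp add: sensed_upto_def sim_on_def)
  next
    case (snoc y L)
    obtain i j where y: "y = (i, j)" by fastforce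
    have ij: "1 \<le> i" "i \<le> ?n" "j < ?k" using snoc.prems y by auto
    then have n0: "?n > 0" by simp
    let ?\<psi> = "sensed_upto ?G \<sigma> (map (\<lambda>y. (tgt_c C (fst y), snd y)) L)" and ?a = "sim_on C L"
    have IH: "?\<psi> s = tgt_c C ` {i. (i, s) \<in> set ?a}" and sub: "set ?a \<subseteq> set L" for s
      using snoc by auto
    have a: "1 \<le> i'" "i' \<le> ?n" "j' < ?k" if "(i', j') \<in> set ?a" for i' j'
      using that sub snoc.prems by auto
    have eq: "tgt_c C i = tgt_c C i' \<longleftrightarrow> i = i'" if "(i', j') \<in> set ?a" for i' j'
      using tgt(2)[OF ij(1,2)] tgt(2)[OF a(1,2)[OF that]] by metis
    have in_psi: "tgt_c C i \<in> ?\<psi> s \<longleftrightarrow> (i, s) \<in> set ?a" for s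
      unfolding IH using eq by auto
    have sim: "sim_on C (L @ [y]) = (if sim_ok C y ?a then y # ?a else ?a)"
      by (simp add: sim_on_def)
    have sense: "can_sense ?G j (tgt_c C i) \<longleftrightarrow> sel False (ent C 5 (tgt_c C i)) j"
      using tgt(1)[OF ij(1,2)] row[OF tgt(1)[OF ij(1,2)]] row[OF n0] ij(3)
      by (simp add: can_sense_def game_c_def sel_def width_c_def)
    have dist: "recharge ?G < enat (nat \<bar>int (\<sigma> (tgt_c C i)) - int (\<sigma> (tgt_c C i'))\<bar>) \<longleftrightarrow>
        \<not> inf_c C \<and> \<not> le_bits (binary ((i - i') + (i' - i))) (ent C 0 1)" if "(i', j') \<in> set ?a" for i' j'
    proof -
      have "nat \<bar>int i - int i'\<bar> = (i - i') + (i' - i)" by simp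
      then show ?thesis
        unfolding tgt(2)[OF ij(1,2)] tgt(2)[OF a(1,2)[OF that]] by (auto simp: game_c_def not_le)
    qed
    have t: "tgt_c C i \<in> targets ?G" "j \<in> sensors ?G"
      using tgt(1)[OF ij(1,2)] ij(3) sens[OF n0] by (simp_all add: nt)
    note ext = extension_iff[OF conjunct1[OF sensed_upto_inv] conjunct2[OF sensed_upto_inv] t, of \<sigma> "map (\<lambda>y. (tgt_c C (fst y), snd y)) L"]
    let ?\<psi>' = "?\<psi>(j := insert (tgt_c C i) (?\<psi> j))"
    have e: "sensed_upto ?G \<sigma> (map (\<lambda>y. (tgt_c C (fst y), snd y)) (L @ [y])) =
        (if sensing_plan ?G ?\<psi>' \<and> valid_plan ?G \<sigma> ?\<psi>' then ?\<psi>' else ?\<psi>)"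
      by (simp add: y sensed_upto_snoc Let_def)
    show ?case
    \<comment> \<open>For a pair that is present already, \<open>sim_ok\<close> fails, while
      extending the plan may be allowed but adds nothing; both sides stay as they are.\<close>
    proof (cases "(i, j) \<in> set ?a")
      case True
      then have "?\<psi>' = ?\<psi>" using in_psi by (simp add: insert_absorb)
      then have e': "sensed_upto ?G \<sigma> (map (\<lambda>y. (tgt_c C (fst y), snd y)) (L @ [y])) = ?\<psi>"
        unfolding e by simp
      have "\<not> sim_ok C y ?a" unfolding sim_ok_def y using True by force
      then have sim': "sim_on C (L @ [y]) = ?a" unfolding sim by simp
      show ?thesis unfolding e' sim' IH using sub by auto
    next
      case False
      have iff: "(sensing_plan ?G ?\<psi>' \<and> valid_plan ?G \<sigma> ?\<psi>') \<longleftrightarrow> sim_ok C y ?a" (is "?L \<longleftrightarrow> ?R")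
      proof
        assume ?L
        then have L: "can_sense ?G j (tgt_c C i)" "\<And>s'. s' \<in> sensors ?G \<Longrightarrow> s' \<noteq> j \<Longrightarrow> tgt_c C i \<notin> ?\<psi> s'"
          "\<And>t'. t' \<in> ?\<psi> j \<Longrightarrow> t' \<noteq> tgt_c C i \<Longrightarrow> recharge ?G < enat (nat \<bar>int (\<sigma> (tgt_c C i)) - int (\<sigma> t')\<bar>)"
          unfolding ext by auto
        have zs: "i' \<noteq> i \<and> (j' = j \<longrightarrow> \<not> inf_c C \<and> \<not> le_bits (binary ((i - i') + (i' - i))) (ent C 0 1))"
          if z: "(i', j') \<in> set ?a" for i' j'
        proof -
          have ne: "i' \<noteq> i"
          proof
            assume "i' = i"
            then have "j' \<noteq> j" "tgt_c C i \<in> ?\<psi> j'" using z False in_psi by auto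
            moreover have "j' \<in> sensors ?G" using a(3)[OF z] sens[OF n0] by simp
            ultimately show False using L(2) by blast
          qed
          moreover have "recharge ?G < enat (nat \<bar>int (\<sigma> (tgt_c C i)) - int (\<sigma> (tgt_c C i'))\<bar>)" if "j' = j"
            by (rule L(3)) (use IH z that ne eq[OF z] in auto)
          ultimately show ?thesis using dist[OF z] by blast
        qed
        have "fst z \<noteq> i \<and> (snd z = j \<longrightarrow> \<not> inf_c C \<and> \<not> le_bits (binary ((i - fst z) + (fst z - i))) (ent C 0 1))"
          if "z \<in> set ?a" for z
          using zs[of "fst z" "snd z"] that unfolding prod.collapse by blast
        then show ?R using L(1) unfolding sense sim_ok_def y fst_conv snd_conv by blast
      next
        assume R: ?R
        have z: "i' \<noteq> i \<and> (j' = j \<longrightarrow> \<not> inf_c C \<and> \<not> le_bits (binary ((i - i') + (i' - i))) (ent C 0 1))"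
          if "(i', j') \<in> set ?a" for i' j'
          using R that unfolding sim_ok_def y by force
        show ?L unfolding ext
        proof (intro conjI ballI impI)
          show "can_sense ?G j (tgt_c C i)" using R sense by (simp add: sim_ok_def y)
          show "tgt_c C i \<notin> ?\<psi> s'" for s' using in_psi z by blast
          fix t' assume "t' \<in> ?\<psi> j" "t' \<noteq> tgt_c C i"
          then obtain i' where i': "t' = tgt_c C i'" "(i', j) \<in> set ?a" unfolding IH by blast
          then show "recharge ?G < enat (nat \<bar>int (\<sigma> (tgt_c C i)) - int (\<sigma> t')\<bar>)"
            using dist[OF i'(2)] z[OF i'(2)] by blast
        qed
      qed
      show ?thesis
      proof (cases "sim_ok C y ?a")
        case True
        then have "sim_on C (L @ [y]) = y # ?a" unfolding sim by simp
        moreover have "sensed_upto ?G \<sigma> (map (\<lambda>y. (tgt_c C (fst y), snd y)) (L @ [y])) = ?\<psi>'"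
          unfolding e iff using True by simp
        moreover have "?\<psi>' s = tgt_c C ` {i. (i, s) \<in> set (y # ?a)}"
          using IH[of s] IH[of j] by (auto simp: y)
        ultimately show ?thesis using sub by auto
      next
        case False
        then have "sim_on C (L @ [y]) = ?a" unfolding sim by simp
        moreover have "sensed_upto ?G \<sigma> (map (\<lambda>y. (tgt_c C (fst y), snd y)) (L @ [y])) = ?\<psi>"
          unfolding e iff using False by simp
        ultimately show ?thesis using IH sub by auto
      qed
    qed
  qed
  have sched: "set (sched ?n ?k) \<subseteq> {1..?n} \<times> {..<?k}" by (auto simp: sched_def)
  have sim: "greedy_plan ?G \<sigma> s = tgt_c C ` {i. (i, s) \<in> set (sim_on C (sched ?n ?k))}"
    "set (sim_on C (sched ?n ?k)) \<subseteq> {1..?n} \<times> {..<?k}" for s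
    unfolding greedy_plan_schedule schedule
    using main[OF sched, of s] sched by (blast, blast)
  have un: "targets ?G - (\<Union>s \<in> sensors ?G. greedy_plan ?G \<sigma> s) = tgt_c C ` set (unsensed_c C)"
  proof (cases "?n = 0")
    case True
    then show ?thesis by (simp add: nt unsensed_c_def)
  next
    case False
    have T: "targets ?G = tgt_c C ` {1..?n}" using bij by (simp add: nt bij_betw_def)
    have inj: "inj_on (tgt_c C) {1..?n}" using bij by (simp add: bij_betw_def)
    have "(\<Union>s \<in> {..<?k}. {i. (i, s) \<in> S}) = fst ` S" if "S \<subseteq> {1..?n} \<times> {..<?k}" for S :: "(nat \<times> nat) set"
      using that by force
    from this[OF sim(2)]
    have "(\<Union>s \<in> sensors ?G. greedy_plan ?G \<sigma> s) = tgt_c C ` fst ` set (sim_on C (sched ?n ?k))"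
      unfolding sens[OF False[unfolded neq0_conv]] sim(1) image_UN[symmetric] by simp
    moreover have "fst ` S \<subseteq> {1..?n}" if "S \<subseteq> {1..?n} \<times> {..<?k}" for S :: "(nat \<times> nat) set"
      using that by force
    note this[OF sim(2)]
    ultimately have "targets ?G - (\<Union>s \<in> sensors ?G. greedy_plan ?G \<sigma> s) =
        tgt_c C ` ({1..?n} - fst ` set (sim_on C (sched ?n ?k)))"
      unfolding T using inj_on_image_set_diff[OF inj, of "{1..?n}"] by simp
    also have "{1..?n} - fst ` set (sim_on C (sched ?n ?k)) = set (unsensed_c C)"
      by (force simp: unsensed_c_def Let_def)
    finally show ?thesis .
  qed
  have su: "set (unsensed_c C) \<subseteq> {1..?n}" by (auto simp: unsensed_c_def Let_def)
  have du: "distinct (unsensed_c C)" by (simp add: unsensed_c_def Let_def)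
  have val: "target_values ?G ! tgt_c C i = fraction (ent C 1 (tgt_c C i), ent C 2 (tgt_c C i))"
    if "i \<in> set (unsensed_c C)" for i
    using tgt(1)[of i] su that by (auto simp: game_c_def)
  have inju: "inj_on (tgt_c C) (set (unsensed_c C))"
    using bij su by (auto simp: bij_betw_def intro: inj_on_subset)
  have "unsensed_value ?G (greedy_plan ?G \<sigma>) = sum_list (map (\<lambda>i. fraction (ent C 1 (tgt_c C i), ent C 2 (tgt_c C i))) (unsensed_c C))"
    unfolding unsensed_value_def un sum.reindex[OF inju] sum_list_eq_sum[OF du] using val by simp
  moreover have "fraction (total_c C) = 0 + sum_list (map (\<lambda>i. fraction (ent C 1 (tgt_c C i), ent C 2 (tgt_c C i))) (unsensed_c C)) \<and>
      bits_val (snd (total_c C)) > 0"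
  proof -
    have "bits_val (snd y) > 0" if "y \<in> set (map (\<lambda>i. (ent C 1 (tgt_c C i), ent C 2 (tgt_c C i))) (unsensed_c C))" for y
      using that su tgt(1) reducedD(3)[OF red] by fastforce
    from frac_fold[of "map (\<lambda>i. (ent C 1 (tgt_c C i), ent C 2 (tgt_c C i))) (unsensed_c C)" "([], [True])"] this
    show ?thesis unfolding total_c_def by (simp add: fraction_def comp_def)
  qed
  ultimately have tot: "fraction (total_c C) = unsensed_value ?G (greedy_plan ?G \<sigma>)" "bits_val (snd (total_c C)) > 0"
    by auto
  have ld: "bits_val (ent C 0 5) > 0" using st reducedD(3) by (auto simp: static_c_def)
  have nonneg: "0 \<le> fraction z" for z by (simp add: fraction_def)
  show ?thesis
  proof (cases "neg_c C")
    case True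
    have "- fraction (ent C 0 4, ent C 0 5) \<le> fraction (total_c C)"
      using nonneg[of "(ent C 0 4, ent C 0 5)"] nonneg[of "total_c C"] by linarith
    then show ?thesis using True tot(1) by (simp add: value_c_def threshold_c_def)
  next
    case False
    have "fraction (ent C 0 4, ent C 0 5) \<le> fraction (total_c C) \<longleftrightarrow>
      bits_val (ent C 0 4) * bits_val (snd (total_c C)) \<le> bits_val (ent C 0 5) * bits_val (fst (total_c C))"
      using ld tot(2) unfolding fraction_def fst_conv snd_conv
      by (simp add: divide_le_eq le_divide_eq pos_divide_le_eq pos_le_divide_eq mult.commute flip: of_nat_mult)
    then show ?thesis using False tot(1) by (simp add: value_c_def threshold_c_def)
  qed
qed

text \<open>A list of \<open>n\<close> numbers in which each of the \<open>n\<close> targets occurs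
  contains each exactly once. Positions start at \<open>1\<close> and list indices at
  \<open>0\<close>, hence the shift.\<close>

lemma order_bij:
  assumes "order_c C"
  shows "bij_betw (tgt_c C) {1..num_c C} {..<num_c C}"
proof -
  define ws where "ws = map length (sel [] C 6)"
  have ws: "length ws = num_c C" using assms by (simp add: ws_def order_c_def)
  have sub: "{..<num_c C} \<subseteq> set ws"
  proof
    fix t assume "t \<in> {..<num_c C}"
    then have "t \<in> set [0..<num_c C]" by simp
    then obtain w where "w \<in> set (sel [] C 6)" "length w = t"
      using assms unfolding order_c_def by blast
    then show "t \<in> set ws" by (auto simp: ws_def)
  qed
  have "card (set ws) \<le> num_c C" using card_length[of ws] ws by simp
  then have eq: "{..<num_c C} = set ws" using card_seteq[OF _ sub] by simp
  then have dist: "distinct ws" using ws by (metis card_distinct card_lessThan)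
  have "bij_betw (\<lambda>i. i - 1) {1..num_c C} {..<num_c C}"
    by (rule bij_betw_byWitness[where f' = Suc]) auto
  moreover have "bij_betw ((!) ws) {..<num_c C} {..<num_c C}"
    using bij_betw_nth[OF dist] ws eq by simp
  ultimately have "bij_betw ((!) ws \<circ> (\<lambda>i. i - 1)) {1..num_c C} {..<num_c C}"
    by (rule bij_betw_trans)
  moreover have "((!) ws \<circ> (\<lambda>i. i - 1)) i = tgt_c C i" if "i \<in> {1..num_c C}" for i
    using that assms by (auto simp: ws_def tgt_c_def ent_def sel_def[of _ "sel [] C 6"] order_c_def)
  ultimately show ?thesis using bij_betw_cong by blast
qed

lemma check_sound:
  assumes "check res x C"
  shows "x \<in> (if res then restricted_BBR else BBR)"
proof -
  let ?n = "num_c C"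
  have st: "static_c C" and x: "x = enc_instance (game_c C) (threshold_c C)"
    using assms static_game(2) by (auto simp: check_def)
  have bij: "bij_betw (tgt_c C) {1..?n} {..<?n}" using assms by (intro order_bij) (simp add: check_def)
  have nt: "targets (game_c C) = {..<?n}" "num_targets (game_c C) = ?n"
    by (simp_all add: num_targets_def targets_def game_c_def)
  define \<sigma> where "\<sigma> = inv_into {1..?n} (tgt_c C)"
  have ord: "target_ordering (game_c C) \<sigma>"
    unfolding target_ordering_def nt \<sigma>_def by (rule bij_betw_inv_into[OF bij])
  have inv: "inv_into {..<?n} \<sigma> i = tgt_c C i" if "1 \<le> i" "i \<le> ?n" for i
    unfolding \<sigma>_def using that by (intro inv_into_inv_into_eq[OF bij]) simp
  have "best_blue_response (game_c C) (threshold_c C)"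
    using value_iff[OF st bij ord inv] ord assms by (auto simp: best_blue_response_def check_def)
  moreover have "restricted_esg (game_c C)" if res
    using assms that restricted_game[OF st] by (simp add: check_def)
  ultimately show ?thesis
    using static_game(1)[OF st] x by (auto simp: BBR_def restricted_BBR_def)
qed

text \<open>The bounds keep certificates short. For \<open>a > 1\<close>, a coefficient is reduced
  modulo \<open>a\<close>, which keeps \<open>v * b\<close> congruent to \<open>1\<close>; then
  \<open>u\<close> is the quotient of \<open>v * b\<close> by \<open>a\<close> and at most
  \<open>b\<close>.\<close>

lemma bezout_bounded:
  fixes a b :: nat
  assumes "coprime a b" "b > 0"
  shows "\<exists>u v. v * b = u * a + 1 \<and> u \<le> b \<and> v \<le> a + 1"
proof -
  consider "a = 0" | "a = 1" | "a > 1" by linarith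
  then show ?thesis
  proof cases
    case 1
    then show ?thesis using assms by (intro exI[of _ 0] exI[of _ 1]) simp
  next
    case 2
    then show ?thesis using assms by (intro exI[of _ "b - 1"] exI[of _ 1]) simp
  next
    case 3
    have "b \<noteq> 0" using assms by simp
    from bezout_nat[OF this, of a] obtain x y where xy: "b * x = a * y + 1"
      using assms(1) by (auto simp: coprime_iff_gcd_eq_1 gcd.commute)
    define v where "v = x mod a"
    have "(b * v) mod a = (b * x) mod a" by (simp add: v_def mod_mult_right_eq)
    also have "\<dots> = 1 mod a" unfolding xy by (metis add.commute mod_mult_self2)
    also have "\<dots> = 1" using 3 by simp
    finally have m: "(v * b) mod a = 1" by (simp add: mult.commute)
    define u where "u = (v * b) div a"
    have eq: "v * b = u * a + 1" using m div_mult_mod_eq[of "v * b" a] by (simp add: u_def)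
    have "v < a" using 3 by (simp add: v_def)
    then have "v * b \<le> a * b" by simp
    then have "u \<le> b" unfolding u_def using 3 by (metis div_le_mono nonzero_mult_div_cancel_left not_one_less_zero)
    then show ?thesis using eq \<open>v < a\<close> by (intro exI[of _ u] exI[of _ v]) simp
  qed
qed

lemma reduced_rat:
  fixes r :: rat
  shows "\<exists>a b u v. reduced a b u v \<and> fraction (a, b) = \<bar>r\<bar> \<and> length u \<le> length b \<and> length v \<le> Suc (length a) \<and> (a = [] \<longleftrightarrow> r = 0)"
proof -
  obtain p q where pq: "quotient_of r = (p, q)" by fastforce
  have q: "q > 0" and cop: "coprime p q"
    using quotient_of_denom_pos[OF pq] quotient_of_coprime[OF pq] by auto
  have r: "r = of_int p / of_int q" by (rule quotient_of_div[OF pq])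
  let ?a = "nat \<bar>p\<bar>" and ?b = "nat q"
  have "coprime (int ?a) (int ?b)" using cop q by simp
  then have cop': "coprime ?a ?b" by simp
  obtain u v where uv: "v * ?b = u * ?a + 1" "u \<le> ?b" "v \<le> ?a + 1"
    using bezout_bounded[OF cop'] q by auto
  have "fraction (binary ?a, binary ?b) = \<bar>r\<bar>"
    using q by (simp add: fraction_def r abs_divide)
  moreover have "reduced (binary ?a) (binary ?b) (binary u) (binary v)"
    using uv(1) by (simp add: reduced_def canonical_binary)
  moreover have "length (binary u) \<le> length (binary ?b)" by (rule length_binary_mono[OF uv(2)])
  moreover have "length (binary v) \<le> Suc (length (binary ?a))"
    using length_binary_mono[OF uv(3)] length_binary_Suc[of ?a] by simp
  moreover have "binary ?a = [] \<longleftrightarrow> r = 0" using q by (simp add: binary_Nil_iff r)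
  ultimately show ?thesis by blast
qed

lemma length_concat_mem: "y \<in> set ys \<Longrightarrow> length y \<le> length (concat ys)"
  by (induction ys) auto

text \<open>The bound \<open>length x + 8\<close>: the first table has eight entries, and
  numerators, denominators and rows occur in \<open>x\<close>. Bezout coefficients are at most one
  bit longer than these, and the words naming targets are shorter than the number of targets or
  equal to it.\<close>

lemma certificate_exists:
  assumes wf: "wf_esg G" and ord: "target_ordering G \<sigma>" and val: "l \<le> unsensed_value G (greedy_plan G \<sigma>)"
    and res: "res \<Longrightarrow> restricted_esg G"
  defines "x \<equiv> enc_instance G l"
  shows "\<exists>C. check res x C \<and> length C = 7 \<and>
    (\<forall>tab \<in> set C. length tab \<le> length x + 8 \<and> (\<forall>w \<in> set tab. length w \<le> length x + 8))"
proof -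
  let ?n = "num_targets G"
  obtain A B U V where rat: "\<And>r :: rat. reduced (A r) (B r) (U r) (V r) \<and> fraction (A r, B r) = \<bar>r\<bar> \<and>
      length (U r) \<le> length (B r) \<and> length (V r) \<le> Suc (length (A r)) \<and> (A r = [] \<longleftrightarrow> r = 0)"
    using reduced_rat by metis
  \<comment> \<open>The empty word, the canonical zero, stands in when the recharging time is
    infinite.\<close>
  define tau where "tau = (case recharge G of enat t \<Rightarrow> binary t | \<infinity> \<Rightarrow> [])"
  define C where "C = [[binary (num_sensors G), tau, [recharge G = \<infinity>], [l < 0], A l, B l, U l, V l],
    map A (target_values G), map B (target_values G), map U (target_values G), map V (target_values G),
    sensing G, map (\<lambda>i. replicate (inv_into (targets G) \<sigma> i) True) [1..<?n + 1]]"
  have C0: "ent C 0 0 = binary (num_sensors G)" "ent C 0 1 = tau" "ent C 0 2 = [recharge G = \<infinity>]"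
    "ent C 0 3 = [l < 0]" "ent C 0 4 = A l" "ent C 0 5 = B l" "ent C 0 6 = U l" "ent C 0 7 = V l"
    by (simp_all add: C_def ent_def sel_def)
  have n: "num_c C = ?n" by (simp add: num_c_def C_def sel_def num_targets_def)
  have Ci: "ent C 1 i = A (target_values G ! i)" "ent C 2 i = B (target_values G ! i)"
    "ent C 3 i = U (target_values G ! i)" "ent C 4 i = V (target_values G ! i)" "ent C 5 i = sensing G ! i"
    if "i < ?n" for i
    using that wf by (simp_all add: C_def ent_def sel_def num_targets_def wf_esg_def)
  have C6: "sel [] C 6 = map (\<lambda>i. replicate (inv_into (targets G) \<sigma> i) True) [1..<?n + 1]"
    by (simp add: C_def sel_def)
  have flags: "inf_c C \<longleftrightarrow> recharge G = \<infinity>" "neg_c C \<longleftrightarrow> l < 0"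
    by (simp_all add: inf_c_def neg_c_def C0)
  have pos: "target_values G ! i > 0" if "i < ?n" for i
    using wf that by (simp add: wf_esg_def num_targets_def)
  have row: "length (sensing G ! i) = num_sensors G" if "i < ?n" for i
    using wf that by (simp add: wf_esg_def)
  have st: "static_c C"
    unfolding static_c_def C0 n flags
  proof (intro conjI ballI impI)
    show "canonical tau" by (cases "recharge G") (simp_all add: tau_def canonical_binary canonical_simps)
    fix i assume "i \<in> set [0..<?n]"
    then have i: "i < ?n" by simp
    show "reduced (ent C 1 i) (ent C 2 i) (ent C 3 i) (ent C 4 i)" unfolding Ci[OF i] using rat by blast
    show "ent C 1 i \<noteq> []" unfolding Ci[OF i] using rat[of "target_values G ! i"] pos[OF i] by simp
    show "binary (length (ent C 5 i)) = binary (num_sensors G)" unfolding Ci[OF i] using row[OF i] by simp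
  qed (use rat[of l] canonical_binary in auto)
  have game: "game_c C = G"
  proof (rule esg.equality)
    have "map (\<lambda>i. fraction (ent C 1 i, ent C 2 i)) [0..<?n] = map (\<lambda>i. target_values G ! i) [0..<?n]"
    proof (rule map_cong[OF refl])
      fix i assume "i \<in> set [0..<?n]"
      then have i: "i < ?n" by simp
      show "fraction (ent C 1 i, ent C 2 i) = target_values G ! i"
        unfolding Ci[OF i] using rat[of "target_values G ! i"] pos[OF i] by simp
    qed
    also have "\<dots> = target_values G" unfolding num_targets_def by (rule map_nth)
    finally show "target_values (game_c C) = target_values G" by (simp add: game_c_def n)
    show "num_sensors (game_c C) = num_sensors G" by (simp add: game_c_def C0)
    show "recharge (game_c C) = recharge G"
      by (cases "recharge G") (simp_all add: game_c_def flags C0(2)[unfolded One_nat_def] tau_def)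
    have "map (ent C 5) [0..<?n] = map (\<lambda>i. sensing G ! i) [0..<?n]" using Ci(5) by simp
    also have "\<dots> = sensing G" using wf map_nth[of "sensing G"] by (simp add: wf_esg_def)
    finally show "sensing (game_c C) = sensing G" by (simp add: game_c_def n)
  qed simp
  have thr: "threshold_c C = l" using rat[of l] by (simp add: threshold_c_def flags C0)
  have x: "word_c C = x" using static_game(2)[OF st] by (simp add: game thr x_def)
  have bij: "bij_betw \<sigma> {..<?n} {1..?n}" using ord by (simp add: target_ordering_def targets_def)
  have tgt: "tgt_c C i = inv_into {..<?n} \<sigma> i" if "1 \<le> i" "i \<le> ?n" for i
  proof -
    have "ent C 6 (i - 1) = replicate (inv_into (targets G) \<sigma> i) True"
      unfolding ent_def C6 using that by (simp add: sel_def del: upt_Suc)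
    then show ?thesis by (simp add: tgt_c_def targets_def)
  qed
  have inv: "bij_betw (inv_into {..<?n} \<sigma>) {1..?n} {..<?n}" by (rule bij_betw_inv_into[OF bij])
  have oc: "order_c C"
    unfolding order_c_def n C6
  proof (intro conjI ballI)
    fix t assume "t \<in> set [0..<?n]"
    then have "t \<in> inv_into {..<?n} \<sigma> ` {1..?n}" using inv by (simp add: bij_betw_def)
    then show "\<exists>w \<in> set (map (\<lambda>i. replicate (inv_into (targets G) \<sigma> i) True) [1..<?n + 1]). length w = t"
      by (auto simp: targets_def simp del: upt_Suc)
  qed simp
  have "value_c C"
    using value_iff[OF st, of \<sigma>] order_bij[OF oc] ord val tgt unfolding n game thr by auto
  then have "check res x C"
    using st oc x res restricted_game[OF st] by (simp add: check_def game)
  moreover have "length tab \<le> length x + 8 \<and> (\<forall>w \<in> set tab. length w \<le> length x + 8)" if tab: "tab \<in> set C" for tab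
  proof -
    let ?vs = "concat (map (\<lambda>i. False # delim (ent C 1 i) @ delim (ent C 2 i)) [0..<?n])"
    let ?rs = "concat (map (\<lambda>i. ent C 5 i) [0..<?n])"
    have lx: "length x = length (delim (binary ?n)) + length (delim (ent C 0 0)) +
        length (if inf_c C then [True] else False # delim tau) + length ?vs + length ?rs +
        Suc (length (delim (A l)) + length (delim (B l)))"
      unfolding x[symmetric] word_c_def n C0 by simp
    have vs: "length (A r) + length (B r) \<le> length ?vs" if r: "r \<in> set (target_values G)" for r
    proof -
      obtain i where i: "i < ?n" "r = target_values G ! i"
        using r unfolding in_set_conv_nth num_targets_def by metis
      have "False # delim (A r) @ delim (B r) \<in> set (map (\<lambda>i. False # delim (ent C 1 i) @ delim (ent C 2 i)) [0..<?n])"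
        unfolding set_map i(2) by (rule image_eqI[of _ _ i]) (use i(1) Ci[OF i(1)] in simp_all)
      from length_concat_mem[OF this] show ?thesis by simp
    qed
    have rs: "length w \<le> length ?rs" if w: "w \<in> set (sensing G)" for w
    proof -
      obtain i where i: "i < ?n" "w = sensing G ! i" using w wf by (auto simp: in_set_conv_nth wf_esg_def)
      then have "w \<in> set (map (\<lambda>i. ent C 5 i) [0..<?n])" using Ci(5)[OF i(1)]
        unfolding set_map by (intro image_eqI[of _ _ i]) simp_all
      from length_concat_mem[OF this] show ?thesis .
    qed
    \<comment> \<open>Each value contributes at least one bit to \<open>x\<close>. So the number of
      targets is at most the length of \<open>x\<close> although it is written in binary, and its
      unary use in the certificate is harmless.\<close>
    have "length (concat (map (\<lambda>i. False # f i) is)) \<ge> length is" for f and "is" :: "nat list"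
      by (induction "is") auto
    from this[of "[0..<?n]"] have nx: "?n \<le> length ?vs" by (simp del: length_concat)
    have tau: "length tau \<le> length x"
      using lx flags by (cases "recharge G") (simp_all add: tau_def)
    have order: "inv_into (targets G) \<sigma> i < ?n" if "i \<in> {1..?n}" for i
      using inv that by (auto simp: bij_betw_def targets_def)
    have A: "length (A r) \<le> length x" "length (B r) \<le> length x"
      if "r = l \<or> r \<in> set (target_values G)" for r
      using that vs[of r] lx by auto
    have UV: "length (U r) \<le> length x" "length (V r) \<le> Suc (length x)"
      if "r = l \<or> r \<in> set (target_values G)" for r
      using rat[of r] A[OF that] by auto
    have k: "length (binary (num_sensors G)) \<le> length x" using lx C0(1) by simp
    have ns: "length (sensing G) = ?n" "length (target_values G) = ?n" using wf by (simp_all add: wf_esg_def num_targets_def)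
    have nx': "?n \<le> length x" using nx lx by linarith
    from tab consider "tab = [binary (num_sensors G), tau, [recharge G = \<infinity>], [l < 0], A l, B l, U l, V l]"
      | "tab = map A (target_values G)" | "tab = map B (target_values G)" | "tab = map U (target_values G)"
      | "tab = map V (target_values G)" | "tab = sensing G"
      | "tab = map (\<lambda>i. replicate (inv_into (targets G) \<sigma> i) True) [1..<?n + 1]"
      unfolding C_def by auto
    then show ?thesis
    proof cases
      case 1
      then show ?thesis using k tau A[of l] UV[of l] by simp
    next
      case 2
      have "length (A r) \<le> length x + 8" if "r \<in> set (target_values G)" for r
        using A(1)[of r] that by simp
      then show ?thesis using 2 nx' ns by auto
    next
      case 3
      have "length (B r) \<le> length x + 8" if "r \<in> set (target_values G)" for r
        using A(2)[of r] that by simp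
      then show ?thesis using 3 nx' ns by auto
    next
      case 4
      have "length (U r) \<le> length x + 8" if "r \<in> set (target_values G)" for r
        using UV(1)[of r] that by simp
      then show ?thesis using 4 nx' ns by auto
    next
      case 5
      have "length (V r) \<le> length x + 8" if "r \<in> set (target_values G)" for r
        using UV(2)[of r] that by simp
      then show ?thesis using 5 nx' ns by auto
    next
      case 6
      have "length w \<le> length x + 8" if "w \<in> set (sensing G)" for w
        using rs[OF that] lx by linarith
      then show ?thesis using 6 nx' ns by auto
    next
      case 7
      have "inv_into (targets G) \<sigma> i \<le> length x + 8" if "i \<in> set [1..<?n + 1]" for i
        using order[of i] that nx' by (simp del: upt_Suc)
      then show ?thesis unfolding 7 using nx' by (simp del: upt_Suc)
    qed
  qed
  ultimately show ?thesis by (intro exI[of _ C]) (simp add: C_def)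
qed

lemma length_concat_delim:
  assumes "\<forall>w \<in> set ws. length w \<le> k"
  shows "length (concat (map delim ws)) \<le> length ws * (2 * k + 1)"
  using assms by (induction ws) auto

lemma NP_membership: "(if res then restricted_BBR else BBR) \<in> NP"
proof -
  let ?L = "if res then restricted_BBR else BBR"
  let ?q = "[:8, 1:] :: nat poly"
  \<comment> \<open>Seven tables of at most \<open>q\<close> words, each word of length at most
    \<open>q\<close>: a table takes \<open>q * (2 * q + 1)\<close> symbols, and delimiting a word of
    length \<open>k\<close> takes \<open>2 * k + 1\<close>.\<close>
  let ?p = "[:7:] * ([:2:] * (?q * ([:2:] * ?q + 1)) + 1)"
  have "x \<in> ?L \<longleftrightarrow> (\<exists>u. length u \<le> poly ?p (length x) \<and> verifier res (pair_word x u) = [True])" for x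
  proof
    assume "x \<in> ?L"
    then obtain G l where G: "x = enc_instance G l" "wf_esg G" "res \<Longrightarrow> restricted_esg G" "best_blue_response G l"
      by (auto simp: BBR_def restricted_BBR_def split: if_splits)
    then obtain \<sigma> where "target_ordering G \<sigma>" "l \<le> unsensed_value G (greedy_plan G \<sigma>)"
      by (auto simp: best_blue_response_def)
    from certificate_exists[OF G(2) this G(3)] obtain C where C: "check res x C" "length C = 7"
      "\<forall>tab \<in> set C. length tab \<le> length x + 8 \<and> (\<forall>w \<in> set tab. length w \<le> length x + 8)"
      unfolding G(1) by blast
    define ws where "ws = map (\<lambda>tab. concat (map delim tab)) C"
    have "length (concat (map delim tab)) \<le> (length x + 8) * (2 * (length x + 8) + 1)" if "tab \<in> set C" for tab
    proof -
      have "length (concat (map delim tab)) \<le> length tab * (2 * (length x + 8) + 1)"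
        by (rule length_concat_delim) (use C(3) that in auto)
      also have "\<dots> \<le> (length x + 8) * (2 * (length x + 8) + 1)"
        by (rule mult_le_mono1) (use C(3) that in auto)
      finally show ?thesis .
    qed
    then have "length (concat (map delim ws)) \<le> length ws * (2 * ((length x + 8) * (2 * (length x + 8) + 1)) + 1)"
      by (intro length_concat_delim) (auto simp: ws_def)
    then have "length (concat (map delim ws)) \<le> poly ?p (length x)"
      using C(2) by (simp add: ws_def algebra_simps)
    moreover have "map segs (segs (concat (map delim ws))) = C"
      unfolding segs_concat by (simp add: ws_def segs_concat comp_def)
    then have "verifier res (pair_word x (concat (map delim ws))) = [True]"
      using C(1) by (simp add: verifier_pair_word)
    ultimately show "\<exists>u. length u \<le> poly ?p (length x) \<and> verifier res (pair_word x u) = [True]" by blast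
  next
    assume "\<exists>u. length u \<le> poly ?p (length x) \<and> verifier res (pair_word x u) = [True]"
    then obtain u where "verifier res (pair_word x u) = [True]" by blast
    then have "check res x (map segs (segs u))" by (simp add: verifier_pair_word)
    then show "x \<in> ?L" by (rule check_sound)
  qed
  then show ?thesis unfolding NP_def using polytime_verifier by blast
qed

theorem theorem6:
  "NP_complete BBR \<and> NP_complete restricted_BBR"
  unfolding NP_complete_def
  using NP_membership[of False] NP_membership[of True] NP_hard_BBR by simp

end
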